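(* Let $d\in\mathbb{N}_+$. There exists a positive integer $T_d$ such that every diffeomorphism $\varphi\in\mathrm{Diff}_0([0,1]^d)$ can be written as a composition of at most $T_d$ flows, i.e. $\varphi=\mathrm{Flow}(V_T)\circ\cdots\circ\mathrm{Flow}(V_1)$ for some $T\le T_d$ and vector fields $V_1,\dots,V_T$, each belonging to $\mathcal{X}^k$ for some $k\in\mathbb{N}\cup\{\infty\}$.
   Context: $\mathrm{Diff}_0([0,1]^d)$ is the set of orientation-preserving $C^\infty$ diffeomorphisms of $\mathbb{R}^d$ that are the identity outside $[0,1]^d$. For $k\in\mathbb{N}_+\cup\{\infty\}$, $\mathcal{X}^k$ is the set of $C^k$ vector fields on $\mathbb{R}^d$ vanishing outside $[0,1]^d$, and $\mathcal{X}^0$ is the set of Lipschitz vector fields on $\mathbb{R}^d$ vanishing outside $[0,1]^d$. For such $V$, $\mathrm{Flow}(V)$ is the time-$1$ map $x\mapsto x_1^x$ of the ODE $\dot x_t^x=V(x_t^x)$, $x_0^x=x$. *)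

theory Defs
  imports "HOL-Analysis.Analysis" "HOL-Library.Extended_Nat"
begin

fun Ck :: "nat \<Rightarrow> ('a::real_normed_vector \<Rightarrow> 'b::real_normed_vector) \<Rightarrow> bool" where
  "Ck 0 f = continuous_on UNIV f"
| "Ck (Suc n) f = ((\<forall>x. f differentiable (at x)) \<and>
                    (\<forall>v. Ck n (\<lambda>x. frechet_derivative f (at x) v)))"

definition smooth :: "('a::real_normed_vector \<Rightarrow> 'b::real_normed_vector) \<Rightarrow> bool" where
  "smooth f \<longleftrightarrow> (\<forall>k. Ck k f)"

definition unit_cube :: "(real^'n) set" where
  "unit_cube = cbox 0 One"

definition Diff0 :: "(real^'n \<Rightarrow> real^'n) set" where
  "Diff0 = {\<phi>. bij \<phi> \<and> smooth \<phi> \<and> smooth (inv \<phi>) \<and>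
               (\<forall>x. det (matrix (frechet_derivative \<phi> (at x))) > 0) \<and>
               (\<forall>x. x \<notin> unit_cube \<longrightarrow> \<phi> x = x)}"

definition VF :: "enat \<Rightarrow> (real^'n \<Rightarrow> real^'n) set" where
  "VF k = {V. (\<forall>x. x \<notin> unit_cube \<longrightarrow> V x = 0) \<and>
              (if k = 0 then (\<exists>C. C-lipschitz_on UNIV V)
               else if k = \<infinity> then smooth V
               else Ck (the_enat k) V)}"

definition Flow :: "(real^'n \<Rightarrow> real^'n) \<Rightarrow> real^'n \<Rightarrow> real^'n" where
  "Flow V x = (THE y. \<exists>\<gamma>::real \<Rightarrow> real^'n. \<gamma> 0 = x \<and> \<gamma> 1 = y \<and>
        (\<forall>t\<in>{0..1}. (\<gamma> has_vector_derivative V (\<gamma> t)) (at t within {0..1})))"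

definition flow_comp :: "(real^'n \<Rightarrow> real^'n) list \<Rightarrow> real^'n \<Rightarrow> real^'n" where
  "flow_comp Vs = foldl (\<lambda>f V. Flow V \<circ> f) id Vs"

end

theory Submission
  imports Defs
begin

text \<open>
  Every field used is Lipschitz. Suppose that a diffeomorphism \<open>\<psi>\<close> is supported in an annulus
  around \<open>p\<close>, and let \<open>S\<close> be the flow of a field contracting a ball linearly to \<open>p\<close> whose
  iterates displace that annulus. If \<open>F\<close> acts on the \<open>n\<close>-th image of the annulus by the copy of
  \<open>\<psi>\<close> rescaled by \<open>exp (- n)\<close>, then \<open>\<psi> = (F \<circ> S \<circ> F\<^sup>-\<^sup>1) \<circ> S\<^sup>-\<^sup>1\<close>, and the
  field generating \<open>F \<circ> S \<circ> F\<^sup>-\<^sup>1\<close> is again Lipschitz: on the \<open>n\<close>-th annulus it differs from the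
  contraction by \<open>W\<^sub>n x = exp (- n) W\<^sub>0 (exp n x)\<close>, and all the \<open>W\<^sub>n\<close> have the same Lipschitz
  constant. So \<open>\<psi>\<close> is a composition of two flows, and the same two flows serve any
  family of diffeomorphisms supported in disjoint balls, with uniform bounds.

  Near the boundary of the cube \<open>u = \<phi> - id\<close> vanishes quadratically, so it may be cut off at the scale
  of Whitney cells without losing the Lipschitz bound on its derivative. The cells fall into finitely many colors, their number
  depending only on the dimension, such that cells of one color are disjoint; removing one color at a time writes the boundary part of
  \<open>\<phi>\<close> as a product of such \<open>\<psi>\<close>. What remains has compact support in the open cube, and
  a contraction flow conjugates it into a small ball.
\<close>

section \<open>Disjointly supported sums and Lipschitz derivatives\<close>

text \<open>The factorization is an infinite swindle: \<open>F\<close> acts by copies of \<psi> at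
  all scales n \<ge> 0, conjugating \<open>F\<close> inverse by \<open>S\<close> undoes the copies
  at scales n \<ge> 1, and only the copy at scale 0 survives. The copies accumulate at
  \<open>p\<close>. Rescaling by exp (- n) keeps first derivatives but multiplies second ones by exp
  n, so a Lipschitz field is what can be hoped for at \<open>p\<close>. \<open>S\<close> has to
  displace the support, so \<open>p\<close> lies beside a cell and not in it; each cell therefore
  needs an enlarged ball around it, and colors must separate these enlarged balls. The number of
  flows must not see \<phi>. Closeness to the identity is used near the boundary, to invert the
  intermediate maps. It is obtained by thinning the layer, and this changes the cells but not the
  number of colors. In the interior the displacement may have any size, since one ball and one
  contraction are enough. Bounds on \<phi> enter the Lipschitz constants of the fields only.\<close>

definition disjoint_sum :: "'j set \<Rightarrow> ('j \<Rightarrow> 'a \<Rightarrow> 'b::comm_monoid_add) \<Rightarrow> 'a \<Rightarrow> 'b" where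
  "disjoint_sum J f x = (\<Sum>j\<in>{j \<in> J. f j x \<noteq> 0}. f j x)"

lemma disjoint_sum_eq_0: "(\<And>i. i \<in> J \<Longrightarrow> f i x = 0) \<Longrightarrow> disjoint_sum J f x = 0"
  unfolding disjoint_sum_def by (rule sum.neutral) auto

lemma disjoint_sum_empty [simp]: "disjoint_sum {} f = (\<lambda>x. 0)"
  by (simp add: disjoint_sum_def fun_eq_iff)

lemma disjoint_sum_eq:
  assumes "j \<in> J" "\<And>i. i \<in> J \<Longrightarrow> i \<noteq> j \<Longrightarrow> f i x = 0"
  shows "disjoint_sum J f x = f j x"
proof (cases "f j x = 0")
  case True
  then have "\<And>i. i \<in> J \<Longrightarrow> f i x = 0" using assms(2) by metis
  then show ?thesis using True by (simp add: disjoint_sum_eq_0)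
next
  case False
  then have "{i \<in> J. f i x \<noteq> 0} = {j}" using assms by auto
  then show ?thesis by (simp add: disjoint_sum_def)
qed

text \<open>If no \<open>Q i\<close> contains \<open>x\<close>, any index serves. At every point the
  sum thus reduces to one summand, possibly zero.\<close>

lemma disjoint_index:
  assumes "J \<noteq> {}" "disjoint_family_on Q J"
  obtains j where "j \<in> J" "\<And>i. i \<in> J \<Longrightarrow> i \<noteq> j \<Longrightarrow> x \<notin> Q i"
proof (cases "\<exists>j\<in>J. x \<in> Q j")
  case True
  then obtain j where "j \<in> J" "x \<in> Q j" by blast
  then show thesis using assms(2) that unfolding disjoint_family_on_def by blast
next
  case False
  then show thesis using assms(1) that by blast
qed

text \<open>Points in different supports cost the factor 2: \<open>f i\<close> vanishes at
  \<open>y\<close> and \<open>f j\<close> at \<open>x\<close>, so the difference is an increment of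
  \<open>f i\<close> plus one of \<open>f j\<close>. Infinite families with touching supports are
  covered.\<close>

lemma disjoint_sum_lipschitz:
  fixes f :: "'j \<Rightarrow> 'a::real_normed_vector \<Rightarrow> 'b::real_normed_vector"
  assumes disj: "disjoint_family_on Q J"
    and supp: "\<And>j x. j \<in> J \<Longrightarrow> x \<notin> Q j \<Longrightarrow> f j x = 0"
    and lip: "\<And>j x y. j \<in> J \<Longrightarrow> norm (f j x - f j y) \<le> L * norm (x - y)"
    and L: "0 \<le> L"
  shows "norm (disjoint_sum J f x - disjoint_sum J f y) \<le> 2 * L * norm (x - y)"
proof (cases "J = {}")
  case True
  then show ?thesis using L by simp
next
  case False
  obtain i where i: "i \<in> J" "\<And>k. k \<in> J \<Longrightarrow> k \<noteq> i \<Longrightarrow> x \<notin> Q k"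
    using disjoint_index[OF False disj, of x] by blast
  obtain j where j: "j \<in> J" "\<And>k. k \<in> J \<Longrightarrow> k \<noteq> j \<Longrightarrow> y \<notin> Q k"
    using disjoint_index[OF False disj, of y] by blast
  have ex: "disjoint_sum J f x = f i x" using i supp by (intro disjoint_sum_eq) auto
  have ey: "disjoint_sum J f y = f j y" using j supp by (intro disjoint_sum_eq) auto
  show ?thesis
  proof (cases "i = j")
    case True
    then have "norm (disjoint_sum J f x - disjoint_sum J f y) \<le> L * norm (x - y)"
      using ex ey lip i by simp
    moreover have "0 \<le> L * norm (x - y)" using L by simp
    ultimately show ?thesis by simp
  next
    case False
    then have "f j x = 0" "f i y = 0" using i j supp by auto
    then have "disjoint_sum J f x - disjoint_sum J f y = (f i x - f i y) + (f j x - f j y)"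
      using ex ey by simp
    then have "norm (disjoint_sum J f x - disjoint_sum J f y) \<le> norm (f i x - f i y) + norm (f j x - f j y)"
      by (metis norm_triangle_ineq)
    then show ?thesis using lip[OF i(1), of x y] lip[OF j(1), of x y] by simp
  qed
qed

text \<open>A segment leaving \<open>S\<close> crosses the frontier, where \<open>f\<close> is zero,
  so the whole increment is already paid inside \<open>S\<close>.\<close>

lemma lipschitz_zero_extension:
  fixes f :: "'a::euclidean_space \<Rightarrow> 'b::real_normed_vector"
  assumes S: "closed S" and L: "0 \<le> L"
    and lip: "\<And>x y. x \<in> S \<Longrightarrow> y \<in> S \<Longrightarrow> norm (f x - f y) \<le> L * norm (x - y)"
    and out: "\<And>x. x \<notin> S \<Longrightarrow> f x = 0" and fr: "\<And>x. x \<in> frontier S \<Longrightarrow> f x = 0"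
  shows "norm (f x - f y) \<le> L * norm (x - y)"
proof -
  have *: "norm (f x) \<le> L * norm (x - y)" if "x \<in> S" "y \<notin> S" for x y
  proof -
    have "closed_segment x y \<inter> frontier S \<noteq> {}"
      using that by (intro connected_Int_frontier) auto
    then obtain z where z: "z \<in> closed_segment x y" "z \<in> frontier S" by blast
    then have "z \<in> S" using S frontier_subset_closed by blast
    then have "norm (f x - f z) \<le> L * norm (x - z)" using lip that by blast
    moreover have "norm (x - z) \<le> norm (x - y)"
      using segment_bound(1)[OF z(1)] by (simp add: norm_minus_commute)
    ultimately show ?thesis using fr[OF z(2)] L
      by (smt (verit) diff_zero mult_left_mono)
  qed
  consider "x \<in> S" "y \<in> S" | "x \<in> S" "y \<notin> S" | "x \<notin> S" "y \<in> S" | "x \<notin> S" "y \<notin> S" by blast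
  then show ?thesis
  proof cases
    case 1 then show ?thesis by (rule lip)
  next
    case 2 then show ?thesis using *[OF 2] out[OF 2(2)] by simp
  next
    case 3 then show ?thesis using *[OF 3(2,1)] out[OF 3(1)] by (simp add: norm_minus_commute)
  next
    case 4 then show ?thesis using out L by simp
  qed
qed

text \<open>The class C^1,1, with the derivative carried explicitly so that its Lipschitz constant
  can be tracked through products, inverses and compositions.\<close>

definition lip_deriv :: "real \<Rightarrow> ('a::real_normed_vector \<Rightarrow> 'b::real_normed_vector) \<Rightarrow> ('a \<Rightarrow> 'a \<Rightarrow> 'b) \<Rightarrow> bool" where
  "lip_deriv a f D \<longleftrightarrow> (\<forall>x. (f has_derivative D x) (at x)) \<and>
     (\<forall>x y h. norm (D x h - D y h) \<le> a * norm (x - y) * norm h)"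

lemma lipschitz_of_derivative_bound:
  fixes f :: "'a::euclidean_space \<Rightarrow> 'b::euclidean_space"
  assumes "convex S" "\<And>x. x \<in> S \<Longrightarrow> (f has_derivative D x) (at x)"
    "\<And>x h. x \<in> S \<Longrightarrow> norm (D x h) \<le> m * norm h" "x \<in> S" "y \<in> S"
  shows "norm (f x - f y) \<le> m * norm (x - y)"
proof (rule differentiable_bound[OF assms(1) _ _ assms(4,5)])
  fix z assume "z \<in> S"
  then show "(f has_derivative D z) (at z within S)" using assms(2) has_derivative_at_withinI by blast
  show "onorm (D z) \<le> m" using assms(3)[OF \<open>z \<in> S\<close>] by (intro onorm_le) auto
qed

text \<open>Mean value inequality for \<open>f - D x\<close> on the ball of radius
  \<open>norm (y - x)\<close>, where the derivative of this difference is at most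
  \<open>a * norm (y - x)\<close>.\<close>

lemma lip_deriv_remainder:
  fixes f :: "'a::euclidean_space \<Rightarrow> 'b::euclidean_space"
  assumes f: "lip_deriv a f D" and a: "0 \<le> a"
  shows "norm (f y - f x - D x (y - x)) \<le> a * norm (y - x) * norm (y - x)"
proof -
  let ?g = "\<lambda>z. f z - D x z" and ?S = "cball x (norm (y - x))"
  have lin: "bounded_linear (D x)" using f unfolding lip_deriv_def by (meson has_derivative_bounded_linear)
  have "norm (?g y - ?g x) \<le> (a * norm (y - x)) * norm (y - x)"
  proof (rule lipschitz_of_derivative_bound[where S = ?S and D = "\<lambda>z h. D z h - D x h"])
    fix z assume z: "z \<in> ?S"
    show "(?g has_derivative (\<lambda>h. D z h - D x h)) (at z)"
      using f lin unfolding lip_deriv_def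
      by (intro has_derivative_diff bounded_linear_imp_has_derivative) auto
    fix h
    have "norm (D z h - D x h) \<le> a * norm (z - x) * norm h" using f unfolding lip_deriv_def by blast
    also have "\<dots> \<le> a * norm (y - x) * norm h"
      using z a by (intro mult_right_mono mult_left_mono) (auto simp: dist_norm norm_minus_commute)
    finally show "norm (D z h - D x h) \<le> a * norm (y - x) * norm h" .
  qed (auto simp: dist_norm norm_minus_commute)
  moreover have "?g y - ?g x = f y - f x - D x (y - x)"
    using linear_diff[OF bounded_linear.linear[OF lin]] by simp
  ultimately show ?thesis by simp
qed

lemma has_derivative_quadratic_remainder:
  fixes f :: "'a::real_normed_vector \<Rightarrow> 'b::real_normed_vector"
  assumes "bounded_linear D" "\<And>y. norm (f y - f x - D (y - x)) \<le> a * norm (y - x) * norm (y - x)"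
  shows "(f has_derivative D) (at x)"
proof -
  have "((\<lambda>y. a * norm (y - x)) \<longlongrightarrow> a * norm (x - x)) (at x)" by (intro tendsto_intros)
  then have lim: "((\<lambda>y. a * norm (y - x)) \<longlongrightarrow> 0) (at x)" by simp
  have "norm ((f y - f x - D (y - x)) /\<^sub>R norm (y - x)) \<le> a * norm (y - x)" for y
    using assms(2)[of y] by (cases "y = x") (auto simp: divide_simps mult_ac)
  then have "eventually (\<lambda>y. norm ((f y - f x - D (y - x)) /\<^sub>R norm (y - x)) \<le> a * norm (y - x)) (at x)"
    by simp
  then have "((\<lambda>y. (f y - f x - D (y - x)) /\<^sub>R norm (y - x)) \<longlongrightarrow> 0) (at x)"
    by (rule Lim_null_comparison[OF _ lim])
  with assms(1) show ?thesis unfolding has_derivative_at_within by blast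
qed

text \<open>No local finiteness is needed: the quadratic remainders of the summands are uniform.\<close>
lemma lip_deriv_disjoint_sum:
  fixes f :: "'j \<Rightarrow> 'a::euclidean_space \<Rightarrow> 'b::euclidean_space"
  assumes disj: "disjoint_family_on Q J"
    and supp: "\<And>j x. j \<in> J \<Longrightarrow> x \<notin> Q j \<Longrightarrow> f j x = 0"
    and suppD: "\<And>j x h. j \<in> J \<Longrightarrow> x \<notin> Q j \<Longrightarrow> D j x h = 0"
    and ld: "\<And>j. j \<in> J \<Longrightarrow> lip_deriv a (f j) (D j)" and a: "0 \<le> a"
  shows "lip_deriv (2 * a) (disjoint_sum J f) (\<lambda>x h. disjoint_sum J (\<lambda>j x. D j x h) x)"
proof (cases "J = {}")
  case True
  then show ?thesis using a by (simp add: lip_deriv_def)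
next
  case False
  have "(disjoint_sum J f has_derivative (\<lambda>h. disjoint_sum J (\<lambda>j x. D j x h) x)) (at x)" for x
  proof -
    obtain i where i: "i \<in> J" "\<And>k. k \<in> J \<Longrightarrow> k \<noteq> i \<Longrightarrow> x \<notin> Q k"
      using disjoint_index[OF False disj, of x] by blast
    have ex: "disjoint_sum J f x = f i x" using i supp by (intro disjoint_sum_eq) auto
    have eD: "(\<lambda>h. disjoint_sum J (\<lambda>j x. D j x h) x) = D i x"
      using i suppD by (intro ext disjoint_sum_eq) auto
    have bl: "bounded_linear (D i x)" using ld[OF i(1)] has_derivative_bounded_linear unfolding lip_deriv_def by blast
    show ?thesis unfolding eD
    proof (rule has_derivative_quadratic_remainder[where a = "2 * a", OF bl])
      fix y
      obtain j where j: "j \<in> J" "\<And>k. k \<in> J \<Longrightarrow> k \<noteq> j \<Longrightarrow> y \<notin> Q k"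
        using disjoint_index[OF False disj, of y] by blast
      have ey: "disjoint_sum J f y = f j y" using j supp by (intro disjoint_sum_eq) auto
      have ri: "norm (f i y - f i x - D i x (y - x)) \<le> a * norm (y - x) * norm (y - x)"
        using lip_deriv_remainder[OF ld[OF i(1)] a] .
      have rj: "norm (f j y - f j x - D j x (y - x)) \<le> a * norm (y - x) * norm (y - x)"
        using lip_deriv_remainder[OF ld[OF j(1)] a] .
      have pos: "0 \<le> a * norm (y - x) * norm (y - x)" using a by simp
      show "norm (disjoint_sum J f y - disjoint_sum J f x - D i x (y - x)) \<le> 2 * a * norm (y - x) * norm (y - x)"
      proof (cases "i = j")
        case True
        then show ?thesis using ex ey ri pos by simp
      next
        case False
        then have "f i y = 0" "f j x = 0" "D j x (y - x) = 0" using i j supp suppD by auto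
        then have "disjoint_sum J f y - disjoint_sum J f x - D i x (y - x)
            = (f i y - f i x - D i x (y - x)) + (f j y - f j x - D j x (y - x))"
          using ex ey by simp
        then have "norm (disjoint_sum J f y - disjoint_sum J f x - D i x (y - x))
            \<le> norm (f i y - f i x - D i x (y - x)) + norm (f j y - f j x - D j x (y - x))"
          by (metis norm_triangle_ineq)
        then show ?thesis using ri rj by linarith
      qed
    qed
  qed
  moreover have "norm (disjoint_sum J (\<lambda>j x. D j x h) x - disjoint_sum J (\<lambda>j x. D j x h) y)
      \<le> 2 * (a * norm h) * norm (x - y)" for x y h
  proof (rule disjoint_sum_lipschitz[OF disj])
    fix j x y assume "j \<in> J"
    then show "norm (D j x h - D j y h) \<le> a * norm h * norm (x - y)"
      using ld unfolding lip_deriv_def by (simp add: mult_ac)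
  qed (use suppD a in auto)
  ultimately show ?thesis unfolding lip_deriv_def by (simp add: mult_ac)
qed

section \<open>Flows and a model contraction\<close>

text \<open>Solutions live on the whole line although \<open>Flow\<close> asks for the unit
  interval; time reversal is then rescaling by a negative factor.\<close>

definition trajectory :: "('a::real_normed_vector \<Rightarrow> 'a) \<Rightarrow> (real \<Rightarrow> 'a) \<Rightarrow> bool" where
  "trajectory V \<gamma> \<longleftrightarrow> (\<forall>t. (\<gamma> has_vector_derivative V (\<gamma> t)) (at t))"

text \<open>Gronwall: \<open>exp (- 2 L t) * norm (\<gamma> t - \<delta> t)\<^sup>2\<close> is nonincreasing.\<close>
lemma lipschitz_ode_unique:
  fixes V :: "'a::euclidean_space \<Rightarrow> 'a"
  assumes lip: "\<And>x y. norm (V x - V y) \<le> L * norm (x - y)"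
    and g: "\<And>t. t \<in> {0..1} \<Longrightarrow> (\<gamma> has_vector_derivative V (\<gamma> t)) (at t within {0..1})"
    and d: "\<And>t. t \<in> {0..1} \<Longrightarrow> (\<delta> has_vector_derivative V (\<delta> t)) (at t within {0..1})"
    and init: "\<gamma> 0 = \<delta> 0"
  shows "\<gamma> 1 = \<delta> 1"
proof -
  define f where "f t = exp (- 2 * L * t) * ((\<gamma> t - \<delta> t) \<bullet> (\<gamma> t - \<delta> t))" for t
  define f' where "f' t = exp (- 2 * L * t) * (2 * ((V (\<gamma> t) - V (\<delta> t)) \<bullet> (\<gamma> t - \<delta> t)))
     + (- 2 * L) * exp (- 2 * L * t) * ((\<gamma> t - \<delta> t) \<bullet> (\<gamma> t - \<delta> t))" for t
  have der: "(f has_real_derivative f' t) (at t within {0..1})" if "t \<in> {0..1}" for t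
  proof -
    have 1: "((\<lambda>t. \<gamma> t - \<delta> t) has_derivative (\<lambda>h. h *\<^sub>R (V (\<gamma> t) - V (\<delta> t)))) (at t within {0..1})"
      using has_vector_derivative_diff[OF g[OF that] d[OF that]] unfolding has_vector_derivative_def .
    have 2: "((\<lambda>t. (\<gamma> t - \<delta> t) \<bullet> (\<gamma> t - \<delta> t)) has_real_derivative 2 * ((V (\<gamma> t) - V (\<delta> t)) \<bullet> (\<gamma> t - \<delta> t))) (at t within {0..1})"
      using has_derivative_inner[OF 1 1] unfolding has_field_derivative_def
      by (rule has_derivative_eq_rhs) (auto simp: inner_commute)
    have 3: "((\<lambda>t. exp (- 2 * L * t)) has_real_derivative (- 2 * L) * exp (- 2 * L * t)) (at t within {0..1})"
      by (auto intro!: derivative_eq_intros)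
    show ?thesis unfolding f_def f'_def
      using DERIV_mult'[OF 3 2] by simp
  qed
  have nonpos: "f' t \<le> 0" for t
  proof -
    have "(V (\<gamma> t) - V (\<delta> t)) \<bullet> (\<gamma> t - \<delta> t) \<le> norm (V (\<gamma> t) - V (\<delta> t)) * norm (\<gamma> t - \<delta> t)"
      by (rule norm_cauchy_schwarz)
    also have "\<dots> \<le> L * norm (\<gamma> t - \<delta> t) * norm (\<gamma> t - \<delta> t)"
      using lip by (intro mult_right_mono) auto
    also have "\<dots> = L * ((\<gamma> t - \<delta> t) \<bullet> (\<gamma> t - \<delta> t))"
      by (simp add: dot_square_norm power2_eq_square)
    finally have "exp (- 2 * L * t) * (2 * ((V (\<gamma> t) - V (\<delta> t)) \<bullet> (\<gamma> t - \<delta> t)))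
      \<le> exp (- 2 * L * t) * (2 * (L * ((\<gamma> t - \<delta> t) \<bullet> (\<gamma> t - \<delta> t))))"
      by (intro mult_left_mono) auto
    then show ?thesis unfolding f'_def by (simp add: algebra_simps)
  qed
  have "f 1 \<le> f 0"
  proof (rule DERIV_nonpos_imp_decreasing_open[of 0 1 f])
    fix t :: real assume t: "0 < t" "t < 1"
    then have "(f has_real_derivative f' t) (at t)" using der[of t] at_within_Icc_at[of 0 t 1] by simp
    then show "\<exists>y. (f has_real_derivative y) (at t) \<and> y \<le> 0" using nonpos[of t] by (intro exI conjI)
  next
    show "continuous_on {0..1} f" unfolding continuous_on_eq_continuous_within using DERIV_continuous[OF der] by (rule ballI)
  qed simp
  then have "exp (- 2 * L) * (norm (\<gamma> 1 - \<delta> 1))\<^sup>2 \<le> 0"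
    using init by (simp add: f_def dot_square_norm)
  then have "(norm (\<gamma> 1 - \<delta> 1))\<^sup>2 \<le> 0"
    by (simp add: mult_le_0_iff not_le[symmetric])
  then show ?thesis by simp
qed

lemma Flow_eqI:
  fixes V :: "real^'n \<Rightarrow> real^'n"
  assumes "\<And>x y. norm (V x - V y) \<le> L * norm (x - y)" "trajectory V \<gamma>" "\<gamma> 0 = x" "\<gamma> 1 = y"
  shows "Flow V x = y"
  unfolding Flow_def
proof (rule the_equality)
  have sol: "\<forall>t\<in>{0..1}. (\<gamma> has_vector_derivative V (\<gamma> t)) (at t within {0..1})"
    using assms(2) has_vector_derivative_at_within unfolding trajectory_def by blast
  then show "\<exists>\<gamma>::real \<Rightarrow> real^'n. \<gamma> 0 = x \<and> \<gamma> 1 = y \<and>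
        (\<forall>t\<in>{0..1}. (\<gamma> has_vector_derivative V (\<gamma> t)) (at t within {0..1}))"
    using assms(3,4) by blast
  fix z assume "\<exists>\<gamma>::real \<Rightarrow> real^'n. \<gamma> 0 = x \<and> \<gamma> 1 = z \<and>
        (\<forall>t\<in>{0..1}. (\<gamma> has_vector_derivative V (\<gamma> t)) (at t within {0..1}))"
  then show "z = y"
    using lipschitz_ode_unique[OF assms(1)] sol assms(3,4) by metis
qed

section \<open>The scalar equation for the radius, solved in closed form\<close>

definition cutoff :: "real \<Rightarrow> real \<Rightarrow> real" where
  "cutoff \<eta> r = max 0 (min 1 ((1 - r) / \<eta>))"

text \<open>Solves \<open>E' = E * cutoff \<eta> E\<close>: exponential up to the value \<open>1 - \<eta>\<close>, logistic beyond it.\<close>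
definition growth :: "real \<Rightarrow> real \<Rightarrow> real" where
  "growth \<eta> \<tau> = (if \<tau> \<le> 0 then (1 - \<eta>) * exp \<tau> else 1 / (1 + \<eta> / (1 - \<eta>) * exp (- \<tau> / \<eta>)))"

text \<open>The time at which \<open>growth\<close> passes \<open>r\<close> in (0, 1); in this
  coordinate the contraction is a translation.\<close>

definition growth_inv :: "real \<Rightarrow> real \<Rightarrow> real" where
  "growth_inv \<eta> r = (if r \<le> 1 - \<eta> then ln (r / (1 - \<eta>)) else - \<eta> * ln ((1 - r) / r * ((1 - \<eta>) / \<eta>)))"

context
  fixes \<eta> :: real
  assumes \<eta>: "0 < \<eta>" "\<eta> < 1"
begin

lemma growth_pos: "0 < growth \<eta> \<tau>"
proof -
  have "0 < 1 + \<eta> / (1 - \<eta>) * exp (- \<tau> / \<eta>)" using \<eta> by (intro add_pos_pos mult_pos_pos) auto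
  then show ?thesis using \<eta> by (simp add: growth_def)
qed

lemma growth_le_iff: "growth \<eta> \<tau> \<le> 1 - \<eta> \<longleftrightarrow> \<tau> \<le> 0"
proof (cases "\<tau> \<le> 0")
  case True
  then show ?thesis using \<eta> by (simp add: growth_def mult_left_le)
next
  case False
  have "exp (- \<tau> / \<eta>) < 1" using False \<eta> by simp
  then have "\<eta> / (1 - \<eta>) * exp (- \<tau> / \<eta>) < \<eta> / (1 - \<eta>) * 1"
    using \<eta> by (intro mult_strict_left_mono) auto
  then have "1 + \<eta> / (1 - \<eta>) * exp (- \<tau> / \<eta>) < 1 / (1 - \<eta>)" using \<eta> by (simp add: field_simps)
  moreover have "0 < 1 + \<eta> / (1 - \<eta>) * exp (- \<tau> / \<eta>)" using \<eta> by (intro add_pos_pos mult_pos_pos) auto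
  ultimately have "1 - \<eta> < 1 / (1 + \<eta> / (1 - \<eta>) * exp (- \<tau> / \<eta>))"
    using \<eta> by (simp add: field_simps)
  then show ?thesis using False by (simp add: growth_def)
qed

lemma growth_less_1: "growth \<eta> \<tau> < 1"
proof (cases "\<tau> \<le> 0")
  case True
  then show ?thesis using growth_le_iff[of \<tau>] \<eta> by simp
next
  case False
  have "0 < \<eta> / (1 - \<eta>) * exp (- \<tau> / \<eta>)" using \<eta> by simp
  then show ?thesis using False by (simp add: growth_def)
qed

lemma growth_inv_growth: "growth_inv \<eta> (growth \<eta> \<tau>) = \<tau>"
proof (cases "\<tau> \<le> 0")
  case True
  then show ?thesis using growth_le_iff[of \<tau>] \<eta> by (simp add: growth_inv_def) (simp add: growth_def)
next
  case False
  define e where "e = exp (- \<tau> / \<eta>)"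
  have e: "0 < e" by (simp add: e_def)
  define q where "q = \<eta> / (1 - \<eta>)"
  have q: "0 < q" "(1 - \<eta>) / \<eta> = 1 / q" using \<eta> by (auto simp: q_def)
  have g: "growth \<eta> \<tau> = 1 / (1 + q * e)" using False by (simp add: growth_def e_def q_def)
  have "0 < 1 + q * e" using q e by (simp add: add_pos_pos)
  moreover from this have "1 - 1 / (1 + q * e) = q * e / (1 + q * e)" by (simp add: field_simps)
  ultimately have "(1 - growth \<eta> \<tau>) / growth \<eta> \<tau> * ((1 - \<eta>) / \<eta>) = e"
    using q(1) unfolding g q(2) by simp
  then show ?thesis using False growth_le_iff[of \<tau>] \<eta> by (simp add: growth_inv_def e_def)
qed

lemma growth_growth_inv:
  assumes "0 < r" "r < 1"
  shows "growth \<eta> (growth_inv \<eta> r) = r"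
proof (cases "r \<le> 1 - \<eta>")
  case True
  then have "growth_inv \<eta> r = ln (r / (1 - \<eta>))" "ln (r / (1 - \<eta>)) \<le> 0"
    using assms \<eta> by (auto simp: growth_inv_def)
  then show ?thesis using assms \<eta> by (simp add: growth_def)
next
  case False
  define z where "z = (1 - r) / r * ((1 - \<eta>) / \<eta>)"
  have zeq: "z = ((1 - r) * (1 - \<eta>)) / (r * \<eta>)" by (simp add: z_def)
  have "(1 - r) * (1 - \<eta>) < r * \<eta>" using False by (simp add: algebra_simps)
  then have z: "0 < z" "z < 1" using assms \<eta> unfolding zeq by (auto simp: divide_simps)
  have i: "growth_inv \<eta> r = - \<eta> * ln z" using False by (simp add: growth_inv_def z_def)
  have "\<eta> * ln z < 0" using z \<eta> by (simp add: mult_pos_neg)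
  then have "growth \<eta> (growth_inv \<eta> r) = 1 / (1 + \<eta> / (1 - \<eta>) * z)"
    using z \<eta> by (simp add: i growth_def)
  also have "\<eta> / (1 - \<eta>) * z = (1 - r) / r" using \<eta> by (simp add: z_def)
  also have "1 / (1 + (1 - r) / r) = r" using assms by (simp add: field_simps)
  finally show ?thesis .
qed

text \<open>The branches are glued along closed half-lines at 0, where both have value and slope
  \<open>1 - \<eta>\<close>; the equation thus holds also at the corner of
  \<open>cutoff\<close>.\<close>

lemma growth_deriv: "(growth \<eta> has_real_derivative growth \<eta> \<tau> * cutoff \<eta> (growth \<eta> \<tau>)) (at \<tau>)"
proof -
  let ?f = "\<lambda>\<tau>. (1 - \<eta>) * exp \<tau>" and ?g = "\<lambda>\<tau>. 1 / (1 + \<eta> / (1 - \<eta>) * exp (- \<tau> / \<eta>))"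
  have pos: "0 < 1 + \<eta> / (1 - \<eta>) * exp (- \<tau> / \<eta>)" for \<tau> using \<eta> by (intro add_pos_pos mult_pos_pos) auto
  have f: "(?f has_real_derivative ?f \<tau>) (at \<tau> within S)" for \<tau> S
    by (auto intro!: derivative_eq_intros)
  have g: "(?g has_real_derivative ?g \<tau> * ((1 - ?g \<tau>) / \<eta>)) (at \<tau> within S)" for \<tau> S
  proof -
    define c where "c = \<eta> / (1 - \<eta>)"
    let ?P = "\<lambda>\<tau>. 1 + c * exp (- \<tau> / \<eta>)"
    have P: "0 < ?P \<tau>" using pos[of \<tau>] by (simp add: c_def)
    have "((\<lambda>\<tau>. - \<tau> / \<eta>) has_real_derivative - 1 / \<eta>) (at \<tau> within S)"
      by (intro DERIV_cdivide DERIV_minus DERIV_ident)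
    from DERIV_add[OF DERIV_const DERIV_cmult[OF DERIV_chain2[OF DERIV_exp this]]]
    have "(?P has_real_derivative - (?P \<tau> - 1) / \<eta>) (at \<tau> within S)" by simp
    from DERIV_inverse_fun[OF this] P
    have "((\<lambda>\<tau>. inverse (?P \<tau>)) has_real_derivative - (- (?P \<tau> - 1) / \<eta> * inverse ((?P \<tau>) ^ Suc (Suc 0)))) (at \<tau> within S)"
      by simp
    note inv_deriv = this
    have eq: "- (- (x - 1) / \<eta> * inverse (x ^ Suc (Suc 0))) = 1 / x * ((1 - 1 / x) / \<eta>)" if "0 < x" for x
      using that \<eta> by (simp add: divide_simps)
    have "((\<lambda>\<tau>. inverse (?P \<tau>)) has_real_derivative 1 / ?P \<tau> * ((1 - 1 / ?P \<tau>) / \<eta>)) (at \<tau> within S)"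
      using inv_deriv unfolding eq[OF P] .
    then show ?thesis by (simp only: c_def inverse_eq_divide)
  qed
  have cf: "growth \<eta> \<tau> * cutoff \<eta> (growth \<eta> \<tau>) = (if \<tau> \<in> {..0} then ?f \<tau> else ?g \<tau> * ((1 - ?g \<tau>) / \<eta>))"
  proof (cases "\<tau> \<le> 0")
    case True
    have "1 \<le> (1 - growth \<eta> \<tau>) / \<eta>" using True growth_le_iff[of \<tau>] \<eta> by (simp add: field_simps)
    then have "cutoff \<eta> (growth \<eta> \<tau>) = 1" by (simp add: cutoff_def)
    then show ?thesis using True by (simp add: growth_def)
  next
    case False
    have "(1 - growth \<eta> \<tau>) / \<eta> \<le> 1" using False growth_le_iff[of \<tau>] \<eta> by (simp add: field_simps)
    moreover have "0 \<le> (1 - growth \<eta> \<tau>) / \<eta>" using growth_less_1[of \<tau>] \<eta> by simp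
    ultimately have "cutoff \<eta> (growth \<eta> \<tau>) = (1 - growth \<eta> \<tau>) / \<eta>" by (simp add: cutoff_def)
    then show ?thesis using False by (simp add: growth_def)
  qed
  have g0: "?g 0 = 1 - \<eta>" using \<eta> by (simp add: field_simps)
  have "((\<lambda>\<tau>. if \<tau> \<in> {..0} then ?f \<tau> else ?g \<tau>) has_vector_derivative
      (if \<tau> \<in> {..0} then ?f \<tau> else ?g \<tau> * ((1 - ?g \<tau>) / \<eta>))) (at \<tau> within UNIV)"
  proof (rule has_vector_derivative_If_within_closures[where T = "{0..}"])
    show "\<tau> \<in> {..0} \<union> closure {..0} \<inter> closure {0::real..} \<Longrightarrow>
      (?f has_vector_derivative ?f \<tau>) (at \<tau> within {..0} \<union> closure {..0} \<inter> closure {0..})"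
      using f by (simp add: has_real_derivative_iff_has_vector_derivative)
    show "\<tau> \<in> {0..} \<union> closure {..0} \<inter> closure {0::real..} \<Longrightarrow>
      (?g has_vector_derivative ?g \<tau> * ((1 - ?g \<tau>) / \<eta>)) (at \<tau> within {0..} \<union> closure {..0} \<inter> closure {0..})"
      using g by (simp add: has_real_derivative_iff_has_vector_derivative)
    show "\<tau> \<in> closure {..0} \<Longrightarrow> \<tau> \<in> closure {0..} \<Longrightarrow> ?f \<tau> = ?g \<tau>"
    proof -
      assume "\<tau> \<in> closure {..0}" "\<tau> \<in> closure {0..}"
      then have "\<tau> = 0" by simp
      then show "?f \<tau> = ?g \<tau>" using g0 by simp
    qed
    show "\<tau> \<in> closure {..0} \<Longrightarrow> \<tau> \<in> closure {0..} \<Longrightarrow> ?f \<tau> = ?g \<tau> * ((1 - ?g \<tau>) / \<eta>)"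
    proof -
      assume "\<tau> \<in> closure {..0}" "\<tau> \<in> closure {0..}"
      then have "\<tau> = 0" by simp
      then show "?f \<tau> = ?g \<tau> * ((1 - ?g \<tau>) / \<eta>)" unfolding \<open>\<tau> = 0\<close> g0 using \<eta> by simp
    qed
  qed auto
  then show ?thesis unfolding cf has_real_derivative_iff_has_vector_derivative
    by (simp add: growth_def[abs_def])
qed

end

section \<open>Time change and affine conjugation of trajectories\<close>

lemma trajectory_rescale:
  assumes "trajectory V \<gamma>"
  shows "trajectory (\<lambda>x. c *\<^sub>R V x) (\<lambda>t. \<gamma> (c * t))"
  unfolding trajectory_def
proof
  fix t
  have "((\<lambda>t. c * t) has_vector_derivative c) (at t)"
    by (auto intro!: derivative_eq_intros simp flip: has_real_derivative_iff_has_vector_derivative)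
  moreover have "(\<gamma> has_vector_derivative V (\<gamma> (c * t))) (at (c * t))"
    using assms unfolding trajectory_def by blast
  ultimately show "((\<lambda>t. \<gamma> (c * t)) has_vector_derivative c *\<^sub>R V (\<gamma> (c * t))) (at t)"
    using vector_diff_chain_at[of "\<lambda>t. c * t" c t \<gamma>] by (simp add: o_def)
qed

lemma trajectory_affine:
  assumes "trajectory V \<gamma>" "R \<noteq> 0"
  shows "trajectory (\<lambda>x. R *\<^sub>R V ((1 / R) *\<^sub>R (x - p))) (\<lambda>t. p + R *\<^sub>R \<gamma> t)"
  unfolding trajectory_def
proof
  fix t
  have "(\<gamma> has_vector_derivative V (\<gamma> t)) (at t)"
    using assms unfolding trajectory_def by blast
  then have "((\<lambda>t. p + R *\<^sub>R \<gamma> t) has_vector_derivative 0 + R *\<^sub>R V (\<gamma> t)) (at t)"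
    by (intro has_vector_derivative_add has_vector_derivative_const bounded_linear.has_vector_derivative[OF bounded_linear_scaleR_right])
  then show "((\<lambda>t. p + R *\<^sub>R \<gamma> t) has_vector_derivative R *\<^sub>R V ((1 / R) *\<^sub>R (p + R *\<^sub>R \<gamma> t - p))) (at t)"
    using assms(2) by simp
qed

lemma trajectory_const: "V x = 0 \<Longrightarrow> trajectory V (\<lambda>t. x)"
  by (simp add: trajectory_def)

text \<open>Two gauges are used: the norm, for contractions of round balls, and twice the sup norm,
  whose closed unit ball is the cube moved to the origin. \<open>C\<close> and \<open>M\<close>
  compare the gauge with the norm.\<close>

locale radial_gauge =
  fixes N :: "'a::euclidean_space \<Rightarrow> real" and \<eta> C M :: real
  assumes \<eta>: "0 < \<eta>" "\<eta> < 1"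
    and N_nonneg: "0 \<le> N x"
    and N_scale: "0 \<le> c \<Longrightarrow> N (c *\<^sub>R x) = c * N x"
    and N_lip: "\<bar>N x - N y\<bar> \<le> C * norm (x - y)"
    and norm_le_N: "norm x \<le> M * N x" and M_nonneg: "0 \<le> M" and C_nonneg: "0 \<le> C"
begin

definition contraction :: "'a \<Rightarrow> 'a" where
  "contraction x = - cutoff \<eta> (N x) *\<^sub>R x"

text \<open>Along a ray the gauge \<open>r\<close> satisfies
  \<open>r' = - r * cutoff \<eta> r\<close>, the time reversal of the equation solved by
  \<open>growth\<close>.\<close>

definition contraction_flow :: "real \<Rightarrow> 'a \<Rightarrow> 'a" where
  "contraction_flow t x =
    (if 0 < N x \<and> N x < 1 then (growth \<eta> (growth_inv \<eta> (N x) - t) / N x) *\<^sub>R x else x)"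

lemma N_eq_0: "N x = 0 \<longleftrightarrow> x = 0"
  using norm_le_N[of x] N_scale[of 0 x] by auto

lemma contraction_linear: "N x \<le> 1 - \<eta> \<Longrightarrow> contraction x = - x"
  using \<eta> by (simp add: contraction_def cutoff_def field_simps)

lemma contraction_outside: "1 \<le> N x \<Longrightarrow> contraction x = 0"
  using \<eta> by (simp add: contraction_def cutoff_def divide_le_0_iff)

lemma contraction_0: "contraction 0 = 0"
  by (simp add: contraction_def)

lemma cutoff_lipschitz: "\<bar>cutoff \<eta> r - cutoff \<eta> s\<bar> \<le> \<bar>r - s\<bar> / \<eta>"
proof -
  have "\<bar>(1 - r) / \<eta> - (1 - s) / \<eta>\<bar> = \<bar>r - s\<bar> / \<eta>"
    using \<eta> by (simp add: diff_divide_distrib[symmetric] abs_minus_commute)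
  then show ?thesis unfolding cutoff_def by linarith
qed

text \<open>The product is split so that the increment of the cutoff multiplies a point of gauge
  below 1, whose norm is at most \<open>M\<close>; if neither point is such, both values
  vanish.\<close>

lemma contraction_lipschitz: "norm (contraction x - contraction y) \<le> (1 + C * M / \<eta>) * norm (x - y)"
proof -
  have *: "norm (contraction x - contraction y) \<le> (1 + C * M / \<eta>) * norm (x - y)" if "N y < 1" for x y
  proof -
    have "contraction x - contraction y
      = (cutoff \<eta> (N y) - cutoff \<eta> (N x)) *\<^sub>R y - cutoff \<eta> (N x) *\<^sub>R (x - y)"
      by (simp add: contraction_def algebra_simps)
    then have "norm (contraction x - contraction y)
      \<le> \<bar>cutoff \<eta> (N y) - cutoff \<eta> (N x)\<bar> * norm y + \<bar>cutoff \<eta> (N x)\<bar> * norm (x - y)"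
      by (metis norm_scaleR norm_triangle_ineq4)
    moreover have "\<bar>cutoff \<eta> (N x)\<bar> * norm (x - y) \<le> 1 * norm (x - y)"
      by (intro mult_right_mono) (auto simp: cutoff_def)
    moreover have "\<bar>cutoff \<eta> (N y) - cutoff \<eta> (N x)\<bar> * norm y \<le> (C * norm (x - y) / \<eta>) * M"
    proof (rule mult_mono)
      have "\<bar>cutoff \<eta> (N y) - cutoff \<eta> (N x)\<bar> \<le> \<bar>N y - N x\<bar> / \<eta>" by (rule cutoff_lipschitz)
      also have "\<dots> \<le> C * norm (x - y) / \<eta>"
        using N_lip[of x y] \<eta> by (intro divide_right_mono) (auto simp: abs_minus_commute)
      finally show "\<bar>cutoff \<eta> (N y) - cutoff \<eta> (N x)\<bar> \<le> C * norm (x - y) / \<eta>" .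
      have "norm y \<le> M * N y" by (rule norm_le_N)
      also have "\<dots> \<le> M * 1" using that M_nonneg by (intro mult_left_mono) auto
      finally show "norm y \<le> M" by simp
    qed (use C_nonneg \<eta> in auto)
    ultimately show ?thesis by (simp add: algebra_simps)
  qed
  show ?thesis
  proof (cases "N x < 1 \<or> N y < 1")
    case True
    then show ?thesis using *[of y x] *[of x y] by (auto simp: norm_minus_commute)
  next
    case False
    have "0 \<le> 1 + C * M / \<eta>" using C_nonneg M_nonneg \<eta> by simp
    then show ?thesis using False by (simp add: contraction_outside)
  qed
qed

lemma N_contraction_flow:
  "0 < N x \<Longrightarrow> N x < 1 \<Longrightarrow> N (contraction_flow t x) = growth \<eta> (growth_inv \<eta> (N x) - t)"
  using growth_pos[OF \<eta>, of "growth_inv \<eta> (N x) - t"] by (simp add: contraction_flow_def N_scale)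

lemma contraction_flow_outside: "1 \<le> N x \<Longrightarrow> contraction_flow t x = x"
  by (simp add: contraction_flow_def)

lemma contraction_flow_0: "contraction_flow t 0 = 0"
  by (simp add: contraction_flow_def)

lemma N_contraction_flow_less:
  assumes "N x < 1"
  shows "N (contraction_flow t x) < 1"
proof (cases "N x = 0")
  case True
  then show ?thesis by (simp add: contraction_flow_def)
next
  case False
  then have "0 < N x" using N_nonneg[of x] by linarith
  then show ?thesis using assms by (simp add: N_contraction_flow growth_less_1[OF \<eta>])
qed

lemma contraction_flow_eq_0: "contraction_flow t x = 0 \<longleftrightarrow> x = 0"
  using growth_pos[OF \<eta>, of "growth_inv \<eta> (N x) - t"] by (auto simp: contraction_flow_def)

lemma contraction_flow_add: "contraction_flow s (contraction_flow t x) = contraction_flow (s + t) x"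
proof (cases "0 < N x \<and> N x < 1")
  case True
  let ?T = "growth_inv \<eta> (N x)"
  have e: "contraction_flow t x = (growth \<eta> (?T - t) / N x) *\<^sub>R x" using True by (simp add: contraction_flow_def)
  have n: "N (contraction_flow t x) = growth \<eta> (?T - t)" using True by (simp add: N_contraction_flow)
  have "0 < N (contraction_flow t x) \<and> N (contraction_flow t x) < 1"
    unfolding n using growth_pos[OF \<eta>] growth_less_1[OF \<eta>] by blast
  then have "contraction_flow s (contraction_flow t x) = (growth \<eta> (?T - t - s) / growth \<eta> (?T - t)) *\<^sub>R contraction_flow t x"
    by (simp add: contraction_flow_def[of s "contraction_flow t x"] n growth_inv_growth[OF \<eta>])
  also have "\<dots> = (growth \<eta> (?T - (s + t)) / N x) *\<^sub>R x"
    using growth_pos[OF \<eta>, of "?T - t"] by (simp add: e algebra_simps)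
  finally show ?thesis using True by (simp add: contraction_flow_def)
next
  case False
  then have "contraction_flow t x = x" for t unfolding contraction_flow_def by presburger
  then show ?thesis by metis
qed

lemma contraction_flow_at_0: "contraction_flow 0 x = x"
  by (simp add: contraction_flow_def growth_growth_inv[OF \<eta>])

lemma contraction_flow_linear:
  assumes "N x \<le> 1 - \<eta>" "0 \<le> t"
  shows "contraction_flow t x = exp (- t) *\<^sub>R x"
proof (cases "x = 0")
  case True
  then show ?thesis by (simp add: contraction_flow_0)
next
  case False
  then have pos: "0 < N x" using N_nonneg[of x] N_eq_0[of x] by linarith
  have i: "growth_inv \<eta> (N x) = ln (N x / (1 - \<eta>))" using assms by (simp add: growth_inv_def)
  have "ln (N x / (1 - \<eta>)) \<le> 0" using assms pos \<eta> by simp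
  then have "growth \<eta> (ln (N x / (1 - \<eta>)) - t) = (1 - \<eta>) * exp (ln (N x / (1 - \<eta>)) - t)"
    using assms(2) by (simp add: growth_def)
  also have "\<dots> = N x * exp (- t)"
    using pos \<eta> by (simp add: exp_diff exp_minus field_simps)
  finally show ?thesis using pos assms \<eta> by (simp add: contraction_flow_def i)
qed

lemma contraction_trajectory: "trajectory contraction (\<lambda>t. contraction_flow t x)"
  unfolding trajectory_def
proof
  fix t
  show "((\<lambda>t. contraction_flow t x) has_vector_derivative contraction (contraction_flow t x)) (at t)"
  proof (cases "0 < N x \<and> N x < 1")
    case True
    let ?T = "growth_inv \<eta> (N x)" and ?G = "growth \<eta> (growth_inv \<eta> (N x) - t)"
    have "((\<lambda>t. ?T - t) has_real_derivative - 1) (at t)"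
      by (auto intro!: derivative_eq_intros)
    from DERIV_chain2[OF growth_deriv[OF \<eta>] this]
    have "((\<lambda>t. growth \<eta> (?T - t)) has_vector_derivative - (?G * cutoff \<eta> ?G)) (at t)"
      by (simp add: has_real_derivative_iff_has_vector_derivative)
    then have "((\<lambda>t. (growth \<eta> (?T - t) / N x) *\<^sub>R x) has_vector_derivative (- (?G * cutoff \<eta> ?G) / N x) *\<^sub>R x) (at t)"
      by (rule bounded_linear.has_vector_derivative[rotated])
         (simp add: bounded_linear_scaleR_const bounded_linear_divide)
    moreover have "contraction (contraction_flow t x) = (- (?G * cutoff \<eta> ?G) / N x) *\<^sub>R x"
      using True by (simp add: contraction_def N_contraction_flow) (simp add: contraction_flow_def)
    ultimately show ?thesis using True by (simp add: contraction_flow_def[abs_def])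
  next
    case False
    then have "N x = 0 \<or> 1 \<le> N x" using N_nonneg[of x] by linarith
    then have "contraction x = 0" using N_eq_0 contraction_outside contraction_0 by metis
    moreover have "contraction_flow t x = x" for t using False unfolding contraction_flow_def by presburger
    ultimately show ?thesis by simp
  qed
qed

end

section \<open>Copying a diffeomorphism to all scales\<close>

text \<open>With \<eta> = 1/2 the field is \<open>- x\<close> on the ball of radius 1/2, which
  contains the shell where \<open>annular\<close> maps may move points. Its Lipschitz constant is 1
  + 1/\<eta> = 3.\<close>

global_interpretation ball: radial_gauge norm "1 / 2" 1 1
  by unfold_locales (auto simp: norm_triangle_ineq3)

lemma exp_1_bounds: "2 < exp (1::real)" "exp (1::real) \<le> 3"
  using exp_lower_Taylor_quadratic[of 1] exp_le by auto

definition at_scale :: "nat \<Rightarrow> ('a::real_normed_vector \<Rightarrow> 'a) \<Rightarrow> 'a \<Rightarrow> 'a" where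
  "at_scale n f x = exp (- real n) *\<^sub>R f (exp (real n) *\<^sub>R x)"

text \<open>The overview's \<open>F\<close>, written through displacements so that copies with
  disjoint supports can be summed.\<close>

definition all_scales :: "('a::real_normed_vector \<Rightarrow> 'a) \<Rightarrow> 'a \<Rightarrow> 'a" where
  "all_scales f x = x + disjoint_sum UNIV (\<lambda>n x. at_scale n f x - x) x"

text \<open>The norm of \<open>exp n x\<close> lies strictly between 1/(2e) and e/4. This shell
  contains [1/4, 7/16] and is just narrow enough that every other scale sees \<open>x\<close>
  outside [1/4, 1/2]. Being open, it lets \<open>all_scales\<close> be differentiated as a single
  copy.\<close>

definition near_scale :: "nat \<Rightarrow> 'a::real_normed_vector \<Rightarrow> bool" where
  "near_scale n x \<longleftrightarrow> 1 / 2 < exp 1 * norm (exp (real n) *\<^sub>R x) \<and> 4 * norm (exp (real n) *\<^sub>R x) < exp 1"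

lemma exp_scaleR_cancel [simp]:
  "exp (- real n) *\<^sub>R exp (real n) *\<^sub>R (x::'a::real_normed_vector) = x"
  "exp (real n) *\<^sub>R exp (- real n) *\<^sub>R x = x"
  by (simp_all flip: exp_add)

lemma exp_mult_cancel [simp]:
  "exp (- real n) * exp (real n) = 1" "exp (real n) * exp (- real n) = 1"
  by (simp_all flip: exp_add)

lemma near_scale_other:
  fixes x :: "'a::real_normed_vector"
  assumes "near_scale n x" "i \<noteq> n"
  shows "norm (exp (real i) *\<^sub>R x) < 1 / 4 \<or> 1 / 2 < norm (exp (real i) *\<^sub>R x)"
proof (cases "i < n")
  case True
  then have "real n = real (n - i - 1) + 1 + real i" by (simp add: of_nat_diff)
  then have "norm (exp (real n) *\<^sub>R x) = exp (real (n - i - 1)) * (exp 1 * norm (exp (real i) *\<^sub>R x))"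
    by (metis (no_types, opaque_lifting) abs_exp_cancel exp_add mult.assoc norm_scaleR)
  moreover have "1 * (exp 1 * norm (exp (real i) *\<^sub>R x)) \<le> exp (real (n - i - 1)) * (exp 1 * norm (exp (real i) *\<^sub>R x))"
    by (intro mult_right_mono) auto
  ultimately have "4 * (exp 1 * norm (exp (real i) *\<^sub>R x)) < exp 1 * 1"
    using assms(1) unfolding near_scale_def by linarith
  then have "exp 1 * (4 * norm (exp (real i) *\<^sub>R x)) < exp 1 * 1" by (simp only: mult.left_commute)
  then have "4 * norm (exp (real i) *\<^sub>R x) < 1" by (rule mult_left_less_imp_less) simp
  then show ?thesis by simp
next
  case False
  then have "real i = real (i - n - 1) + 1 + real n" using assms(2) by (simp add: of_nat_diff)
  then have "norm (exp (real i) *\<^sub>R x) = exp (real (i - n - 1)) * (exp 1 * norm (exp (real n) *\<^sub>R x))"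
    by (metis (no_types, opaque_lifting) abs_exp_cancel exp_add mult.assoc norm_scaleR)
  moreover have "1 * (exp 1 * norm (exp (real n) *\<^sub>R x)) \<le> exp (real (i - n - 1)) * (exp 1 * norm (exp (real n) *\<^sub>R x))"
    by (intro mult_right_mono) auto
  ultimately show ?thesis using assms(1) unfolding near_scale_def by linarith
qed

text \<open>Take the least \<open>n\<close> satisfying the lower bound. Minimality, or the
  assumption on \<open>norm x\<close> if \<open>n = 0\<close>, bounds the norm of
  \<open>exp n x\<close> by 1/2 < e/4.\<close>

lemma near_scale_exists:
  fixes x :: "'a::real_normed_vector"
  assumes "x \<noteq> 0" "norm x \<le> 1 / 2"
  obtains n where "near_scale n x"
proof -
  let ?P = "\<lambda>n. 1 / 2 < exp 1 * norm (exp (real n) *\<^sub>R x)"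
  obtain n0 :: nat where "1 / norm x < real n0" using reals_Archimedean2 by blast
  moreover have "real n0 \<le> exp (real n0)" using exp_ge_add_one_self[of "real n0"] by linarith
  ultimately have "1 / norm x < exp (real n0)" by linarith
  then have "1 < norm (exp (real n0) *\<^sub>R x)" using assms(1) by (simp add: field_simps)
  moreover have "1 * norm (exp (real n0) *\<^sub>R x) \<le> exp 1 * norm (exp (real n0) *\<^sub>R x)"
    by (intro mult_right_mono) auto
  ultimately have P0: "?P n0" by linarith
  define n where "n = (LEAST n. ?P n)"
  have Pn: "?P n" unfolding n_def by (rule LeastI[of ?P, OF P0])
  have "norm (exp (real n) *\<^sub>R x) \<le> 1 / 2"
  proof (cases n)
    case 0
    then show ?thesis using assms by simp
  next
    case (Suc k)
    then have "\<not> ?P k" using not_less_Least[of k ?P] n_def by simp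
    moreover have "norm (exp (real n) *\<^sub>R x) = exp 1 * norm (exp (real k) *\<^sub>R x)"
      using Suc by (simp add: exp_add mult.assoc)
    ultimately show ?thesis by linarith
  qed
  then show thesis using that[of n] Pn exp_1_bounds unfolding near_scale_def by linarith
qed

text \<open>The radii have ratio 7/4 < e, so the contraction by 1/e displaces the shell from itself;
  7/16 < 1/2 keeps it in the linear region of \<open>ball.contraction\<close>.\<close>

definition annular :: "('a::real_normed_vector \<Rightarrow> 'a) \<Rightarrow> bool" where
  "annular f \<longleftrightarrow> (\<forall>x. norm x \<le> 1 / 4 \<or> 7 / 16 \<le> norm x \<longrightarrow> f x = x)"

lemma all_scales_eq:
  fixes f :: "'a::real_normed_vector \<Rightarrow> 'a"
  assumes "annular f" "near_scale n x"
  shows "all_scales f x = at_scale n f x"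
proof -
  have "disjoint_sum UNIV (\<lambda>n x. at_scale n f x - x) x = at_scale n f x - x"
  proof (rule disjoint_sum_eq)
    fix i assume "i \<noteq> n"
    then have "f (exp (real i) *\<^sub>R x) = exp (real i) *\<^sub>R x"
      using near_scale_other[OF assms(2), of i] assms(1) unfolding annular_def by force
    then show "at_scale i f x - x = 0" by (simp add: at_scale_def)
  qed simp
  then show ?thesis by (simp add: all_scales_def)
qed

lemma norm_exp_scaleR_ge: "norm x \<le> norm (exp (real n) *\<^sub>R x)"
proof -
  have "1 * norm x \<le> exp (real n) * norm x" by (intro mult_right_mono) auto
  then show ?thesis by simp
qed

lemma all_scales_far:
  fixes f :: "'a::real_normed_vector \<Rightarrow> 'a"
  assumes "annular f" "7 / 16 \<le> norm x"
  shows "all_scales f x = x"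
proof -
  have "disjoint_sum UNIV (\<lambda>n x. at_scale n f x - x) x = 0"
  proof (rule disjoint_sum_eq_0)
    fix i :: nat
    have "f (exp (real i) *\<^sub>R x) = exp (real i) *\<^sub>R x"
      using norm_exp_scaleR_ge[of x i] assms unfolding annular_def by force
    then show "at_scale i f x - x = 0" by (simp add: at_scale_def)
  qed
  then show ?thesis by (simp add: all_scales_def)
qed

lemma all_scales_0: "annular f \<Longrightarrow> all_scales f 0 = 0"
  by (simp add: all_scales_def at_scale_def annular_def disjoint_sum_eq_0)

lemma lip_at_scale:
  fixes f :: "'a::real_normed_vector \<Rightarrow> 'a"
  assumes "\<And>x y. norm (f x - f y) \<le> L * norm (x - y)"
  shows "norm (at_scale n f x - at_scale n f y) \<le> L * norm (x - y)"
proof -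
  have "norm (at_scale n f x - at_scale n f y) = exp (- real n) * norm (f (exp (real n) *\<^sub>R x) - f (exp (real n) *\<^sub>R y))"
    by (simp add: at_scale_def flip: scaleR_diff_right)
  also have "\<dots> \<le> exp (- real n) * (L * norm (exp (real n) *\<^sub>R x - exp (real n) *\<^sub>R y))"
    using assms by (intro mult_left_mono) auto
  also have "\<dots> = L * norm (x - y)"
    by (simp add: exp_minus flip: scaleR_diff_right)
  finally show ?thesis .
qed

text \<open>Estimates are asked inside the open unit ball only: the instances are rescaled
  restrictions to a ball, continued by the identity, and there \<open>D\<close> does not describe
  the continuation.\<close>

locale annular_diffeo =
  fixes \<psi> g :: "'a::euclidean_space \<Rightarrow> 'a" and D :: "'a \<Rightarrow> 'a \<Rightarrow> 'a" and a M :: real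
  assumes psi_g: "\<psi> (g x) = x" and g_psi: "g (\<psi> x) = x"
    and annular_psi: "annular \<psi>"
    and der: "norm x < 1 \<Longrightarrow> (\<psi> has_derivative D x) (at x)"
    and lipD: "norm x < 1 \<Longrightarrow> norm y < 1 \<Longrightarrow> norm (D x h - D y h) \<le> a * norm (x - y) * norm h"
    and lipg: "norm x < 1 \<Longrightarrow> norm y < 1 \<Longrightarrow> norm (g x - g y) \<le> M * norm (x - y)"
    and a: "0 \<le> a" and M: "0 \<le> M"
begin

lemma annular_g: "annular g"
  using annular_psi g_psi unfolding annular_def by metis

lemma psi_annulus: "norm (\<psi> x) \<le> 1 / 4 \<or> 7 / 16 \<le> norm (\<psi> x) \<longleftrightarrow> norm x \<le> 1 / 4 \<or> 7 / 16 \<le> norm x"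
  using annular_psi g_psi unfolding annular_def by metis

lemma g_annulus: "norm (g x) \<le> 1 / 4 \<or> 7 / 16 \<le> norm (g x) \<longleftrightarrow> norm x \<le> 1 / 4 \<or> 7 / 16 \<le> norm x"
  using psi_annulus[of "g x"] psi_g by simp

lemma D_eq_id:
  assumes "norm x < 1 / 4 \<or> 7 / 16 < norm x \<and> norm x < 1"
  shows "D x h = h"
proof -
  let ?S = "{x::'a. norm x < 1 / 4 \<or> 7 / 16 < norm x \<and> norm x < 1}"
  have "open ?S" by (intro open_Collect_disj open_Collect_conj open_Collect_less continuous_intros)
  moreover have "(\<psi> has_derivative D x) (at x)" using der assms by auto
  moreover have "\<psi> y = y" if "y \<in> ?S" for y using that annular_psi unfolding annular_def by auto
  ultimately have "((\<lambda>y. y) has_derivative D x) (at x)"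
    using has_derivative_transform_within_open[of \<psi> "D x" x UNIV ?S "\<lambda>y. y"] assms by auto
  then show ?thesis using has_derivative_unique[OF _ has_derivative_ident] by metis
qed

lemma linear_D: "norm x < 1 \<Longrightarrow> linear (D x)"
  using der has_derivative_linear by blast

lemma D_bound: assumes "norm x < 1" shows "norm (D x h - h) \<le> a * norm x * norm h"
  using lipD[OF assms, of 0 h] D_eq_id[of 0 h] by simp

text \<open>At \<open>y = \<psi> x\<close> the push-forward of the field \<open>- x\<close> is
  \<open>- D x x = - y + defect x\<close>. This is thus the correction to the contraction, seen from
  the source point.\<close>

definition defect :: "'a \<Rightarrow> 'a" where "defect x = \<psi> x - D x x"

text \<open>\<open>D 0\<close> is the identity, so in the half ball \<open>D z\<close> differs from
  it by at most a/2. Three terms contribute a/2 each: the increment of \<psi> - id,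
  \<open>D x - D y\<close> applied to \<open>x\<close>, and \<open>D y - id\<close> applied to
  \<open>x - y\<close>.\<close>

lemma defect_lipschitz:
  assumes x: "norm x \<le> 1 / 2" and y: "norm y \<le> 1 / 2"
  shows "norm (defect x - defect y) \<le> 3 / 2 * a * norm (x - y)"
proof -
  have b: "norm (D z h - h) \<le> a / 2 * norm h" if "norm z \<le> 1 / 2" for z h
  proof -
    have "norm (D z h - h) \<le> a * norm z * norm h" using that by (intro D_bound) auto
    also have "\<dots> \<le> a * (1 / 2) * norm h" using that a by (intro mult_right_mono mult_left_mono) auto
    finally show ?thesis by simp
  qed
  have 1: "norm ((\<psi> x - x) - (\<psi> y - y)) \<le> a / 2 * norm (x - y)"
  proof (rule lipschitz_of_derivative_bound[where S = "cball 0 (1 / 2)" and D = "\<lambda>z h. D z h - h"])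
    fix z :: 'a assume "z \<in> cball 0 (1 / 2)"
    then show "((\<lambda>x. \<psi> x - x) has_derivative (\<lambda>h. D z h - h)) (at z)"
      by (intro has_derivative_diff der has_derivative_ident) auto
  qed (use x y b in auto)
  have 2: "norm ((D x x - x) - (D y x - x)) \<le> a / 2 * norm (x - y)"
  proof -
    have "norm ((D x x - x) - (D y x - x)) \<le> a * norm (x - y) * norm x" using lipD[of x y x] x y by simp
    also have "\<dots> \<le> a * norm (x - y) * (1 / 2)" using x a by (intro mult_left_mono) auto
    finally show ?thesis by simp
  qed
  have 3: "norm (D y (x - y) - (x - y)) \<le> a / 2 * norm (x - y)" using b y by blast
  have "D y (x - y) = D y x - D y y" using linear_diff[OF linear_D] y by auto
  then have "defect x - defect y = ((\<psi> x - x) - (\<psi> y - y)) - (((D x x - x) - (D y x - x)) + (D y (x - y) - (x - y)))"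
    by (simp add: defect_def)
  also have "norm \<dots> \<le> a / 2 * norm (x - y) + (a / 2 * norm (x - y) + a / 2 * norm (x - y))"
    by (rule order_trans[OF norm_triangle_ineq4 add_mono[OF 1 order_trans[OF norm_triangle_ineq add_mono[OF 2 3]]]])
  finally show ?thesis by (simp add: algebra_simps)
qed

definition pushed_defect :: "'a \<Rightarrow> 'a" where
  "pushed_defect y = (if norm y < 1 then defect (g y) else 0)"

lemma defect_eq_0: "norm x < 1 / 4 \<or> 7 / 16 < norm x \<and> norm x < 1 \<Longrightarrow> defect x = 0"
  using D_eq_id annular_psi unfolding defect_def annular_def by auto

lemma pushed_defect_eq_0: "norm y < 1 / 4 \<or> 7 / 16 < norm y \<Longrightarrow> pushed_defect y = 0"
  using defect_eq_0[of y] annular_g unfolding pushed_defect_def annular_def by auto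

lemma pushed_defect_psi: "norm x < 1 \<Longrightarrow> pushed_defect (\<psi> x) = defect x"
  using psi_annulus[of x] annular_psi unfolding pushed_defect_def annular_def by (auto simp: g_psi)

lemma pushed_defect_lipschitz: "norm (pushed_defect x - pushed_defect y) \<le> 3 / 2 * a * M * norm (x - y)"
proof (rule lipschitz_zero_extension[where S = "cball 0 (1 / 2)"])
  fix x y :: 'a assume xy: "x \<in> cball 0 (1 / 2)" "y \<in> cball 0 (1 / 2)"
  have gb: "norm (g z) \<le> 1 / 2" if "norm z \<le> 1 / 2" for z
    using g_annulus[of z] annular_g that unfolding annular_def by fastforce
  have "norm (pushed_defect x - pushed_defect y) = norm (defect (g x) - defect (g y))"
    using xy by (simp add: pushed_defect_def)
  also have "\<dots> \<le> 3 / 2 * a * norm (g x - g y)" using xy gb by (intro defect_lipschitz) auto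
  also have "\<dots> \<le> 3 / 2 * a * (M * norm (x - y))" using xy a by (intro mult_left_mono lipg) auto
  finally show "norm (pushed_defect x - pushed_defect y) \<le> 3 / 2 * a * M * norm (x - y)" by simp
qed (use a M pushed_defect_eq_0 in auto)

text \<open>The push-forward of the contraction by \<open>all_scales \<psi>\<close>;
  \<open>pushed_defect\<close> is the overview's \<open>W_0\<close>.\<close>

definition pushed_field :: "'a \<Rightarrow> 'a" where
  "pushed_field x = ball.contraction x + disjoint_sum UNIV (\<lambda>n. at_scale n pushed_defect) x"

lemma pushed_field_lipschitz: "norm (pushed_field x - pushed_field y) \<le> (3 + 3 * a * M) * norm (x - y)"
proof -
  let ?Q = "\<lambda>n::nat. {x::'a. 1 / 4 \<le> norm (exp (real n) *\<^sub>R x) \<and> norm (exp (real n) *\<^sub>R x) \<le> 7 / 16}"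
  have "norm (disjoint_sum UNIV (\<lambda>n. at_scale n pushed_defect) x - disjoint_sum UNIV (\<lambda>n. at_scale n pushed_defect) y)
    \<le> 2 * (3 / 2 * a * M) * norm (x - y)"
  proof (rule disjoint_sum_lipschitz[where Q = ?Q])
    have "x \<notin> ?Q m" if "x \<in> ?Q n" "m \<noteq> n" for x m n
    proof -
      have q: "1 / 4 \<le> norm (exp (real n) *\<^sub>R x)" "norm (exp (real n) *\<^sub>R x) \<le> 7 / 16" using that(1) by simp_all
      then have "exp 1 * (1 / 4) \<le> exp 1 * norm (exp (real n) *\<^sub>R x)" by (intro mult_left_mono) auto
      then have "near_scale n x" using q exp_1_bounds unfolding near_scale_def by linarith
      then show ?thesis using near_scale_other[OF _ that(2)] by fastforce
    qed
    then show "disjoint_family_on ?Q UNIV" unfolding disjoint_family_on_def by blast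
    show "at_scale n pushed_defect x = 0" if "x \<notin> ?Q n" for n x
      using that pushed_defect_eq_0[of "exp (real n) *\<^sub>R x"] by (auto simp: at_scale_def not_le)
    show "norm (at_scale n pushed_defect x - at_scale n pushed_defect y) \<le> 3 / 2 * a * M * norm (x - y)" for n x y
      by (intro lip_at_scale pushed_defect_lipschitz)
  qed (use a M in auto)
  moreover have "norm (ball.contraction x - ball.contraction y) \<le> 3 * norm (x - y)"
    using ball.contraction_lipschitz[of x y] by simp
  ultimately show ?thesis
    unfolding pushed_field_def
    by (intro order_trans[OF norm_diff_triangle_ineq]) (simp add: algebra_simps)
qed

lemma pushed_field_far:
  assumes "7 / 16 < norm x" shows "pushed_field x = ball.contraction x"
proof -
  have "disjoint_sum UNIV (\<lambda>n. at_scale n pushed_defect) x = 0"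
  proof (rule disjoint_sum_eq_0)
    fix n :: nat
    have "7 / 16 < norm (exp (real n) *\<^sub>R x)" using norm_exp_scaleR_ge[of x n] assms by linarith
    then show "at_scale n pushed_defect x = 0" by (simp add: at_scale_def pushed_defect_eq_0)
  qed
  then show ?thesis by (simp add: pushed_field_def)
qed

lemma pushed_field_outside: "1 \<le> norm x \<Longrightarrow> pushed_field x = 0"
  using pushed_field_far[of x] ball.contraction_outside[of x] by simp

lemma pushed_field_0: "pushed_field 0 = 0"
  by (simp add: pushed_field_def ball.contraction_0 at_scale_def pushed_defect_eq_0 disjoint_sum_eq_0)

lemma norm_at_scale_psi:
  assumes "norm x \<le> 1 / 2" shows "norm (at_scale n \<psi> x) \<le> 1 / 2"
proof (cases "\<psi> (exp (real n) *\<^sub>R x) = exp (real n) *\<^sub>R x")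
  case True
  then show ?thesis using assms by (simp add: at_scale_def)
next
  case False
  then have "norm (\<psi> (exp (real n) *\<^sub>R x)) \<le> 1 / 2"
    using psi_annulus[of "exp (real n) *\<^sub>R x"] annular_psi unfolding annular_def by fastforce
  moreover have "exp (- real n) * norm (\<psi> (exp (real n) *\<^sub>R x)) \<le> 1 * norm (\<psi> (exp (real n) *\<^sub>R x))"
    by (intro mult_right_mono) auto
  ultimately show ?thesis by (simp add: at_scale_def)
qed

lemma near_scale_at_scale:
  assumes "near_scale n x" shows "near_scale n (at_scale n \<psi> x)" "near_scale n (at_scale n g x)"
proof -
  have *: "near_scale n (at_scale n f x)"
    if "annular f" "\<And>x. norm (f x) \<le> 1 / 4 \<or> 7 / 16 \<le> norm (f x) \<longleftrightarrow> norm x \<le> 1 / 4 \<or> 7 / 16 \<le> norm x" for f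
  proof (cases "f (exp (real n) *\<^sub>R x) = exp (real n) *\<^sub>R x")
    case True
    then show ?thesis using assms by (simp add: at_scale_def)
  next
    case False
    then have "1 / 4 < norm (f (exp (real n) *\<^sub>R x))" "norm (f (exp (real n) *\<^sub>R x)) < 7 / 16"
      using that unfolding annular_def by (meson not_le)+
    moreover from this have "exp 1 * (1 / 4) < exp 1 * norm (f (exp (real n) *\<^sub>R x))" by (intro mult_strict_left_mono) auto
    ultimately show ?thesis using exp_1_bounds unfolding near_scale_def at_scale_def exp_scaleR_cancel by linarith
  qed
  show "near_scale n (at_scale n \<psi> x)" "near_scale n (at_scale n g x)"
    using *[OF annular_psi] *[OF annular_g] psi_annulus g_annulus by blast+
qed

lemma at_scale_psi_g: "at_scale n \<psi> (at_scale n g x) = x"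
  by (simp add: at_scale_def psi_g)

lemma all_scales_psi_g: "all_scales \<psi> (all_scales g x) = x"
proof (cases "x = 0 \<or> 7 / 16 \<le> norm x")
  case True
  then show ?thesis
    using all_scales_0[OF annular_g] all_scales_0[OF annular_psi] all_scales_far[OF annular_g] all_scales_far[OF annular_psi]
    by auto
next
  case False
  then obtain n where n: "near_scale n x" using near_scale_exists[of x] by force
  then show ?thesis
    using near_scale_at_scale[OF n] all_scales_eq[OF annular_g n] all_scales_eq[OF annular_psi] at_scale_psi_g by simp
qed

text \<open>Both \<open>w\<close> and its image \<open>y\<close> lie in the half ball, where the
  contraction is minus the identity; \<open>- y\<close> cancels against the \<open>y\<close> of the
  defect and the derivative term remains.\<close>

lemma pushed_field_at_scale:
  assumes n: "near_scale n w" and w: "norm w < 1 / 2"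
  shows "pushed_field (at_scale n \<psi> w) = exp (- real n) *\<^sub>R D (exp (real n) *\<^sub>R w) (exp (real n) *\<^sub>R ball.contraction w)"
proof -
  let ?y = "at_scale n \<psi> w" and ?v = "exp (real n) *\<^sub>R w"
  have v: "norm ?v < 1" using n exp_1_bounds unfolding near_scale_def by linarith
  have "disjoint_sum UNIV (\<lambda>n. at_scale n pushed_defect) ?y = at_scale n pushed_defect ?y"
  proof (rule disjoint_sum_eq)
    fix i assume "i \<noteq> n"
    then have "pushed_defect (exp (real i) *\<^sub>R ?y) = 0"
      using near_scale_other[OF near_scale_at_scale(1)[OF n], of i] by (intro pushed_defect_eq_0) linarith
    then show "at_scale i pushed_defect ?y = 0" by (simp add: at_scale_def)
  qed simp
  moreover have "at_scale n pushed_defect ?y = ?y - exp (- real n) *\<^sub>R D ?v ?v"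
    using v by (simp add: at_scale_def pushed_defect_psi defect_def scaleR_diff_right)
  moreover have "ball.contraction ?y = - ?y"
    using norm_at_scale_psi[of w n] w by (intro ball.contraction_linear) auto
  moreover have "ball.contraction w = - w" using w by (intro ball.contraction_linear) auto
  ultimately show ?thesis using linear_neg[OF linear_D[OF v]] by (simp add: pushed_field_def)
qed

text \<open>Away from rest points, \<open>all_scales \<psi>\<close> agrees near each point of the
  orbit with the identity or with one copy of \<psi>. The chain rule therefore applies at every
  time, although the map may fail to be differentiable at 0.\<close>

lemma pushed_trajectory: "trajectory pushed_field (\<lambda>t. all_scales \<psi> (ball.contraction_flow t z))"
proof (cases "z = 0 \<or> 1 \<le> norm z")
  case True
  have const: "ball.contraction_flow t z = z" for t
    using True ball.contraction_flow_0 ball.contraction_flow_outside by blast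
  have "pushed_field (all_scales \<psi> z) = 0"
    using True all_scales_0[OF annular_psi] all_scales_far[OF annular_psi, of z] pushed_field_0 pushed_field_outside[of z] by auto
  then show ?thesis unfolding const by (rule trajectory_const)
next
  case False
  show ?thesis unfolding trajectory_def
  proof
    fix t
    let ?\<sigma> = "\<lambda>t. ball.contraction_flow t z"
    have d: "(?\<sigma> has_vector_derivative ball.contraction (?\<sigma> t)) (at t)" for t
      using ball.contraction_trajectory unfolding trajectory_def by blast
    have cont: "continuous_on UNIV ?\<sigma>"
      by (intro continuous_at_imp_continuous_on ballI has_vector_derivative_continuous[OF d])
    have ne: "?\<sigma> t \<noteq> 0" using False by (simp add: ball.contraction_flow_eq_0)
    consider "7 / 16 < norm (?\<sigma> t)" | "norm (?\<sigma> t) \<le> 7 / 16" by linarith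
    then show "((\<lambda>t. all_scales \<psi> (?\<sigma> t)) has_vector_derivative pushed_field (all_scales \<psi> (?\<sigma> t))) (at t)"
    proof cases
      case 1
      have o: "open {t. 7 / 16 < norm (?\<sigma> t)}"
        by (intro open_Collect_less continuous_intros cont)
      have "(?\<sigma> has_vector_derivative pushed_field (all_scales \<psi> (?\<sigma> t))) (at t)"
        using d[of t] 1 by (simp add: all_scales_far[OF annular_psi] pushed_field_far)
      then show ?thesis
        by (rule has_vector_derivative_transform_within_open[OF _ o]) (use 1 in \<open>auto simp: all_scales_far[OF annular_psi]\<close>)
    next
      case 2
      then obtain n where n: "near_scale n (?\<sigma> t)" using near_scale_exists[of "?\<sigma> t"] ne by force
      have o: "open {t. near_scale n (?\<sigma> t)}" unfolding near_scale_def
        by (intro open_Collect_conj open_Collect_less continuous_intros cont)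
      let ?v = "exp (real n) *\<^sub>R ?\<sigma> t"
      have v: "norm ?v < 1" using n exp_1_bounds unfolding near_scale_def by linarith
      have "((\<lambda>t. exp (real n) *\<^sub>R ?\<sigma> t) has_vector_derivative exp (real n) *\<^sub>R ball.contraction (?\<sigma> t)) (at t)"
        by (intro bounded_linear.has_vector_derivative[OF bounded_linear_scaleR_right] d)
      from vector_derivative_diff_chain_within[OF this has_derivative_at_withinI[OF der[OF v]]]
      have "((\<lambda>t. \<psi> (exp (real n) *\<^sub>R ?\<sigma> t)) has_vector_derivative D ?v (exp (real n) *\<^sub>R ball.contraction (?\<sigma> t))) (at t)"
        by (simp add: o_def)
      then have "((\<lambda>t. at_scale n \<psi> (?\<sigma> t)) has_vector_derivative
          exp (- real n) *\<^sub>R D ?v (exp (real n) *\<^sub>R ball.contraction (?\<sigma> t))) (at t)"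
        unfolding at_scale_def by (rule bounded_linear.has_vector_derivative[OF bounded_linear_scaleR_right])
      moreover have "pushed_field (all_scales \<psi> (?\<sigma> t)) = exp (- real n) *\<^sub>R D ?v (exp (real n) *\<^sub>R ball.contraction (?\<sigma> t))"
        using pushed_field_at_scale[OF n] 2 all_scales_eq[OF annular_psi n] by simp
      ultimately have "((\<lambda>t. at_scale n \<psi> (?\<sigma> t)) has_vector_derivative pushed_field (all_scales \<psi> (?\<sigma> t))) (at t)"
        by simp
      then show ?thesis
        by (rule has_vector_derivative_transform_within_open[OF _ o]) (use n in \<open>auto simp: all_scales_eq[OF annular_psi]\<close>)
    qed
  qed
qed

lemma all_scales_stays:
  assumes "norm x < 1" shows "norm (all_scales \<psi> x) < 1"
proof (cases "x = 0 \<or> 7 / 16 \<le> norm x")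
  case True
  then show ?thesis using assms all_scales_0[OF annular_psi] all_scales_far[OF annular_psi, of x] by auto
next
  case False
  then obtain n where n: "near_scale n x" using near_scale_exists[of x] by force
  show ?thesis using norm_at_scale_psi[of x n] False all_scales_eq[OF annular_psi n] by simp
qed

text \<open>In the half ball, \<open>all_scales g\<close> acts at some scale \<open>n\<close>, the
  contraction moves the result to scale \<open>n + 1\<close>, and the copy of \<psi> there cancels
  that of \<open>g\<close>. What remains is y/e, of norm at most 1/4 and hence fixed by \<psi>.
  Outside the half ball \<open>all_scales g\<close> fixes \<open>y\<close>, and only the copy at
  scale 0 can act on the contracted point.\<close>

lemma pushed_time_1:
  "all_scales \<psi> (ball.contraction_flow 1 (all_scales g y)) = \<psi> (ball.contraction_flow 1 y)"
proof -
  have near_id: "\<psi> x = x" if "norm x \<le> 1 / 4" for x using annular_psi that unfolding annular_def by blast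
  consider "y = 0" | "y \<noteq> 0" "norm y \<le> 1 / 2" | "1 / 2 < norm y" by linarith
  then show ?thesis
  proof cases
    case 1
    then show ?thesis
      by (simp add: all_scales_0 annular_g annular_psi ball.contraction_flow_0 near_id)
  next
    case 2
    then obtain n where n: "near_scale n y" using near_scale_exists by blast
    let ?z = "at_scale n g y"
    have z: "norm ?z \<le> 1 / 2"
    proof (cases "g (exp (real n) *\<^sub>R y) = exp (real n) *\<^sub>R y")
      case True
      then show ?thesis using 2 by (simp add: at_scale_def)
    next
      case False
      then have "norm (g (exp (real n) *\<^sub>R y)) \<le> 1 / 2"
        using g_annulus[of "exp (real n) *\<^sub>R y"] annular_g unfolding annular_def by fastforce
      moreover have "exp (- real n) * norm (g (exp (real n) *\<^sub>R y)) \<le> 1 * norm (g (exp (real n) *\<^sub>R y))"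
        by (intro mult_right_mono) auto
      ultimately show ?thesis by (simp add: at_scale_def)
    qed
    have e: "exp (real (Suc n)) * exp (- 1) = exp (real n)" "exp (- real (Suc n)) * exp (real n) = exp (- 1)"
      using exp_add[of "real (Suc n)" "- 1"] exp_add[of "- real (Suc n)" "real n"] by simp_all
    have s: "exp (real (Suc n)) *\<^sub>R exp (- 1) *\<^sub>R x = exp (real n) *\<^sub>R x" for x :: 'a
      by (simp only: scaleR_scaleR e)
    have nz: "near_scale (Suc n) (exp (- 1) *\<^sub>R ?z)"
      using near_scale_at_scale(2)[OF n] unfolding near_scale_def s .
    have "all_scales \<psi> (ball.contraction_flow 1 (all_scales g y)) = at_scale (Suc n) \<psi> (exp (- 1) *\<^sub>R ?z)"
      using z all_scales_eq[OF annular_g n] all_scales_eq[OF annular_psi nz] by (simp add: ball.contraction_flow_linear)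
    also have "\<dots> = exp (- real (Suc n)) *\<^sub>R exp (real n) *\<^sub>R y"
      unfolding at_scale_def[of "Suc n"] s by (simp only: at_scale_def exp_scaleR_cancel psi_g)
    also have "\<dots> = exp (- 1) *\<^sub>R y" by (simp only: scaleR_scaleR e)
    also have "\<dots> = \<psi> (exp (- 1) *\<^sub>R y)"
    proof (rule near_id[symmetric])
      have "norm y / exp 1 \<le> (1 / 2) / 2" using 2 exp_1_bounds by (intro frac_le) auto
      moreover have "norm (exp (- 1) *\<^sub>R y) = norm y / exp 1" by (simp add: exp_minus field_simps)
      ultimately show "norm (exp (- 1) *\<^sub>R y) \<le> 1 / 4" by simp
    qed
    finally show ?thesis using 2 by (simp add: ball.contraction_flow_linear)
  next
    case 3
    let ?w = "ball.contraction_flow 1 y"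
    have "all_scales \<psi> ?w = \<psi> ?w"
    proof (cases "7 / 16 \<le> norm ?w")
      case True
      then show ?thesis using all_scales_far[OF annular_psi] annular_psi unfolding annular_def by auto
    next
      case False
      \<comment> \<open>Unit time shrinks by at most the factor e: otherwise \<open>e ?w\<close>
        would lie in the linear region and reach \<open>?w\<close> at time 1, and reversing the flow
        would give \<open>y = e ?w\<close>, of norm at most 1/2.\<close>
      have "1 / 2 < exp 1 * norm ?w"
      proof (rule ccontr)
        assume "\<not> ?thesis"
        then have l: "norm (exp 1 *\<^sub>R ?w) \<le> 1 / 2" by simp
        then have "ball.contraction_flow 1 (exp 1 *\<^sub>R ?w) = ?w"
          using exp_add[of "- 1" "1::real"] by (simp add: ball.contraction_flow_linear)
        then have "ball.contraction_flow (- 1) (ball.contraction_flow 1 (exp 1 *\<^sub>R ?w)) = ball.contraction_flow (- 1) ?w"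
          by simp
        then have "exp 1 *\<^sub>R ?w = y" unfolding ball.contraction_flow_add by (simp add: ball.contraction_flow_at_0)
        then show False using l 3 by simp
      qed
      then have "near_scale 0 ?w" using False exp_1_bounds unfolding near_scale_def by simp
      then show ?thesis using all_scales_eq[OF annular_psi] by (simp add: at_scale_def)
    qed
    then show ?thesis using 3 all_scales_far[OF annular_g, of y] by simp
  qed
qed

lemma pushed_flow:
  assumes y: "norm y < 1"
  shows "\<exists>\<gamma>. trajectory pushed_field \<gamma> \<and> \<gamma> 0 = y \<and> \<gamma> 1 = \<psi> (ball.contraction_flow 1 y) \<and> (\<forall>t. norm (\<gamma> t) < 1)"
proof (intro exI conjI allI)
  let ?\<gamma> = "\<lambda>t. all_scales \<psi> (ball.contraction_flow t (all_scales g y))"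
  show "trajectory pushed_field ?\<gamma>" by (rule pushed_trajectory)
  show "?\<gamma> 0 = y" by (simp add: ball.contraction_flow_at_0 all_scales_psi_g)
  show "?\<gamma> 1 = \<psi> (ball.contraction_flow 1 y)" by (rule pushed_time_1)
  have "norm (all_scales g y) < 1"
  proof (rule ccontr)
    assume *: "\<not> norm (all_scales g y) < 1"
    then have "all_scales \<psi> (all_scales g y) = all_scales g y" by (intro all_scales_far annular_psi) auto
    then show False using y all_scales_psi_g[of y] * by simp
  qed
  then show "norm (?\<gamma> t) < 1" for t by (intro all_scales_stays ball.N_contraction_flow_less)
qed

end

section \<open>Compositions of flows\<close>

definition flowable :: "nat \<Rightarrow> (real^'n \<Rightarrow> real^'n) \<Rightarrow> bool" where
  "flowable n f \<longleftrightarrow> (\<exists>Vs. length Vs \<le> n \<and> (\<forall>V\<in>set Vs. V \<in> VF 0) \<and> f = flow_comp Vs)"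

lemma flow_comp_append:
  fixes Vs Ws :: "(real^'n \<Rightarrow> real^'n) list"
  shows "flow_comp (Vs @ Ws) = flow_comp Ws \<circ> flow_comp Vs"
proof -
  have "foldl (\<lambda>f V. Flow V \<circ> f) h Ws = foldl (\<lambda>f V. Flow V \<circ> f) id Ws \<circ> h" for h :: "real^'n \<Rightarrow> real^'n"
  proof (induction Ws arbitrary: h)
    case (Cons W Ws)
    have "foldl (\<lambda>f V. Flow V \<circ> f) h (W # Ws) = foldl (\<lambda>f V. Flow V \<circ> f) id Ws \<circ> (Flow W \<circ> h)"
      using Cons[of "Flow W \<circ> h"] by (simp only: foldl_Cons)
    moreover have "foldl (\<lambda>f V. Flow V \<circ> f) id (W # Ws) = foldl (\<lambda>f V. Flow V \<circ> f) id Ws \<circ> Flow W"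
      using Cons[of "Flow W"] by (simp only: foldl_Cons comp_id)
    ultimately show ?case by (simp only: comp_assoc)
  qed simp
  then show ?thesis unfolding flow_comp_def foldl_append .
qed

lemma flowable_comp:
  assumes "flowable m f" "flowable n g" shows "flowable (m + n) (g \<circ> f)"
proof -
  obtain Vs Ws where "length Vs \<le> m" "\<forall>V\<in>set Vs. V \<in> VF 0" "f = flow_comp Vs"
    "length Ws \<le> n" "\<forall>V\<in>set Ws. V \<in> VF 0" "g = flow_comp Ws"
    using assms unfolding flowable_def by blast
  then show ?thesis unfolding flowable_def
    by (intro exI[of _ "Vs @ Ws"]) (auto simp: flow_comp_append)
qed

lemma flowable_0_id: "flowable 0 id"
  unfolding flowable_def by (intro exI[of _ "[]"]) (simp add: flow_comp_def)

lemma flowable_time_1: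
  fixes V :: "real^'n \<Rightarrow> real^'n"
  assumes lip: "\<And>x y. norm (V x - V y) \<le> L * norm (x - y)" and L: "0 \<le> L"
    and out: "\<And>x. x \<notin> unit_cube \<Longrightarrow> V x = 0"
    and traj: "\<And>x. \<exists>\<gamma>. trajectory V \<gamma> \<and> \<gamma> 0 = x \<and> \<gamma> 1 = f x"
  shows "flowable 1 f"
proof -
  have "Flow V x = f x" for x
    using traj[of x] Flow_eqI[OF lip] by blast
  then have "f = flow_comp [V]" by (auto simp: flow_comp_def)
  moreover have "L-lipschitz_on UNIV V" using lip L by (intro lipschitz_onI) (auto simp: dist_norm)
  then have "V \<in> VF 0" using out unfolding VF_def by auto
  ultimately show ?thesis unfolding flowable_def by (intro exI[of _ "[V]"]) simp
qed

text \<open>A trajectory starting in \<open>B j\<close> stays there, where all other summands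
  vanish; one field thus runs all the flows at once.\<close>

lemma flowable_disjoint_sum:
  fixes V :: "'j \<Rightarrow> real^'n \<Rightarrow> real^'n"
  assumes disj: "disjoint_family_on B J"
    and cube: "\<And>j. j \<in> J \<Longrightarrow> B j \<subseteq> unit_cube"
    and supp: "\<And>j x. j \<in> J \<Longrightarrow> x \<notin> B j \<Longrightarrow> V j x = 0"
    and lip: "\<And>j x y. j \<in> J \<Longrightarrow> norm (V j x - V j y) \<le> L * norm (x - y)" and L: "0 \<le> L"
    and traj: "\<And>j x. j \<in> J \<Longrightarrow> x \<in> B j \<Longrightarrow>
      \<exists>\<gamma>. trajectory (V j) \<gamma> \<and> \<gamma> 0 = x \<and> \<gamma> 1 = f x \<and> (\<forall>t. \<gamma> t \<in> B j)"
    and id: "\<And>x. (\<And>j. j \<in> J \<Longrightarrow> x \<notin> B j) \<Longrightarrow> f x = x"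
  shows "flowable 1 f"
proof (rule flowable_time_1)
  fix x y :: "real^'n"
  show "norm (disjoint_sum J V x - disjoint_sum J V y) \<le> (2 * L) * norm (x - y)"
    by (rule disjoint_sum_lipschitz[OF disj supp lip L])
next
  fix x :: "real^'n" assume "x \<notin> unit_cube"
  then show "disjoint_sum J V x = 0" using supp cube by (intro disjoint_sum_eq_0) blast
next
  fix x :: "real^'n"
  show "\<exists>\<gamma>. trajectory (disjoint_sum J V) \<gamma> \<and> \<gamma> 0 = x \<and> \<gamma> 1 = f x"
  proof (cases "\<exists>j\<in>J. x \<in> B j")
    case True
    then obtain j where j: "j \<in> J" "x \<in> B j" by blast
    obtain \<gamma> where g: "trajectory (V j) \<gamma>" "\<gamma> 0 = x" "\<gamma> 1 = f x" "\<And>t. \<gamma> t \<in> B j" using traj[OF j] by blast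
    have "disjoint_sum J V (\<gamma> t) = V j (\<gamma> t)" for t
    proof (rule disjoint_sum_eq[OF j(1)])
      fix i assume "i \<in> J" "i \<noteq> j"
      then show "V i (\<gamma> t) = 0" using disj g(4)[of t] j(1) supp unfolding disjoint_family_on_def by blast
    qed
    then have "trajectory (disjoint_sum J V) \<gamma>" using g(1) unfolding trajectory_def by simp
    then show ?thesis using g by blast
  next
    case False
    then have "disjoint_sum J V x = 0" using supp by (intro disjoint_sum_eq_0) blast
    then show ?thesis using trajectory_const[of "disjoint_sum J V" x] id[of x] False by (intro exI[of _ "\<lambda>t. x"]) auto
  qed
qed (use L in simp)

lemma lipschitz_affine:
  assumes "\<And>x y. norm (V x - V y) \<le> L * norm (x - y)" "0 < (R::real)"
  shows "norm (R *\<^sub>R V ((1 / R) *\<^sub>R (x - p)) - R *\<^sub>R V ((1 / R) *\<^sub>R (y - p))) \<le> L * norm (x - y)"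
proof -
  have "norm (R *\<^sub>R V ((1 / R) *\<^sub>R (x - p)) - R *\<^sub>R V ((1 / R) *\<^sub>R (y - p)))
    = R * norm (V ((1 / R) *\<^sub>R (x - p)) - V ((1 / R) *\<^sub>R (y - p)))"
    using assms(2) by (simp flip: scaleR_diff_right)
  also have "\<dots> \<le> R * (L * norm ((1 / R) *\<^sub>R (x - p) - (1 / R) *\<^sub>R (y - p)))"
    using assms by (intro mult_left_mono) auto
  also have "\<dots> = L * norm (x - y)"
    using assms(2) by (simp flip: scaleR_diff_right)
  finally show ?thesis .
qed

text \<open>On each ball \<open>f1\<close> is the inverse contraction and \<open>f2\<close> the
  contraction followed by \<psi>, the time-1 map of \<open>pushed_field\<close>. Rescaling the ball
  to radius 1 multiplies the constant of the derivative by \<open>R j \<le> 1\<close> and preserves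
  that of \<open>g\<close>, so \<open>a\<close> and \<open>M\<close> serve for all balls.\<close>

lemma flowable_annular:
  fixes \<psi> g :: "real^'n \<Rightarrow> real^'n" and p :: "'j \<Rightarrow> real^'n" and R :: "'j \<Rightarrow> real"
  assumes disj: "disjoint_family_on (\<lambda>j. ball (p j) (R j)) J"
    and R: "\<And>j. j \<in> J \<Longrightarrow> 0 < R j" "\<And>j. j \<in> J \<Longrightarrow> R j \<le> 1"
    and cube: "\<And>j. j \<in> J \<Longrightarrow> ball (p j) (R j) \<subseteq> unit_cube"
    and ld: "lip_deriv a \<psi> D" and a: "0 \<le> a"
    and psi_g: "\<And>x. \<psi> (g x) = x" and g_psi: "\<And>x. g (\<psi> x) = x"
    and lipg: "\<And>x y. norm (g x - g y) \<le> M * norm (x - y)" and M: "0 \<le> M"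
    and supp: "\<And>x. \<psi> x \<noteq> x \<Longrightarrow> \<exists>j\<in>J. R j / 4 < norm (x - p j) \<and> norm (x - p j) < 7 / 16 * R j"
    and pres: "\<And>j x. j \<in> J \<Longrightarrow> x \<in> ball (p j) (R j) \<Longrightarrow> \<psi> x \<in> ball (p j) (R j)"
  shows "flowable 2 \<psi>"
proof -
  let ?B = "\<lambda>j. ball (p j) (R j)"
  define into where "into j x = (1 / R j) *\<^sub>R (x - p j)" for j x
  define out where "out j x = p j + R j *\<^sub>R x" for j x
  have out_into: "out j (into j x) = x" and into_out: "into j (out j x) = x" if "j \<in> J" for j x
    using R(1)[OF that] by (simp_all add: into_def out_def)
  have norm_into: "norm (x - p j) = R j * norm (into j x)" if "j \<in> J" for j x
    using R(1)[OF that] by (simp add: into_def)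
  have ball_iff: "x \<in> ?B j \<longleftrightarrow> norm (into j x) < 1" if "j \<in> J" for j x
    using R(1)[OF that] norm_into[OF that, of x] by (simp add: dist_norm norm_minus_commute)
  have out_ball: "out j x \<in> ?B j \<longleftrightarrow> norm x < 1" if "j \<in> J" for j x
    using ball_iff[OF that] into_out[OF that] by simp
  have psi_out: "\<psi> x = x" if "\<And>j. j \<in> J \<Longrightarrow> x \<notin> ?B j" for x
  proof (rule ccontr)
    assume "\<psi> x \<noteq> x"
    then obtain j where j: "j \<in> J" "norm (x - p j) < 7 / 16 * R j" using supp by blast
    moreover have "7 / 16 * R j \<le> R j" using R(1)[OF j(1)] by simp
    ultimately show False using that[OF j(1)] by (simp add: dist_norm norm_minus_commute)
  qed
  \<comment> \<open>If \<open>g x\<close> lies in ball \<open>i\<close>, so does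
    \<open>x = \<psi> (g x)\<close>, which forces \<open>i = j\<close>; if it lies in none, \<psi>
    fixes it.\<close>
  have g_pres: "g x \<in> ?B j" if "j \<in> J" "x \<in> ?B j" for j x
  proof (cases "\<exists>i\<in>J. g x \<in> ?B i")
    case True
    then obtain i where i: "i \<in> J" "g x \<in> ?B i" by blast
    then have "x \<in> ?B i" using pres[OF i] psi_g by simp
    then have "i = j" using disj that i unfolding disjoint_family_on_def by blast
    then show ?thesis using i by simp
  next
    case False
    then have "\<psi> (g x) = g x" using psi_out by blast
    then show ?thesis using psi_g that by simp
  qed
  define \<psi>' where "\<psi>' j x = (if norm x < 1 then into j (\<psi> (out j x)) else x)" for j x
  define g' where "g' j x = (if norm x < 1 then into j (g (out j x)) else x)" for j x
  define D' where "D' j x = D (out j x)" for j x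
  have ad: "annular_diffeo (\<psi>' j) (g' j) (D' j) a M" if j: "j \<in> J" for j
  proof
    note [simp] = out_into[OF j] into_out[OF j]
    have \<psi>'_less: "norm (\<psi>' j x) < 1" if "norm x < 1" for x
      using that pres[OF j, of "out j x"] out_ball[OF j, of x] ball_iff[OF j] by (simp add: \<psi>'_def)
    have g'_less: "norm (g' j x) < 1" if "norm x < 1" for x
      using that g_pres[OF j, of "out j x"] out_ball[OF j, of x] ball_iff[OF j] by (simp add: g'_def)
    have diff_out: "out j x - out j y = R j *\<^sub>R (x - y)" for x y by (simp add: out_def algebra_simps)
    show "\<psi>' j (g' j x) = x" for x
      using g'_less[of x] by (cases "norm x < 1") (simp_all add: \<psi>'_def g'_def psi_g)
    show "g' j (\<psi>' j x) = x" for x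
      using \<psi>'_less[of x] by (cases "norm x < 1") (simp_all add: \<psi>'_def g'_def g_psi)
    show "annular (\<psi>' j)" unfolding annular_def
    proof (intro allI impI)
      fix x :: "real^'n" assume x: "norm x \<le> 1 / 4 \<or> 7 / 16 \<le> norm x"
      show "\<psi>' j x = x"
      proof (cases "norm x < 1")
        case True
        have "\<psi> (out j x) = out j x"
        proof (rule ccontr)
          assume "\<psi> (out j x) \<noteq> out j x"
          then obtain i where i: "i \<in> J" "R i / 4 < norm (out j x - p i)" "norm (out j x - p i) < 7 / 16 * R i"
            using supp by blast
          have "7 / 16 * R i \<le> R i" using R(1)[OF i(1)] by simp
          then have "out j x \<in> ?B i" using i(3) by (simp add: dist_norm norm_minus_commute)
          then have "i = j" using True out_ball[OF j] disj i(1) j unfolding disjoint_family_on_def by blast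
          then have "R j / 4 < R j * norm x" "R j * norm x < 7 / 16 * R j" using i norm_into[OF j, of "out j x"] by auto
          then show False using x R(1)[OF j] by (auto simp: field_simps)
        qed
        then show ?thesis using True by (simp add: \<psi>'_def)
      qed (simp add: \<psi>'_def)
    qed
    show "(\<psi>' j has_derivative D' j x) (at x)" if "norm x < 1" for x
    proof -
      have 1: "((\<lambda>x. out j x) has_derivative (\<lambda>h. R j *\<^sub>R h)) (at x)"
        unfolding out_def by (auto intro!: derivative_eq_intros)
      have 2: "(\<psi> has_derivative D (out j x)) (at (out j x))" using ld unfolding lip_deriv_def by blast
      have 3: "((\<lambda>y. into j y) has_derivative (\<lambda>h. (1 / R j) *\<^sub>R h)) F" for F
        unfolding into_def by (auto intro!: derivative_eq_intros)
      have "((\<lambda>x. into j (\<psi> (out j x))) has_derivative (\<lambda>h. (1 / R j) *\<^sub>R D (out j x) (R j *\<^sub>R h))) (at x)"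
        using has_derivative_compose[OF has_derivative_compose[OF 1 2] 3] .
      moreover have "(\<lambda>h. (1 / R j) *\<^sub>R D (out j x) (R j *\<^sub>R h)) = D' j x"
        using linear_cmul[OF has_derivative_linear[OF 2]] R(1)[OF j] by (auto simp: D'_def)
      ultimately have "((\<lambda>x. into j (\<psi> (out j x))) has_derivative D' j x) (at x)" by simp
      then show ?thesis
        by (rule has_derivative_transform_within_open[OF _ open_ball[of 0 1]]) (use that in \<open>auto simp: \<psi>'_def\<close>)
    qed
    show "norm (D' j x h - D' j y h) \<le> a * norm (x - y) * norm h" for x y h
    proof -
      have "norm (D' j x h - D' j y h) \<le> a * norm (out j x - out j y) * norm h"
        using ld unfolding lip_deriv_def D'_def by blast
      also have "\<dots> = R j * (a * norm (x - y) * norm h)" using R(1)[OF j] by (simp add: diff_out)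
      also have "\<dots> \<le> 1 * (a * norm (x - y) * norm h)" using R(2)[OF j] a by (intro mult_right_mono) auto
      finally show ?thesis by simp
    qed
    show "norm (g' j x - g' j y) \<le> M * norm (x - y)" if "norm x < 1" "norm y < 1" for x y
    proof -
      have "norm (g' j x - g' j y) = (1 / R j) * norm (g (out j x) - g (out j y))"
        using that R(1)[OF j] by (simp add: g'_def into_def flip: scaleR_diff_right)
      also have "\<dots> \<le> (1 / R j) * (M * norm (out j x - out j y))"
        using lipg R(1)[OF j] by (intro mult_left_mono) auto
      also have "\<dots> = M * norm (x - y)" using R(1)[OF j] by (simp add: diff_out)
      finally show ?thesis .
    qed
  qed (use a M in auto)
  define h1 where "h1 j x = out j (ball.contraction_flow (- 1) (into j x))" for j x
  define h2 where "h2 j x = out j (\<psi>' j (ball.contraction_flow 1 (into j x)))" for j x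
  define glue where "glue h x = (if \<exists>j\<in>J. x \<in> ?B j then h (SOME j. j \<in> J \<and> x \<in> ?B j) x else x)" for h x
  have glue_eq: "glue h x = h j x" if j: "j \<in> J" "x \<in> ?B j" for h j x
  proof -
    have "(SOME j. j \<in> J \<and> x \<in> ?B j) = j"
    proof (rule some_equality)
      show "j \<in> J \<and> x \<in> ?B j" using j by (rule conjI)
      fix i assume i: "i \<in> J \<and> x \<in> ?B i"
      show "i = j"
      proof (rule ccontr)
        assume "i \<noteq> j"
        then have "?B i \<inter> ?B j = {}" using i j(1) by (intro disjoint_family_onD[OF disj]) (rule conjunct1)
        moreover have "x \<in> ?B i \<inter> ?B j" using i j(2) by (intro IntI) (rule conjunct2)
        ultimately show False by (simp only: empty_iff)
      qed
    qed
    moreover have "\<exists>j\<in>J. x \<in> ?B j" using j by (rule bexI[rotated])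
    ultimately show ?thesis by (simp only: glue_def if_True)
  qed
  have glue_out: "glue h x = x" if "\<And>j. j \<in> J \<Longrightarrow> x \<notin> ?B j" for h x
  proof -
    have "\<not> (\<exists>j\<in>J. x \<in> ?B j)" using that by (intro notI) (elim bexE, metis)
    then show ?thesis by (simp only: glue_def if_False)
  qed
  define f1 where "f1 = glue h1"
  define f2 where "f2 = glue h2"
  note f1 = glue_eq[of _ _ h1, folded f1_def] glue_out[of _ h1, folded f1_def]
  note f2 = glue_eq[of _ _ h2, folded f2_def] glue_out[of _ h2, folded f2_def]
  have nlt: "1 \<le> norm (into j x)" if "j \<in> J" "x \<notin> ?B j" for j x using ball_iff[OF that(1), of x] that(2) by linarith
  have "flowable 1 f1"
  proof (rule flowable_disjoint_sum[OF disj cube, where L = 3 and V = "\<lambda>j x. R j *\<^sub>R (- 1) *\<^sub>R ball.contraction ((1 / R j) *\<^sub>R (x - p j))"])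
    fix j x assume j: "j \<in> J" and x: "x \<in> ?B j"
    let ?\<gamma> = "\<lambda>t. p j + R j *\<^sub>R ball.contraction_flow (- 1 * t) (into j x)"
    have "trajectory (\<lambda>x. R j *\<^sub>R (- 1) *\<^sub>R ball.contraction ((1 / R j) *\<^sub>R (x - p j))) ?\<gamma>"
      by (rule trajectory_affine[OF trajectory_rescale[OF ball.contraction_trajectory]]) (use R(1)[OF j] in auto)
    moreover have "?\<gamma> 0 = x" using out_into[OF j] by (simp add: ball.contraction_flow_at_0 out_def)
    moreover have "?\<gamma> 1 = f1 x" using f1(1)[OF j x] by (simp add: h1_def out_def)
    moreover have "?\<gamma> t \<in> ?B j" for t
      using out_ball[OF j] ball.N_contraction_flow_less ball_iff[OF j] x unfolding out_def by blast
    ultimately show "\<exists>\<gamma>. trajectory (\<lambda>x. R j *\<^sub>R (- 1) *\<^sub>R ball.contraction ((1 / R j) *\<^sub>R (x - p j))) \<gamma>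
        \<and> \<gamma> 0 = x \<and> \<gamma> 1 = f1 x \<and> (\<forall>t. \<gamma> t \<in> ?B j)" by blast
  next
    fix j x y assume j: "j \<in> J"
    have "norm ((- 1) *\<^sub>R ball.contraction x - (- 1) *\<^sub>R ball.contraction y) \<le> 3 * norm (x - y)" for x y :: "real^'n"
      using ball.contraction_lipschitz[of y x] by (simp add: norm_minus_commute)
    from lipschitz_affine[OF this R(1)[OF j]]
    show "norm (R j *\<^sub>R (- 1) *\<^sub>R ball.contraction ((1 / R j) *\<^sub>R (x - p j)) - R j *\<^sub>R (- 1) *\<^sub>R ball.contraction ((1 / R j) *\<^sub>R (y - p j)))
      \<le> 3 * norm (x - y)" .
  next
    fix j x assume "j \<in> J" "x \<notin> ?B j"
    then show "R j *\<^sub>R (- 1) *\<^sub>R ball.contraction ((1 / R j) *\<^sub>R (x - p j)) = 0"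
      using ball.contraction_outside[OF nlt[of j x]] by (simp add: into_def)
  qed (use f1(2) in auto)
  moreover have "flowable 1 f2"
  proof (rule flowable_disjoint_sum[OF disj cube, where L = "3 + 3 * a * M"
        and V = "\<lambda>j x. R j *\<^sub>R annular_diffeo.pushed_field (\<psi>' j) (g' j) (D' j) ((1 / R j) *\<^sub>R (x - p j))"])
    fix j x assume j: "j \<in> J" and x: "x \<in> ?B j"
    interpret ad: annular_diffeo "\<psi>' j" "g' j" "D' j" a M by (rule ad[OF j])
    have z: "norm (into j x) < 1" using ball_iff[OF j, of x] x by blast
    obtain \<gamma> where g: "trajectory ad.pushed_field \<gamma>" "\<gamma> 0 = into j x"
      "\<gamma> 1 = \<psi>' j (ball.contraction_flow 1 (into j x))" "\<forall>t. norm (\<gamma> t) < 1"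
      using ad.pushed_flow[OF z] by (elim exE conjE)
    have "trajectory (\<lambda>x. R j *\<^sub>R ad.pushed_field ((1 / R j) *\<^sub>R (x - p j))) (\<lambda>t. p j + R j *\<^sub>R \<gamma> t)"
      using R(1)[OF j] by (intro trajectory_affine[OF g(1)]) simp
    moreover have "p j + R j *\<^sub>R \<gamma> 0 = x" using out_into[OF j] g(2) by (simp add: out_def)
    moreover have "p j + R j *\<^sub>R \<gamma> 1 = f2 x" using f2(1)[OF j x] g(3) by (simp add: h2_def out_def)
    moreover have "p j + R j *\<^sub>R \<gamma> t \<in> ?B j" for t
    proof -
      have "out j (\<gamma> t) \<in> ?B j" using g(4) by (intro out_ball[OF j, THEN iffD2]) (rule spec)
      then show ?thesis unfolding out_def .
    qed
    ultimately show "\<exists>\<gamma>. trajectory (\<lambda>x. R j *\<^sub>R ad.pushed_field ((1 / R j) *\<^sub>R (x - p j))) \<gamma>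
        \<and> \<gamma> 0 = x \<and> \<gamma> 1 = f2 x \<and> (\<forall>t. \<gamma> t \<in> ?B j)" by (intro exI[of _ "\<lambda>t. p j + R j *\<^sub>R \<gamma> t"] conjI allI)
  next
    fix j x y assume j: "j \<in> J"
    show "norm (R j *\<^sub>R annular_diffeo.pushed_field (\<psi>' j) (g' j) (D' j) ((1 / R j) *\<^sub>R (x - p j))
        - R j *\<^sub>R annular_diffeo.pushed_field (\<psi>' j) (g' j) (D' j) ((1 / R j) *\<^sub>R (y - p j))) \<le> (3 + 3 * a * M) * norm (x - y)"
      by (rule lipschitz_affine[OF annular_diffeo.pushed_field_lipschitz[OF ad[OF j]] R(1)[OF j]])
  next
    fix j x assume j: "j \<in> J" and "x \<notin> ?B j"
    then show "R j *\<^sub>R annular_diffeo.pushed_field (\<psi>' j) (g' j) (D' j) ((1 / R j) *\<^sub>R (x - p j)) = 0"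
      using annular_diffeo.pushed_field_outside[OF ad[OF j] nlt[of j x]] by (simp add: into_def)
  next
    show "0 \<le> 3 + 3 * a * M" using a M by simp
  qed (auto intro: f2(2))
  ultimately have "flowable (1 + 1) (f2 \<circ> f1)" by (rule flowable_comp)
  moreover have "f2 \<circ> f1 = \<psi>"
  proof
    fix x
    show "(f2 \<circ> f1) x = \<psi> x"
    proof (cases "\<exists>j\<in>J. x \<in> ?B j")
      case True
      then obtain j where j: "j \<in> J" "x \<in> ?B j" by blast
      have z: "norm (into j x) < 1" using ball_iff[of j x] j by blast
      then have "norm (ball.contraction_flow (- 1) (into j x)) < 1" by (rule ball.N_contraction_flow_less)
      then have "h1 j x \<in> ?B j" using out_ball[OF j(1)] by (simp add: h1_def)
      then have "f2 (f1 x) = h2 j (h1 j x)" unfolding f1(1)[OF j] by (rule f2(1)[OF j(1)])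
      also have "\<dots> = out j (\<psi>' j (into j x))"
        by (simp add: h1_def h2_def into_out[OF j(1)] ball.contraction_flow_add ball.contraction_flow_at_0)
      also have "\<dots> = \<psi> x" using z by (simp add: \<psi>'_def out_into[OF j(1)])
      finally show ?thesis by simp
    next
      case False
      then have "f1 x = x" "f2 x = x" "\<psi> x = x" by (auto intro!: f1(2) f2(2) psi_out)
      then show ?thesis by simp
    qed
  qed
  ultimately show ?thesis by (simp only: one_add_one)
qed

section \<open>Diffeomorphisms close to the identity\<close>

text \<open>\<open>g y\<close> is the fixed point of the contraction sending \<open>x\<close> to
  \<open>y - v x\<close>; 8/7 is the reciprocal of 1 - 1/8.\<close>

lemma near_id_inverse:
  fixes v :: "'a::euclidean_space \<Rightarrow> 'a"
  assumes v: "\<And>x y. norm (v x - v y) \<le> 1 / 8 * norm (x - y)"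
  obtains g where "\<And>x. g x + v (g x) = x" "\<And>x. g (x + v x) = x"
    "\<And>x y. norm (g x - g y) \<le> 8 / 7 * norm (x - y)"
proof -
  have "\<exists>!x. y - v x = x" for y
    by (rule banach_fix_type[of "1 / 8"]) (use v in \<open>auto simp: dist_norm norm_minus_commute\<close>)
  then have "\<exists>x. x + v x = y" for y by (metis diff_add_cancel)
  then obtain g where g: "\<And>y. g y + v (g y) = y" by metis
  have exp: "7 / 8 * norm (x - y) \<le> norm ((x + v x) - (y + v y))" for x y
  proof -
    have "norm (x - y) \<le> norm ((x + v x) - (y + v y)) + norm (v x - v y)"
      using norm_triangle_ineq4[of "(x + v x) - (y + v y)" "v x - v y"] by (simp add: algebra_simps)
    then show ?thesis using v[of x y] by linarith
  qed
  have "g (x + v x) = x" for x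
    using exp[of "g (x + v x)" x] g[of "x + v x"] by simp
  moreover have "norm (g x - g y) \<le> 8 / 7 * norm (x - y)" for x y
    using exp[of "g x" "g y"] g[of x] g[of y] by simp
  ultimately show thesis using g that by blast
qed

text \<open>With \<open>T = id + D\<close> and \<open>S\<close> its inverse, the difference of two
  inverses is \<open>S ((T' - T) (S' h))\<close>. The crude bound 2, for each of the two inverses
  and for the Lipschitz constant of \<open>g\<close>, gives the factor 8.\<close>

lemma lip_deriv_near_id_inverse:
  fixes v g :: "'a::euclidean_space \<Rightarrow> 'a"
  assumes v: "lip_deriv a v D" and a: "0 \<le> a" and D: "\<And>x h. norm (D x h) \<le> 1 / 8 * norm h"
    and g1: "\<And>x. g x + v (g x) = x"
    and g3: "\<And>x y. norm (g x - g y) \<le> 8 / 7 * norm (x - y)"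
  obtains D' where "lip_deriv (8 * a) g D'" "\<And>x h. norm (D' x h) \<le> 2 * norm h"
proof -
  define T where "T x h = h + D x h" for x h
  have vd: "(v has_derivative D x) (at x)" for x using v unfolding lip_deriv_def by blast
  have Td: "((\<lambda>x. x + v x) has_derivative T x) (at x)" for x
    unfolding T_def[abs_def] by (intro has_derivative_add has_derivative_ident vd)
  have lin: "linear (T x)" for x using Td has_derivative_linear by blast
  have low: "norm h \<le> 2 * norm (T x h)" for x h
  proof -
    have "norm h \<le> norm (T x h) + norm (D x h)"
      using norm_triangle_ineq4[of "T x h" "D x h"] by (simp add: T_def)
    then show ?thesis using D[of x h] norm_ge_zero[of "T x h"] by linarith
  qed
  have "\<exists>S. linear S \<and> (\<forall>h. S (T x h) = h) \<and> (\<forall>h. T x (S h) = h)" for x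
  proof (rule linear_injective_isomorphism[OF lin])
    show "inj (T x)" unfolding linear_injective_0[OF lin]
    proof (intro allI impI)
      fix h assume "T x h = 0"
      then show "h = 0" using low[of h x] by simp
    qed
  qed (rule refl)
  then obtain S where S: "\<And>x. linear (S x)" "\<And>x h. S x (T x h) = h" "\<And>x h. T x (S x h) = h" by metis
  have Sb: "norm (S x h) \<le> 2 * norm h" for x h using low[of "S x h" x] S(3) by simp
  have "(g has_derivative S (g y)) (at y)" for y
  proof (rule has_derivative_inverse_basic[where f = "\<lambda>x. x + v x" and f' = "T (g y)" and T = UNIV])
    show "bounded_linear (S (g y))" using S(1) linear_conv_bounded_linear by blast
    show "S (g y) \<circ> T (g y) = id" using S(2) by auto
    have "(8 / 7)-lipschitz_on UNIV g" using g3 by (intro lipschitz_onI) (auto simp: dist_norm)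
    then show "continuous (at y) g"
      using lipschitz_on_continuous_on continuous_on_eq_continuous_at by blast
  qed (use Td g1 in auto)
  moreover have "norm (S (g x) h - S (g y) h) \<le> 8 * a * norm (x - y) * norm h" for x y h
  proof -
    let ?k = "S (g x) h" and ?l = "S (g y) h"
    have "T (g x) (?k - ?l) = T (g y) ?l - T (g x) ?l" using S(3) linear_diff[OF lin] by simp
    also have "\<dots> = D (g y) ?l - D (g x) ?l" by (simp add: T_def)
    finally have "norm (?k - ?l) \<le> 2 * norm (D (g y) ?l - D (g x) ?l)" using low[of "?k - ?l" "g x"] by simp
    also have "\<dots> \<le> 2 * (a * norm (g y - g x) * norm ?l)"
      using v unfolding lip_deriv_def by (intro mult_left_mono) auto
    also have "\<dots> \<le> 2 * (a * (2 * norm (x - y)) * (2 * norm h))"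
    proof (intro mult_left_mono mult_mono Sb)
      show "norm (g y - g x) \<le> 2 * norm (x - y)"
        using g3[of x y] norm_ge_zero[of "x - y"] unfolding norm_minus_commute[of "g y"] by linarith
    qed (use a in auto)
    finally show ?thesis by simp
  qed
  ultimately have "lip_deriv (8 * a) g (\<lambda>y. S (g y))" unfolding lip_deriv_def by blast
  then show thesis using that Sb by blast
qed

lemma lip_deriv_compose:
  fixes f :: "'b::euclidean_space \<Rightarrow> 'c::euclidean_space" and g :: "'a::euclidean_space \<Rightarrow> 'b"
  assumes f: "lip_deriv a f Df" "\<And>x h. norm (Df x h) \<le> m * norm h"
    and g: "lip_deriv b g Dg" "\<And>x h. norm (Dg x h) \<le> n * norm h"
    and pos: "0 \<le> a" "0 \<le> m" "0 \<le> n"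
  shows "lip_deriv (a * n * n + m * b) (f \<circ> g) (\<lambda>x h. Df (g x) (Dg x h))"
  unfolding lip_deriv_def
proof (intro conjI allI)
  have fd: "(f has_derivative Df x) (at x)" and gd: "(g has_derivative Dg x') (at x')" for x x'
    using f(1) g(1) unfolding lip_deriv_def by blast+
  show "(f \<circ> g has_derivative (\<lambda>h. Df (g x) (Dg x h))) (at x)" for x
    using diff_chain_at[OF gd fd] by (simp only: o_def)
  fix x y h
  have gl: "norm (g x - g y) \<le> n * norm (x - y)"
    by (rule lipschitz_of_derivative_bound[OF convex_UNIV gd g(2)]) auto
  have 1: "norm (Df (g x) (Dg x h) - Df (g y) (Dg x h)) \<le> (a * n * n) * norm (x - y) * norm h"
  proof -
    have "norm (Df (g x) (Dg x h) - Df (g y) (Dg x h)) \<le> a * norm (g x - g y) * norm (Dg x h)"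
      using f(1) unfolding lip_deriv_def by blast
    also have "\<dots> \<le> a * (n * norm (x - y)) * (n * norm h)"
      using pos gl by (intro mult_mono g(2) mult_left_mono) auto
    finally show ?thesis by (simp add: mult_ac)
  qed
  have 2: "norm (Df (g y) (Dg x h - Dg y h)) \<le> (m * b) * norm (x - y) * norm h"
  proof -
    have "norm (Df (g y) (Dg x h - Dg y h)) \<le> m * norm (Dg x h - Dg y h)" by (rule f(2))
    also have "\<dots> \<le> m * (b * norm (x - y) * norm h)"
      using g(1) pos unfolding lip_deriv_def by (intro mult_left_mono) auto
    finally show ?thesis by (simp add: mult_ac)
  qed
  have "Df (g x) (Dg x h) - Df (g y) (Dg y h) = (Df (g x) (Dg x h) - Df (g y) (Dg x h)) + Df (g y) (Dg x h - Dg y h)"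
    using linear_diff[OF has_derivative_linear[OF fd]] by simp
  then have "norm (Df (g x) (Dg x h) - Df (g y) (Dg y h))
      \<le> norm (Df (g x) (Dg x h) - Df (g y) (Dg x h)) + norm (Df (g y) (Dg x h - Dg y h))"
    by (metis norm_triangle_ineq)
  then show "norm (Df (g x) (Dg x h) - Df (g y) (Dg y h)) \<le> (a * n * n + m * b) * norm (x - y) * norm h"
    using 1 2 by (simp add: algebra_simps)
qed

text \<open>The 1-jet of \<open>u\<close> vanishes on \<open>A\<close>; the instance of interest is
  \<phi> - id on the complement of the open cube.\<close>

definition flat_on :: "'a set \<Rightarrow> real \<Rightarrow> ('a::euclidean_space \<Rightarrow> 'b::euclidean_space) \<Rightarrow> ('a \<Rightarrow> 'a \<Rightarrow> 'b) \<Rightarrow> bool" where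
  "flat_on A a u D \<longleftrightarrow> lip_deriv a u D \<and> (\<forall>x\<in>A. u x = 0 \<and> (\<forall>h. D x h = 0))"

text \<open>Both bounds come from expanding at a nearest point of \<open>A\<close>.\<close>

lemma flat_on_bounds:
  assumes u: "flat_on A a u D" and A: "closed A" "A \<noteq> {}" and a: "0 \<le> a"
  shows "norm (D x h) \<le> a * infdist x A * norm h" "norm (u x) \<le> a * infdist x A * infdist x A"
proof -
  obtain y where y: "y \<in> A" "\<And>z. z \<in> A \<Longrightarrow> dist x y \<le> dist x z"
    using distance_attains_inf[OF A] by metis
  have d: "infdist x A = norm (x - y)"
    using y A(2) unfolding infdist_def by (auto simp: dist_norm intro!: cInf_eq_minimum)
  have "norm (D x h - D y h) \<le> a * norm (x - y) * norm h"
    using u unfolding flat_on_def lip_deriv_def by blast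
  then show "norm (D x h) \<le> a * infdist x A * norm h" using u y(1) d unfolding flat_on_def by simp
  have "norm (u x - u y - D y (x - y)) \<le> a * norm (x - y) * norm (x - y)"
    using u a unfolding flat_on_def by (intro lip_deriv_remainder) auto
  then show "norm (u x) \<le> a * infdist x A * infdist x A" using u y(1) d unfolding flat_on_def by simp
qed

lemma flat_on_diff:
  assumes "flat_on A a u D" "flat_on A b v E"
  shows "flat_on A (a + b) (\<lambda>x. u x - v x) (\<lambda>x h. D x h - E x h)"
proof -
  have "((\<lambda>x. u x - v x) has_derivative (\<lambda>h. D x h - E x h)) (at x)" for x
    using assms unfolding flat_on_def lip_deriv_def by (intro has_derivative_diff) auto
  moreover have "norm ((D x h - E x h) - (D y h - E y h)) \<le> (a + b) * norm (x - y) * norm h" for x y h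
  proof -
    have 1: "norm (D x h - D y h) \<le> a * norm (x - y) * norm h" "norm (E x h - E y h) \<le> b * norm (x - y) * norm h"
      using assms unfolding flat_on_def lip_deriv_def by blast+
    have "(D x h - E x h) - (D y h - E y h) = (D x h - D y h) - (E x h - E y h)" by simp
    then have "norm ((D x h - E x h) - (D y h - E y h)) \<le> norm (D x h - D y h) + norm (E x h - E y h)"
      by (metis norm_triangle_ineq4)
    then show ?thesis using 1 by (simp add: algebra_simps)
  qed
  ultimately show ?thesis using assms unfolding flat_on_def lip_deriv_def by simp
qed

text \<open>Beyond distance \<theta> the function vanishes on an open set, and so does its
  derivative; closer to \<open>A\<close> flatness bounds it. A thin layer thus brings
  \<open>id + v\<close> as close to the identity as desired.\<close>

lemma lip_deriv_small:
  fixes v :: "'a::euclidean_space \<Rightarrow> 'b::euclidean_space"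
  assumes v: "flat_on A a v D" and A: "closed A" "A \<noteq> {}" and a: "0 \<le> a" and \<theta>: "0 \<le> \<theta>"
    and out: "\<And>x. \<theta> < infdist x A \<Longrightarrow> v x = 0"
  shows "norm (D x h) \<le> a * \<theta> * norm h"
proof (cases "\<theta> < infdist x A")
  case True
  have "open {x. \<theta> < infdist x A}"
    by (intro open_Collect_less continuous_intros)
  moreover have "(v has_derivative D x) (at x)" using v unfolding flat_on_def lip_deriv_def by blast
  ultimately have "((\<lambda>x. 0) has_derivative D x) (at x)"
    using has_derivative_transform_within_open[of v "D x" x UNIV "{x. \<theta> < infdist x A}" "\<lambda>x. 0"] True out by auto
  then have "D x = (\<lambda>h. 0)" using has_derivative_unique has_derivative_const by blast
  then show ?thesis using a \<theta> by simp
next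
  case False
  have "norm (D x h) \<le> a * infdist x A * norm h" by (rule flat_on_bounds[OF v A a])
  also have "\<dots> \<le> a * \<theta> * norm h" using False a by (intro mult_right_mono mult_left_mono) auto
  finally show ?thesis .
qed

section \<open>Cutting off flat functions\<close>

definition square_pos :: "real \<Rightarrow> real" where "square_pos s = (max 0 s)\<^sup>2"

lemma square_pos_deriv: "(square_pos has_real_derivative 2 * max 0 s) (at s)"
  unfolding has_field_derivative_def
proof (rule has_derivative_quadratic_remainder[where a = 1])
  fix t :: real
  have sq: "(t - s)\<^sup>2 = t * t - 2 * (s * t) + s * s" by (simp add: power2_eq_square algebra_simps)
  consider "0 \<le> s" "0 \<le> t" | "0 \<le> s" "t < 0" | "s < 0" "0 \<le> t" | "s < 0" "t < 0" by linarith
  then have "\<bar>square_pos t - square_pos s - 2 * max 0 s * (t - s)\<bar> \<le> (t - s)\<^sup>2"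
  proof cases
    case 1
    then have "square_pos t - square_pos s - 2 * max 0 s * (t - s) = (t - s)\<^sup>2"
      by (simp add: square_pos_def power2_eq_square algebra_simps)
    then show ?thesis by simp
  next
    case 2
    then have "0 \<le> t * t" "s * t \<le> 0" "0 \<le> s * s" by (simp_all add: mult_nonneg_nonpos)
    moreover have "square_pos t - square_pos s - 2 * max 0 s * (t - s) = s * s - 2 * (s * t)"
      using 2 by (simp add: square_pos_def power2_eq_square algebra_simps)
    ultimately show ?thesis unfolding sq by linarith
  next
    case 3
    then have "0 \<le> t * t" "s * t \<le> 0" "0 \<le> s * s" by (simp_all add: mult_nonpos_nonneg)
    moreover have "square_pos t - square_pos s - 2 * max 0 s * (t - s) = t * t"
      using 3 by (simp add: square_pos_def power2_eq_square algebra_simps)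
    ultimately show ?thesis unfolding sq by linarith
  next
    case 4
    then show ?thesis by (simp add: square_pos_def)
  qed
  then show "norm (square_pos t - square_pos s - 2 * max 0 s * (t - s)) \<le> 1 * norm (t - s) * norm (t - s)"
    by (simp add: power2_eq_square)
qed (rule bounded_linear_mult_right)

text \<open>The derivative is the tent over [0, 1] of height 2 and area 1. The C^1,1 class is all
  that the cut-offs have to preserve, and every constant stays explicit.\<close>

definition smooth_step :: "real \<Rightarrow> real" where
  "smooth_step s = 2 * square_pos s - 4 * square_pos (s - 1 / 2) + 2 * square_pos (s - 1)"

definition smooth_step' :: "real \<Rightarrow> real" where
  "smooth_step' s = 4 * max 0 s - 8 * max 0 (s - 1 / 2) + 4 * max 0 (s - 1)"

lemma smooth_step_deriv: "(smooth_step has_real_derivative smooth_step' s) (at s)"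
proof -
  have "((\<lambda>s. square_pos (s - c)) has_real_derivative 2 * max 0 (s - c)) (at s)" for c
  proof -
    have "((\<lambda>s. s - c) has_real_derivative 1) (at s)" by (auto intro!: derivative_eq_intros)
    from DERIV_chain2[OF square_pos_deriv this] show ?thesis by simp
  qed
  note d = this
  have "((\<lambda>s. 2 * square_pos s - 4 * square_pos (s - 1 / 2) + 2 * square_pos (s - 1)) has_real_derivative
      2 * (2 * max 0 s) - 4 * (2 * max 0 (s - 1 / 2)) + 2 * (2 * max 0 (s - 1))) (at s)"
    by (intro DERIV_add DERIV_diff DERIV_cmult square_pos_deriv d)
  then show ?thesis unfolding smooth_step_def[abs_def] smooth_step'_def by simp
qed

lemma smooth_step_eq: "s \<le> 0 \<Longrightarrow> smooth_step s = 0" "1 \<le> s \<Longrightarrow> smooth_step s = 1"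
  by (simp_all add: smooth_step_def square_pos_def max_def power2_eq_square algebra_simps)

lemma smooth_step'_bounds: "0 \<le> smooth_step' s" "smooth_step' s \<le> 2" "s \<le> 0 \<Longrightarrow> smooth_step' s = 0" "\<bar>smooth_step' s - smooth_step' t\<bar> \<le> 16 * \<bar>s - t\<bar>"
proof -
  show "0 \<le> smooth_step' s" "smooth_step' s \<le> 2" "s \<le> 0 \<Longrightarrow> smooth_step' s = 0" by (auto simp: smooth_step'_def max_def)
  have "\<bar>max 0 (s - c) - max 0 (t - c)\<bar> \<le> \<bar>s - t\<bar>" for c by linarith
  note lip = this
  have key: "\<bar>4 * a - 8 * b + 4 * c\<bar> \<le> 16 * d" if "\<bar>a\<bar> \<le> d" "\<bar>b\<bar> \<le> d" "\<bar>c\<bar> \<le> d" for a b c d :: real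
    using that by linarith
  have split: "4 * a - 8 * b + 4 * c - (4 * a' - 8 * b' + 4 * c') = 4 * (a - a') - 8 * (b - b') + 4 * (c - c')"
    for a b c a' b' c' :: real by (simp add: algebra_simps)
  have "smooth_step' s - smooth_step' t = 4 * (max 0 (s - 0) - max 0 (t - 0)) - 8 * (max 0 (s - 1 / 2) - max 0 (t - 1 / 2))
      + 4 * (max 0 (s - 1) - max 0 (t - 1))"
    unfolding smooth_step'_def diff_0_right by (rule split)
  then show "\<bar>smooth_step' s - smooth_step' t\<bar> \<le> 16 * \<bar>s - t\<bar>" by (simp only:) (intro key lip)
qed

lemma smooth_step_bounds: "0 \<le> smooth_step s" "smooth_step s \<le> 1"
proof -
  have mono: "smooth_step s \<le> smooth_step t" if "s \<le> t" for s t
    by (rule DERIV_nonneg_imp_nondecreasing[OF that]) (use smooth_step_deriv smooth_step'_bounds(1) in blast)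
  show "0 \<le> smooth_step s" using mono[of "min s 0" s] smooth_step_eq(1)[of "min s 0"] by simp
  show "smooth_step s \<le> 1" using mono[of s "max s 1"] smooth_step_eq(2)[of "max s 1"] by simp
qed

text \<open>Using \<open>x \<bullet> x\<close> and not the norm keeps it differentiable at 0. The
  argument is at least 1 for norms up to 1/2 and negative for norms from 1 on.\<close>

definition bump :: "'a::euclidean_space \<Rightarrow> real" where "bump x = smooth_step (3 / 2 - 2 * (x \<bullet> x))"

definition bump' :: "'a::euclidean_space \<Rightarrow> 'a \<Rightarrow> real" where
  "bump' x h = smooth_step' (3 / 2 - 2 * (x \<bullet> x)) * (- 4 * (x \<bullet> h))"

lemma bump_deriv: "(bump has_derivative bump' x) (at x)"
proof -
  have "((\<lambda>x. x \<bullet> x) has_derivative (\<lambda>h. x \<bullet> h + h \<bullet> x)) (at x)"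
    by (rule has_derivative_inner[OF has_derivative_ident has_derivative_ident])
  then have "((\<lambda>x. 3 / 2 - 2 * (x \<bullet> x)) has_derivative (\<lambda>h. 0 - 2 * (x \<bullet> h + h \<bullet> x))) (at x)"
    by (intro has_derivative_diff has_derivative_const has_derivative_mult_right)
  from has_derivative_compose[OF this smooth_step_deriv[unfolded has_field_derivative_def]]
  have "(bump has_derivative (\<lambda>h. smooth_step' (3 / 2 - 2 * (x \<bullet> x)) * (0 - 2 * (x \<bullet> h + h \<bullet> x)))) (at x)"
    unfolding bump_def[abs_def] .
  moreover have "(\<lambda>h. smooth_step' (3 / 2 - 2 * (x \<bullet> x)) * (0 - 2 * (x \<bullet> h + h \<bullet> x))) = bump' x"
    by (auto simp: bump'_def inner_commute)
  ultimately show ?thesis by simp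
qed

lemma bump_eq_1: assumes "norm x \<le> 1 / 2" shows "bump x = 1"
proof -
  have "x \<bullet> x \<le> (1 / 2)\<^sup>2" using assms unfolding dot_square_norm by (intro power_mono) auto
  then have "1 \<le> 3 / 2 - 2 * (x \<bullet> x)" by (simp add: power2_eq_square)
  then show ?thesis unfolding bump_def by (rule smooth_step_eq(2))
qed

lemma bump_outside: assumes "1 \<le> norm x" shows "bump x = 0" "bump' x h = 0"
proof -
  have "1\<^sup>2 \<le> x \<bullet> x" using assms unfolding dot_square_norm by (intro power_mono) auto
  then have "3 / 2 - 2 * (x \<bullet> x) \<le> 0" by simp
  then show "bump x = 0" "bump' x h = 0" unfolding bump_def bump'_def using smooth_step_eq(1) smooth_step'_bounds(3) by auto
qed

lemma norm_rescale:
  fixes x q :: "'a::real_normed_vector"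
  assumes "0 < r"
  shows "norm ((1 / r) *\<^sub>R (x - q)) \<le> c \<longleftrightarrow> dist q x \<le> c * r" "c \<le> norm ((1 / r) *\<^sub>R (x - q)) \<longleftrightarrow> c * r \<le> dist q x"
proof -
  have "norm ((1 / r) *\<^sub>R (x - q)) = dist q x / r" using assms by (simp add: dist_norm norm_minus_commute)
  then show "norm ((1 / r) *\<^sub>R (x - q)) \<le> c \<longleftrightarrow> dist q x \<le> c * r" "c \<le> norm ((1 / r) *\<^sub>R (x - q)) \<longleftrightarrow> c * r \<le> dist q x"
    using assms by (simp_all add: pos_divide_le_eq pos_le_divide_eq)
qed

lemma bump_bounds: "0 \<le> bump x" "bump x \<le> 1"
  unfolding bump_def by (rule smooth_step_bounds)+

lemma bump'_bound: assumes "norm x \<le> 1" shows "\<bar>bump' x h\<bar> \<le> 8 * norm h"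
proof -
  have "\<bar>x \<bullet> h\<bar> \<le> norm x * norm h" by (rule Cauchy_Schwarz_ineq2)
  also have "\<dots> \<le> 1 * norm h" using assms by (intro mult_right_mono) auto
  finally have "\<bar>smooth_step' (3 / 2 - 2 * (x \<bullet> x))\<bar> * \<bar>- 4 * (x \<bullet> h)\<bar> \<le> 2 * (4 * norm h)"
    using smooth_step'_bounds(1,2)[of "3 / 2 - 2 * (x \<bullet> x)"] by (intro mult_mono) auto
  then show ?thesis by (simp add: bump'_def abs_mult)
qed

text \<open>264 = 64 * 4 + 2 * 4: the increment of \<open>smooth_step'\<close> against
  \<open>4 * (x \<bullet> h)\<close>, and its size against the increment of
  \<open>4 * (x \<bullet> h)\<close>.\<close>

lemma bump'_lipschitz:
  assumes x: "norm x \<le> 1" and y: "norm y \<le> 1"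
  shows "\<bar>bump' x h - bump' y h\<bar> \<le> 264 * norm (x - y) * norm h"
proof -
  let ?s = "\<lambda>x. smooth_step' (3 / 2 - 2 * (x \<bullet> x))"
  have "(x - y) \<bullet> (x + y) = x \<bullet> x - y \<bullet> y"
    by (simp add: inner_diff_left inner_add_right inner_commute[of y x])
  then have "\<bar>x \<bullet> x - y \<bullet> y\<bar> = \<bar>(x - y) \<bullet> (x + y)\<bar>" by simp
  also have "\<dots> \<le> norm (x - y) * norm (x + y)" by (rule Cauchy_Schwarz_ineq2)
  also have "\<dots> \<le> norm (x - y) * 2"
    using x y norm_triangle_ineq[of x y] by (intro mult_left_mono) auto
  finally have "\<bar>?s x - ?s y\<bar> \<le> 64 * norm (x - y)"
  proof -
    assume *: "\<bar>x \<bullet> x - y \<bullet> y\<bar> \<le> norm (x - y) * 2"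
    have "\<bar>?s x - ?s y\<bar> \<le> 16 * \<bar>3 / 2 - 2 * (x \<bullet> x) - (3 / 2 - 2 * (y \<bullet> y))\<bar>" by (rule smooth_step'_bounds(4))
    also have "\<dots> = 32 * \<bar>x \<bullet> x - y \<bullet> y\<bar>" by (simp add: abs_if)
    finally show ?thesis using * by simp
  qed
  moreover have xh: "\<bar>x \<bullet> h\<bar> \<le> norm h"
    using Cauchy_Schwarz_ineq2[of x h] mult_right_mono[OF x, of "norm h"] by simp
  ultimately have 1: "\<bar>?s x - ?s y\<bar> * \<bar>4 * (x \<bullet> h)\<bar> \<le> (64 * norm (x - y)) * (4 * norm h)"
    by (intro mult_mono) auto
  have "\<bar>?s y\<bar> \<le> 2" using smooth_step'_bounds(1,2)[of "3 / 2 - 2 * (y \<bullet> y)"] by simp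
  moreover have "\<bar>4 * ((x - y) \<bullet> h)\<bar> \<le> 4 * (norm (x - y) * norm h)"
    using Cauchy_Schwarz_ineq2[of "x - y" h] by simp
  ultimately have 2: "\<bar>?s y\<bar> * \<bar>4 * ((x - y) \<bullet> h)\<bar> \<le> 2 * (4 * (norm (x - y) * norm h))"
    by (intro mult_mono) auto
  have "bump' x h - bump' y h = - ((?s x - ?s y) * (4 * (x \<bullet> h)) + ?s y * (4 * ((x - y) \<bullet> h)))"
    by (simp add: bump'_def algebra_simps inner_diff_left)
  then have "\<bar>bump' x h - bump' y h\<bar> = \<bar>(?s x - ?s y) * (4 * (x \<bullet> h)) + ?s y * (4 * ((x - y) \<bullet> h))\<bar>"
    by (simp only: abs_minus_cancel)
  also have "\<dots> \<le> \<bar>?s x - ?s y\<bar> * \<bar>4 * (x \<bullet> h)\<bar> + \<bar>?s y\<bar> * \<bar>4 * ((x - y) \<bullet> h)\<bar>"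
    by (rule order_trans[OF abs_triangle_ineq]) (simp only: abs_mult order_refl)
  finally show ?thesis using 1 2 by (simp add: algebra_simps)
qed

text \<open>The bump at scale \<open>r\<close> costs \<open>1 / r\<close> per derivative, which the quadratic decay of a flat
  function compensates as long as the distance to \<open>A\<close> is \<open>O(r)\<close>.\<close>
lemma lip_deriv_bump_mult:
  fixes u :: "'a::euclidean_space \<Rightarrow> 'b::euclidean_space"
  assumes u: "flat_on A a u D" and A: "closed A" "A \<noteq> {}" and a: "0 \<le> a" and r: "0 < r" and K: "0 \<le> K"
    and depth: "\<And>x. x \<in> cball q r \<Longrightarrow> infdist x A \<le> K * r"
  defines "z \<equiv> \<lambda>x. (1 / r) *\<^sub>R (x - q)"
  shows "lip_deriv ((1 + 16 * K + 264 * K\<^sup>2) * a) (\<lambda>x. bump (z x) *\<^sub>R u x)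
    (\<lambda>x h. bump (z x) *\<^sub>R D x h + bump' (z x) ((1 / r) *\<^sub>R h) *\<^sub>R u x)"
    (is "lip_deriv ?C ?f ?D")
proof -
  have ud: "(u has_derivative D x) (at x)" and uD: "norm (D x h - D y h) \<le> a * norm (x - y) * norm h" for x y h
    using u unfolding flat_on_def lip_deriv_def by blast+
  have zd: "(z has_derivative (\<lambda>h. (1 / r) *\<^sub>R h)) (at x)" for x
    unfolding z_def by (auto intro!: derivative_eq_intros)
  have bd: "((\<lambda>x. bump (z x)) has_derivative (\<lambda>h. bump' (z x) ((1 / r) *\<^sub>R h))) (at x)" for x
    using has_derivative_compose[OF zd bump_deriv] .
  have fd: "(?f has_derivative ?D x) (at x)" for x
    using has_derivative_scaleR[OF bd ud] by simp
  have nz: "norm (z x) \<le> 1 \<longleftrightarrow> x \<in> cball q r" for x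
    unfolding z_def norm_rescale[OF r] by simp
  have nz': "1 \<le> norm (z x)" if "dist q x \<ge> r" for x
    using that unfolding z_def norm_rescale[OF r] by simp
  have zz: "norm (z x - z y) = norm (x - y) / r" for x y
  proof -
    have "z x - z y = (1 / r) *\<^sub>R (x - y)" by (simp add: z_def algebra_simps)
    then show ?thesis using r by (simp add: mult_ac)
  qed
  have Db: "norm (D x h) \<le> a * (K * r) * norm h" and ub: "norm (u x) \<le> a * (K * r) * (K * r)" if "x \<in> cball q r" for x h
  proof -
    have "norm (D x h) \<le> a * infdist x A * norm h" by (rule flat_on_bounds[OF u A a])
    also have "\<dots> \<le> a * (K * r) * norm h" using depth[OF that] a by (intro mult_right_mono mult_left_mono) auto
    finally show "norm (D x h) \<le> a * (K * r) * norm h" .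
    have "norm (u x) \<le> a * infdist x A * infdist x A" by (rule flat_on_bounds[OF u A a])
    also have "\<dots> \<le> a * (K * r) * (K * r)" using depth[OF that] a infdist_nonneg K r
      by (intro mult_mono mult_left_mono mult_nonneg_nonneg) auto
    finally show "norm (u x) \<le> a * (K * r) * (K * r)" .
  qed
  have bb: "\<bar>bump' (z x) ((1 / r) *\<^sub>R h)\<bar> \<le> 8 / r * norm h" if "x \<in> cball q r" for x h
    using bump'_bound[of "z x" "(1 / r) *\<^sub>R h"] nz that r by simp
  have bl: "\<bar>bump (z x) - bump (z y)\<bar> \<le> 8 / r * norm (x - y)" if "x \<in> cball q r" "y \<in> cball q r" for x y
    using lipschitz_of_derivative_bound[OF convex_cball bd _ that, of "8 / r"] bb by simp
  have ul: "norm (u x - u y) \<le> a * (K * r) * norm (x - y)" if "x \<in> cball q r" "y \<in> cball q r" for x y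
    by (rule lipschitz_of_derivative_bound[OF convex_cball ud Db that])
  have C: "0 \<le> ?C" using a K by simp
  have "norm (?D x h - ?D y h) \<le> (?C * norm h) * norm (x - y)" for x y h
  proof (rule lipschitz_zero_extension[where S = "cball q r"])
    fix x y assume xy: "x \<in> cball q r" "y \<in> cball q r"
    let ?t = "norm (x - y) * norm h"
    have t: "0 \<le> ?t" by simp
    have 1: "norm (bump (z x) *\<^sub>R (D x h - D y h)) \<le> a * ?t"
    proof -
      have "\<bar>bump (z x)\<bar> * norm (D x h - D y h) \<le> 1 * (a * norm (x - y) * norm h)"
        using bump_bounds[of "z x"] uD by (intro mult_mono) auto
      then show ?thesis by simp
    qed
    have 2: "norm ((bump (z x) - bump (z y)) *\<^sub>R D y h) \<le> 8 * K * a * ?t"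
    proof -
      have "\<bar>bump (z x) - bump (z y)\<bar> * norm (D y h) \<le> (8 / r * norm (x - y)) * (a * (K * r) * norm h)"
        using bl[OF xy] Db[OF xy(2)] r by (intro mult_mono) auto
      then show ?thesis using r by (simp add: mult_ac)
    qed
    have 3: "norm (bump' (z x) ((1 / r) *\<^sub>R h) *\<^sub>R (u x - u y)) \<le> 8 * K * a * ?t"
    proof -
      have "\<bar>bump' (z x) ((1 / r) *\<^sub>R h)\<bar> * norm (u x - u y) \<le> (8 / r * norm h) * (a * (K * r) * norm (x - y))"
        using bb[OF xy(1)] ul[OF xy] r by (intro mult_mono) auto
      then show ?thesis using r by (simp add: mult_ac)
    qed
    have 4: "norm ((bump' (z x) ((1 / r) *\<^sub>R h) - bump' (z y) ((1 / r) *\<^sub>R h)) *\<^sub>R u y) \<le> 264 * K\<^sup>2 * a * ?t"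
    proof -
      have "\<bar>bump' (z x) ((1 / r) *\<^sub>R h) - bump' (z y) ((1 / r) *\<^sub>R h)\<bar> \<le> 264 * (norm (x - y) / r) * (norm h / r)"
        using bump'_lipschitz[of "z x" "z y" "(1 / r) *\<^sub>R h"] nz xy r zz[of x y] by simp
      then have "\<bar>bump' (z x) ((1 / r) *\<^sub>R h) - bump' (z y) ((1 / r) *\<^sub>R h)\<bar> * norm (u y)
          \<le> (264 * (norm (x - y) / r) * (norm h / r)) * (a * (K * r) * (K * r))"
        using ub[OF xy(2)] r by (intro mult_mono) auto
      then show ?thesis using r by (simp add: power2_eq_square mult_ac)
    qed
    \<comment> \<open>Both product-rule terms are split once more. On the ball \<open>u\<close> is
      of order r^2 and its derivative of order r, so in each of the four pieces the powers of
      \<open>r\<close> cancel.\<close>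
    have "?D x h - ?D y h = bump (z x) *\<^sub>R (D x h - D y h) + (bump (z x) - bump (z y)) *\<^sub>R D y h
      + bump' (z x) ((1 / r) *\<^sub>R h) *\<^sub>R (u x - u y) + (bump' (z x) ((1 / r) *\<^sub>R h) - bump' (z y) ((1 / r) *\<^sub>R h)) *\<^sub>R u y"
      by (simp add: algebra_simps)
    also have "norm \<dots> \<le> a * ?t + 8 * K * a * ?t + 8 * K * a * ?t + 264 * K\<^sup>2 * a * ?t"
      by (rule order_trans[OF norm_triangle_ineq add_mono[OF order_trans[OF norm_triangle_ineq add_mono[OF order_trans[OF norm_triangle_ineq add_mono[OF 1 2]] 3]] 4]])
    also have "\<dots> = (?C * norm h) * norm (x - y)" by (simp add: algebra_simps)
    finally show "norm (?D x h - ?D y h) \<le> (?C * norm h) * norm (x - y)" .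
  next
    fix x assume "x \<notin> cball q r"
    then show "?D x h = 0" using bump_outside[OF nz'[of x]] by simp
  next
    fix x assume "x \<in> frontier (cball q r)"
    then show "?D x h = 0" using bump_outside[OF nz'[of x]] by (simp add: frontier_cball)
  qed (use C in auto)
  then show ?thesis using fd unfolding lip_deriv_def by (simp add: mult_ac)
qed

definition bump_cut :: "'j set \<Rightarrow> ('j \<Rightarrow> 'a::euclidean_space) \<Rightarrow> ('j \<Rightarrow> real) \<Rightarrow> ('a \<Rightarrow> 'b::euclidean_space) \<Rightarrow> 'a \<Rightarrow> 'b" where
  "bump_cut J q r u x = u x - disjoint_sum J (\<lambda>j x. bump ((1 / r j) *\<^sub>R (x - q j)) *\<^sub>R u x) x"

text \<open>The factor is 1 for \<open>u\<close> itself plus twice the cost of one bump, the 2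
  coming from the disjoint sum. It depends on \<open>K\<close> alone, so a color has a fixed price
  whatever the size and number of its balls.\<close>

lemma flat_on_bump_cut:
  fixes u :: "'a::euclidean_space \<Rightarrow> 'b::euclidean_space"
  assumes u: "flat_on A a u D" and A: "closed A" "A \<noteq> {}" and a: "0 \<le> a" and K: "0 \<le> K"
    and disj: "disjoint_family_on (\<lambda>j. ball (q j) (r j)) J" and r: "\<And>j. j \<in> J \<Longrightarrow> 0 < r j"
    and depth: "\<And>j x. j \<in> J \<Longrightarrow> x \<in> cball (q j) (r j) \<Longrightarrow> infdist x A \<le> K * r j"
  shows "\<exists>D'. flat_on A ((1 + 2 * (1 + 16 * K + 264 * K\<^sup>2)) * a) (bump_cut J q r u) D'"
proof -
  let ?C = "(1 + 16 * K + 264 * K\<^sup>2) * a"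
  let ?z = "\<lambda>j x. (1 / r j) *\<^sub>R (x - q j)"
  let ?f = "\<lambda>j x. bump (?z j x) *\<^sub>R u x"
  let ?D = "\<lambda>j x h. bump (?z j x) *\<^sub>R D x h + bump' (?z j x) ((1 / r j) *\<^sub>R h) *\<^sub>R u x"
  have nz: "1 \<le> norm (?z j x)" if "j \<in> J" "x \<notin> ball (q j) (r j)" for j x
    using that(2) unfolding norm_rescale[OF r[OF that(1)]] by simp
  have "lip_deriv (2 * ?C) (disjoint_sum J ?f) (\<lambda>x h. disjoint_sum J (\<lambda>j x. ?D j x h) x)"
  proof (rule lip_deriv_disjoint_sum[OF disj])
    fix j x h assume "j \<in> J" "x \<notin> ball (q j) (r j)"
    note o = bump_outside[OF nz[OF this]]
    show "?f j x = 0" using o by simp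
    show "?D j x h = 0" using o by simp
  next
    fix j assume "j \<in> J"
    then show "lip_deriv ?C (?f j) (?D j)"
      by (intro lip_deriv_bump_mult[OF u A a r K depth])
  qed (use a K in auto)
  moreover have "disjoint_sum J ?f x = 0" "disjoint_sum J (\<lambda>j x. ?D j x h) x = 0" if "x \<in> A" for x h
    using u that unfolding flat_on_def by (auto intro!: disjoint_sum_eq_0)
  ultimately have "flat_on A (2 * ?C) (disjoint_sum J ?f) (\<lambda>x h. disjoint_sum J (\<lambda>j x. ?D j x h) x)"
    unfolding flat_on_def by blast
  from flat_on_diff[OF u this]
  have "flat_on A (a + 2 * ?C) (bump_cut J q r u) (\<lambda>x h. D x h - disjoint_sum J (\<lambda>j x. ?D j x h) x)"
    unfolding bump_cut_def[abs_def] .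
  then show ?thesis by (intro exI) (simp add: algebra_simps)
qed

lemma bump_cut_outside:
  assumes "\<And>j. j \<in> J \<Longrightarrow> 0 < r j" "\<And>j. j \<in> J \<Longrightarrow> x \<notin> ball (q j) (r j)"
  shows "bump_cut J q r u x = u x"
proof -
  have "disjoint_sum J (\<lambda>j x. bump ((1 / r j) *\<^sub>R (x - q j)) *\<^sub>R u x) x = 0"
  proof (rule disjoint_sum_eq_0)
    fix j assume j: "j \<in> J"
    have "1 \<le> norm ((1 / r j) *\<^sub>R (x - q j))"
      using assms(2)[OF j] unfolding norm_rescale[OF assms(1)[OF j]] by simp
    then show "bump ((1 / r j) *\<^sub>R (x - q j)) *\<^sub>R u x = 0" by (simp only: bump_outside scaleR_zero_left)
  qed
  then show ?thesis by (simp add: bump_cut_def)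
qed

lemma bump_cut_zero: "u x = 0 \<Longrightarrow> bump_cut J q r u x = 0"
  by (simp add: bump_cut_def disjoint_sum_eq_0)

lemma bump_cut_center:
  assumes disj: "disjoint_family_on (\<lambda>j. ball (q j) (r j)) J" and r: "\<And>j. j \<in> J \<Longrightarrow> 0 < r j"
    and j: "j \<in> J" "dist (q j) x \<le> r j / 2"
  shows "bump_cut J q r u x = 0"
proof -
  have x: "x \<in> ball (q j) (r j)" using j r[OF j(1)] by simp
  have "disjoint_sum J (\<lambda>j x. bump ((1 / r j) *\<^sub>R (x - q j)) *\<^sub>R u x) x = bump ((1 / r j) *\<^sub>R (x - q j)) *\<^sub>R u x"
  proof (rule disjoint_sum_eq[OF j(1)])
    fix i assume i: "i \<in> J" "i \<noteq> j"
    then have "ball (q i) (r i) \<inter> ball (q j) (r j) = {}" using j(1) by (intro disjoint_family_onD[OF disj])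
    then have "x \<notin> ball (q i) (r i)" using x by (metis IntI empty_iff)
    then have "1 \<le> norm ((1 / r i) *\<^sub>R (x - q i))"
      unfolding norm_rescale[OF r[OF i(1)]] by simp
    then show "bump ((1 / r i) *\<^sub>R (x - q i)) *\<^sub>R u x = 0" by (simp only: bump_outside scaleR_zero_left)
  qed
  moreover have "bump ((1 / r j) *\<^sub>R (x - q j)) = 1"
    using j(2) unfolding norm_rescale(1)[OF r[OF j(1)]] by (intro bump_eq_1) (simp only: norm_rescale(1)[OF r[OF j(1)]])
  ultimately show ?thesis by (simp add: bump_cut_def)
qed

section \<open>Whitney cells of the cube\<close>

text \<open>The faces of the cube are included: this is the closure of the complement of
  \<open>unit_cube\<close>, on which jets vanish by continuity.\<close>

definition cube_exterior :: "(real^'n) set" where "cube_exterior = - box 0 One"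

definition depth :: "real^'n \<Rightarrow> real" where "depth x = infdist x cube_exterior"

lemma closed_cube_exterior: "closed cube_exterior" and cube_exterior_nonempty: "cube_exterior \<noteq> {}"
proof -
  show "closed cube_exterior" unfolding cube_exterior_def by (intro closed_Compl open_box)
  have "box 0 One \<noteq> (UNIV :: (real^'n) set)" using bounded_box not_bounded_UNIV by metis
  then show "(cube_exterior :: (real^'n) set) \<noteq> {}" unfolding cube_exterior_def by blast
qed

lemma depth_lipschitz: "\<bar>depth x - depth y\<bar> \<le> dist x y"
  unfolding depth_def by (rule infdist_triangle_abs)

lemma depth_pos_imp_in_cube: "0 < depth x \<Longrightarrow> x \<in> unit_cube"
proof (rule ccontr)
  assume "0 < depth x" "x \<notin> unit_cube"
  then have "x \<in> cube_exterior" unfolding cube_exterior_def unit_cube_def using box_subset_cbox by blast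
  then have "depth x = 0" unfolding depth_def by simp
  then show False using \<open>0 < depth x\<close> by simp
qed

lemma depth_eq_0: "depth x = 0 \<Longrightarrow> x \<in> cube_exterior"
  using in_closed_iff_infdist_zero[OF closed_cube_exterior cube_exterior_nonempty] unfolding depth_def by blast

text \<open>Whitney cells are indexed by a dyadic level and a grid point; two cells of the same
  level and color are separated because their grid coordinates agree modulo \<open>88 n\<close>.\<close>
type_synonym 'n cell = "nat \<times> ('n \<Rightarrow> int)"

text \<open>The 128 makes 22 radii less than a quarter of the dyadic size, so the depth varies
  little on the enlarged ball of a cell.\<close>

definition radius :: "'n cell \<Rightarrow> real" where "radius j = (1 / 2) ^ fst j / 128"

text \<open>With this grid spacing, rounding all coordinates down moves a point by at most
  \<open>radius j / 2\<close> in the l1 norm.\<close>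

definition center :: "'n::finite cell \<Rightarrow> real^'n" where
  "center j = (\<chi> i. radius j / (2 * real CARD('n)) * of_int (snd j i))"

text \<open>A level modulo 4 and grid coordinates modulo 88 n, with n the dimension, coded in the
  type of cells; there are 4 * (88 n)^n of them.\<close>

definition colors :: "'n::finite cell set" where
  "colors = {..<4} \<times> (UNIV \<rightarrow>\<^sub>E {0..<88 * int CARD('n)})"

text \<open>\<open>k0\<close> is the coarsest level and fixes the thickness of the boundary layer;
  \<open>colors\<close> is independent of it. The window from 1/2 to 3 leaves room for the distance
  between a point and its grid point.\<close>

definition cells :: "nat \<Rightarrow> 'n::finite cell \<Rightarrow> 'n cell set" where
  "cells k0 c = {j. k0 \<le> fst j \<and> fst j mod 4 = fst c \<and> (\<forall>i. snd j i mod (88 * int CARD('n)) = snd c i) \<and>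
     (1 / 2) ^ fst j / 2 \<le> depth (center j) \<and> depth (center j) \<le> 3 * (1 / 2) ^ fst j}"

lemma finite_colors: "finite (colors :: 'n::finite cell set)"
  unfolding colors_def by (intro finite_cartesian_product finite_PiE) auto

lemma radius_pos: "0 < radius j"
  by (simp add: radius_def)

lemma radius_le: "radius j \<le> 1 / 128"
  by (simp add: radius_def power_le_one)

lemma depth_near_cell:
  assumes "j \<in> cells k0 c" "dist (center j) x < 22 * radius j"
  shows "(1 / 2) ^ fst j / 4 < depth x" "depth x < 4 * (1 / 2) ^ fst j"
  using assms depth_lipschitz[of "center j" x] unfolding cells_def radius_def by auto

lemma cell_ball_in_cube: "j \<in> cells k0 c \<Longrightarrow> ball (center j) (22 * radius j) \<subseteq> unit_cube"
proof
  fix x assume "j \<in> cells k0 c" "x \<in> ball (center j) (22 * radius j)"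
  then have "(1 / 2) ^ fst j / 4 < depth x" by (intro depth_near_cell) auto
  moreover have "0 < (1 / 2 :: real) ^ fst j / 4" by simp
  ultimately have "0 < depth x" by linarith
  then show "x \<in> unit_cube" by (rule depth_pos_imp_in_cube)
qed

text \<open>On its enlarged ball a cell sees depths between 1/4 and 4 times its dyadic size.
  Distinct levels that agree modulo 4 are at least 4 apart, and 2^4 is exactly the ratio of these
  bounds.\<close>

lemma cells_level_eq:
  assumes i: "i \<in> cells k0 c" "dist (center i) x < 22 * radius i"
    and j: "j \<in> cells k0 c" "dist (center j) x < 22 * radius j"
  shows "fst i = fst j"
proof -
  have *: False if "i \<in> cells k0 c" "dist (center i) x < 22 * radius i"
    "j \<in> cells k0 c" "dist (center j) x < 22 * radius j" "fst i < fst j" for i j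
  proof -
    have "fst i mod 4 = fst j mod 4" using that(1,3) unfolding cells_def by simp
    then have "fst i + 4 \<le> fst j" using that(5) by presburger
    then have "(1 / 2 :: real) ^ fst j \<le> (1 / 2) ^ (fst i + 4)" by (intro power_decreasing) auto
    also have "(1 / 2 :: real) ^ (fst i + 4) = (1 / 2) ^ fst i / 16" by (simp add: power_add power4_eq_xxxx)
    finally show False using depth_near_cell(1)[OF that(1,2)] depth_near_cell(2)[OF that(3,4)] by linarith
  qed
  show ?thesis using *[OF i j] *[OF j i] by (meson linorder_neqE_nat)
qed

text \<open>At equal levels some grid coordinate differs by at least 88 n, which at spacing radius /
  (2 n) is 44 radii, twice the size of the enlarged balls.\<close>

lemma cells_disjoint:
  fixes c :: "'n::finite cell"
  shows "disjoint_family_on (\<lambda>j. ball (center j) (22 * radius j)) (cells k0 c)"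
  unfolding disjoint_family_on_def
proof (intro ballI impI, rule ccontr)
  fix i j assume ij: "i \<in> cells k0 c" "j \<in> cells k0 c" "i \<noteq> j"
    "ball (center i) (22 * radius i) \<inter> ball (center j) (22 * radius j) \<noteq> {}"
  then obtain x where x: "dist (center i) x < 22 * radius i" "dist (center j) x < 22 * radius j" by auto
  have level: "fst i = fst j" using cells_level_eq[OF ij(1) x(1) ij(2) x(2)] .
  then have r: "radius j = radius i" by (simp add: radius_def)
  have "snd i \<noteq> snd j" using level ij(3) by (simp add: prod_eq_iff)
  then obtain l where l: "snd i l \<noteq> snd j l" by blast
  let ?M = "88 * int CARD('n)"
  have "snd i l mod ?M = snd j l mod ?M" using ij(1,2) unfolding cells_def by simp
  then have "?M dvd snd i l - snd j l" by (simp only: mod_eq_dvd_iff)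
  then have "?M \<le> \<bar>snd i l - snd j l\<bar>" using l by (intro zdvd_imp_le) (auto simp: dvd_abs_iff)
  then have "real_of_int ?M \<le> real_of_int \<bar>snd i l - snd j l\<bar>" by (simp only: of_int_le_iff)
  then have M: "88 * real CARD('n) \<le> \<bar>real_of_int (snd i l) - real_of_int (snd j l)\<bar>" by simp
  have n: "0 < real CARD('n)" by simp
  have "44 * radius i = radius i / (2 * real CARD('n)) * (88 * real CARD('n))" using n by (simp add: field_simps)
  also have "\<dots> \<le> radius i / (2 * real CARD('n)) * \<bar>real_of_int (snd i l) - real_of_int (snd j l)\<bar>"
    using M radius_pos[of i] n by (intro mult_left_mono) auto
  also have "\<dots> = \<bar>(center i - center j) $ l\<bar>"
    using radius_pos[of i] n by (simp add: center_def r abs_mult flip: right_diff_distrib diff_divide_distrib)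
  also have "\<dots> \<le> dist (center i) (center j)" unfolding dist_norm by (rule component_le_norm_cart)
  also have "\<dots> < 44 * radius i" using x r dist_triangle2[of "center i" "center j" x] by simp
  finally show False by simp
qed

text \<open>The level is the least \<open>k\<close> with \<open>(1 / 2) ^ k \<le> depth x\<close>,
  so the depth is below twice that size; the center comes from rounding down the coordinates of
  \<open>x\<close>.\<close>

lemma cells_cover:
  fixes x :: "real^'n"
  assumes x: "0 < depth x" "depth x < (1 / 2) ^ k0"
  shows "\<exists>c\<in>colors. \<exists>j\<in>cells k0 c. dist (center j) x \<le> radius j / 2"
proof -
  obtain k1 :: nat where k1: "(1 / 2) ^ k1 < depth x" using real_arch_pow_inv[OF x(1), of "1 / 2"] by auto
  define k where "k = (LEAST k. (1 / 2 :: real) ^ k \<le> depth x)"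
  have k: "(1 / 2) ^ k \<le> depth x" unfolding k_def
    by (rule LeastI[of "\<lambda>k. (1 / 2) ^ k \<le> depth x"]) (rule less_imp_le[OF k1])
  have small: "depth x < (1 / 2) ^ l" if "l < k" for l
    using not_less_Least[of l "\<lambda>k. (1 / 2 :: real) ^ k \<le> depth x"] that unfolding k_def by linarith
  have "k0 < k"
  proof (rule ccontr)
    assume "\<not> k0 < k"
    then have "(1 / 2 :: real) ^ k0 \<le> (1 / 2) ^ k" by (intro power_decreasing) auto
    then show False using k x(2) by linarith
  qed
  then have "depth x < (1 / 2) ^ (k - 1)" by (intro small) simp
  also have "(1 / 2 :: real) ^ (k - 1) = 2 * (1 / 2) ^ k" using \<open>k0 < k\<close> by (cases k) auto
  finally have k': "depth x < 2 * (1 / 2) ^ k" .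
  define h where "h = (1 / 2) ^ k / 128 / (2 * real CARD('n))"
  have h: "0 < h" by (simp add: h_def)
  define m where "m = (\<lambda>i. \<lfloor>x $ i / h\<rfloor>)"
  define j where "j = (k, m)"
  have rj: "radius j = (1 / 2) ^ k / 128" by (simp add: radius_def j_def)
  have cj: "center j $ i = h * of_int (m i)" for i by (simp add: center_def rj h_def) (simp add: j_def)
  have ci: "\<bar>(center j - x) $ i\<bar> \<le> h" for i
  proof -
    have "of_int (m i) \<le> x $ i / h" "x $ i / h < of_int (m i) + 1" unfolding m_def by linarith+
    then have "h * of_int (m i) \<le> x $ i" "x $ i < h * of_int (m i) + h"
      using h by (simp_all add: field_simps)
    then show ?thesis unfolding vector_minus_component cj by linarith
  qed
  have "dist (center j) x \<le> (\<Sum>i\<in>UNIV. \<bar>(center j - x) $ i\<bar>)" unfolding dist_norm by (rule norm_le_l1_cart)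
  also have "\<dots> \<le> (\<Sum>i\<in>(UNIV::'n set). h)" by (intro sum_mono ci)
  also have "\<dots> = radius j / 2" by (simp add: rj h_def)
  finally have d: "dist (center j) x \<le> radius j / 2" .
  define c where "c = (k mod 4, \<lambda>i. m i mod (88 * int CARD('n)))"
  have "c \<in> colors" unfolding colors_def c_def by auto
  moreover have "j \<in> cells k0 c"
  proof -
    have "\<bar>depth (center j) - depth x\<bar> \<le> radius j / 2" using depth_lipschitz[of "center j" x] d by linarith
    then have "(1 / 2) ^ k / 2 \<le> depth (center j)" "depth (center j) \<le> 3 * (1 / 2) ^ k"
      using k k' unfolding rj abs_le_iff by linarith+
    then show ?thesis using \<open>k0 < k\<close> unfolding cells_def by (simp add: c_def j_def)
  qed
  ultimately show ?thesis using d by blast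
qed

text \<open>512 = 4 * 128; this is the \<open>K\<close> with which flat functions are cut off on
  cells.\<close>

lemma cell_radius_le_depth:
  assumes "j \<in> cells k0 c" "x \<in> cball (center j) (radius j)"
  shows "infdist x cube_exterior \<le> 512 * radius j"
proof -
  have "dist (center j) x < 22 * radius j" using assms(2) radius_pos[of j] unfolding mem_cball by linarith
  from depth_near_cell(2)[OF assms(1) this] show ?thesis by (simp add: depth_def radius_def)
qed

lemma depth_small_on_cell:
  assumes "j \<in> cells k0 c" "x \<in> ball (center j) (radius j)"
  shows "depth x < 4 * (1 / 2) ^ k0"
proof -
  have "dist (center j) x < 22 * radius j" using assms(2) radius_pos[of j] unfolding mem_ball by linarith
  then have "depth x < 4 * (1 / 2) ^ fst j" by (rule depth_near_cell(2)[OF assms(1)])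
  moreover have "(1 / 2 :: real) ^ fst j \<le> (1 / 2) ^ k0" using assms(1) unfolding cells_def by (intro power_decreasing) auto
  ultimately show ?thesis by linarith
qed

text \<open>The contraction is centered here, beside the cell. At 11/2 radii, the ball of one radius
  around \<open>center j\<close> lies in the shell from 4 to 7 radii, which is the shell of an
  annular map for the ball of 16 radii around the pole; 11/2 + 16 < 22 keeps this ball inside the
  enlarged one.\<close>

definition pole :: "'n::finite cell \<Rightarrow> real^'n" where
  "pole j = center j + (11 / 2 * radius j) *\<^sub>R axis undefined 1"

lemma dist_pole: "dist (center j) (pole j) = 11 / 2 * radius j"
  using radius_pos[of j] by (simp add: pole_def dist_norm)

lemma shifted_annulus:
  assumes "0 < \<rho>" "dist q p = 11 / 2 * \<rho>" "x \<in> ball q \<rho>"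
  shows "16 * \<rho> / 4 < norm (x - p)" "norm (x - p) < 7 / 16 * (16 * \<rho>)"
proof -
  have "dist q x < \<rho>" using assms(3) by simp
  then show "16 * \<rho> / 4 < norm (x - p)" "norm (x - p) < 7 / 16 * (16 * \<rho>)"
    using assms(1,2) dist_triangle[of q p x] dist_triangle3[of x p q]
    unfolding dist_norm[symmetric] by linarith+
qed

lemma shifted_ball:
  assumes "0 < \<rho>" "dist q p = 11 / 2 * \<rho>"
  shows "cball p (16 * \<rho>) \<subseteq> ball q (22 * \<rho>)"
proof
  fix x assume "x \<in> cball p (16 * \<rho>)"
  then show "x \<in> ball q (22 * \<rho>)"
    using assms dist_triangle[of q x p] unfolding mem_ball mem_cball by linarith
qed

lemmas pole_annulus = shifted_annulus[OF radius_pos dist_pole]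
lemmas pole_ball = shifted_ball[OF radius_pos dist_pole]

section \<open>The part of a diffeomorphism near the boundary\<close>

lemma lip_deriv_add_id:
  fixes v :: "'a::euclidean_space \<Rightarrow> 'a"
  assumes "lip_deriv a v D"
  shows "lip_deriv a (\<lambda>x. x + v x) (\<lambda>x h. h + D x h)"
  using assms unfolding lip_deriv_def
  by (auto intro!: has_derivative_add has_derivative_ident)

text \<open>If \<psi> x left the ball, the segment from \<open>x\<close> to it would meet the sphere
  in a fixed point \<open>z\<close>. The displacement at \<open>x\<close> is at most
  \<open>c * norm (x - z)\<close>, hence at most \<open>c\<close> times itself, hence zero.\<close>

lemma preserves_ball:
  fixes \<psi> :: "'a::euclidean_space \<Rightarrow> 'a"
  assumes lip: "\<And>x y. norm ((\<psi> x - x) - (\<psi> y - y)) \<le> c * norm (x - y)" and c: "0 \<le> c" "c < 1"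
    and fix_sphere: "\<And>z. z \<in> sphere p R \<Longrightarrow> \<psi> z = z" and R: "0 < R" and x: "x \<in> ball p R"
  shows "\<psi> x \<in> ball p R"
proof (rule ccontr)
  assume out: "\<psi> x \<notin> ball p R"
  have "closed_segment x (\<psi> x) \<inter> frontier (ball p R) \<noteq> {}"
    using x out by (intro connected_Int_frontier) auto
  then obtain z where z: "z \<in> closed_segment x (\<psi> x)" "z \<in> frontier (ball p R)" by blast
  then have "\<psi> z = z" using fix_sphere R by (simp add: frontier_ball)
  then have "norm (\<psi> x - x) \<le> c * norm (x - z)" using lip[of x z] by simp
  also have "\<dots> \<le> c * norm (\<psi> x - x)"
    using segment_bound(1)[OF z(1)] c by (intro mult_left_mono) (auto simp: norm_minus_commute)
  finally have "(1 - c) * norm (\<psi> x - x) \<le> 0" by (simp add: algebra_simps)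
  then have "\<psi> x = x" using c by (simp add: mult_le_0_iff)
  then show False using x out by simp
qed

definition cut_factor :: real where
  "cut_factor = 1 + 2 * (1 + 16 * 512 + 264 * 512\<^sup>2)"

lemma cut_factor_ge_1: "1 \<le> cut_factor"
  by (simp add: cut_factor_def)

primrec color_cut :: "nat \<Rightarrow> (nat \<Rightarrow> 'n::finite cell) \<Rightarrow> (real^'n \<Rightarrow> real^'n) \<Rightarrow> nat \<Rightarrow> real^'n \<Rightarrow> real^'n" where
  "color_cut k0 c u 0 = u"
| "color_cut k0 c u (Suc i) = bump_cut (cells k0 (c i)) center radius (color_cut k0 c u i)"

lemma cells_disjoint_small: "disjoint_family_on (\<lambda>j. ball (center j) (radius j)) (cells k0 c)"
proof -
  have "ball (center j) (radius j) \<subseteq> ball (center j) (22 * radius j)" for j :: "'n::finite cell"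
    using radius_pos[of j] by (intro subset_ball) simp
  then show ?thesis using cells_disjoint[of k0 c] unfolding disjoint_family_on_def by blast
qed

lemma flat_on_color_cut:
  assumes "flat_on cube_exterior a u D" "0 \<le> a"
  shows "\<exists>D'. flat_on cube_exterior (cut_factor ^ i * a) (color_cut k0 c u i) D'"
proof (induction i)
  case 0
  then show ?case using assms by auto
next
  case (Suc i)
  then obtain D' where D': "flat_on cube_exterior (cut_factor ^ i * a) (color_cut k0 c u i) D'" by blast
  have "0 \<le> cut_factor ^ i * a" using assms cut_factor_ge_1 by simp
  from flat_on_bump_cut[OF D' closed_cube_exterior cube_exterior_nonempty this, of 512, OF _ cells_disjoint_small radius_pos cell_radius_le_depth]
  show ?case unfolding color_cut.simps power_Suc mult.assoc cut_factor_def[symmetric] by simp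
qed

lemma color_cut_deep: "4 * (1 / 2) ^ k0 \<le> depth x \<Longrightarrow> color_cut k0 c u i x = u x"
proof (induction i)
  case (Suc i)
  have "x \<notin> ball (center j) (radius j)" if "j \<in> cells k0 (c i)" for j
    using depth_small_on_cell[OF that, of x] Suc(2) by linarith
  then have "color_cut k0 c u (Suc i) x = color_cut k0 c u i x"
    unfolding color_cut.simps by (intro bump_cut_outside radius_pos)
  then show ?case using Suc by simp
qed simp

lemma color_cut_zero_mono: "color_cut k0 c u i x = 0 \<Longrightarrow> i \<le> l \<Longrightarrow> color_cut k0 c u l x = 0"
  by (induction l rule: nat_induct) (auto simp: le_Suc_eq bump_cut_zero)

text \<open>A point of positive depth in the layer lies in the half-size ball of some cell; the
  round of that color makes the value zero, and later rounds keep it zero.\<close>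

lemma color_cut_shallow:
  fixes u :: "real^'n \<Rightarrow> real^'n" and c :: "nat \<Rightarrow> 'n cell"
  assumes u: "\<And>x. x \<in> cube_exterior \<Longrightarrow> u x = 0" and c: "c ` {..<m} = colors" and x: "depth x < (1 / 2) ^ k0"
  shows "color_cut k0 c u m x = 0"
proof (cases "depth x = 0")
  case True
  then have "color_cut k0 c u 0 x = 0" using u depth_eq_0[of x] by simp
  then show ?thesis by (rule color_cut_zero_mono) simp
next
  case False
  then have "0 < depth x" unfolding depth_def using infdist_nonneg[of x cube_exterior] by linarith
  then obtain b j where b: "b \<in> colors" "j \<in> cells k0 b" "dist (center j) x \<le> radius j / 2"
    using cells_cover[OF _ x] by blast
  then obtain i where i: "i < m" "c i = b" using c by (metis image_iff lessThan_iff)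
  have "color_cut k0 c u (Suc i) x = 0"
    unfolding color_cut.simps i(2) by (rule bump_cut_center[OF cells_disjoint_small radius_pos b(2,3)])
  then show ?thesis using i(1) by (intro color_cut_zero_mono[of k0 c u "Suc i" x m]) auto
qed

text \<open>Consecutive maps \<open>x + v\<^sub>i x\<close>, with \<open>v\<^sub>i\<close> the part of \<open>u\<close> still to be removed after \<open>i\<close> colors, differ by
  a diffeomorphism supported in the cells of one color.\<close>
lemma near_boundary_flowable:
  fixes u :: "real^'n \<Rightarrow> real^'n" and c :: "nat \<Rightarrow> 'n cell"
  assumes u: "flat_on cube_exterior a u D" and a: "0 \<le> a" and c: "c ` {..<m} = colors"
  shows "\<exists>v D' b \<kappa>. flowable (2 * m) (\<lambda>x. x + v x) \<and> lip_deriv b v D' \<and> 0 \<le> b \<and>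
    (\<forall>x h. norm (D' x h) \<le> 1 / 8 * norm h) \<and> 0 < \<kappa> \<and> (\<forall>x. depth x < \<kappa> \<longrightarrow> v x = u x) \<and> (\<forall>x\<in>cube_exterior. v x = 0)"
proof -
  \<comment> \<open>Bounds the sum of the constants of \<open>U i\<close> and \<open>U m\<close> for
    every \<open>i \<le> m\<close>. It does not depend on the cells, so \<open>k0\<close> can be
    chosen after it.\<close>
  define b where "b = 2 * cut_factor ^ m * a"
  have b: "0 \<le> b" using a cut_factor_ge_1 by (simp add: b_def)
  obtain k0 :: nat where k0: "(1 / 2) ^ k0 < 1 / (32 * (b + 1))"
    using real_arch_pow_inv[of "1 / (32 * (b + 1))" "1 / 2"] b by auto
  have small: "b * (4 * (1 / 2) ^ k0) \<le> 1 / 8"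
  proof -
    have "b * (4 * (1 / 2) ^ k0) \<le> (b + 1) * (4 * (1 / (32 * (b + 1))))"
      using k0 b by (intro mult_mono) auto
    also have "\<dots> = 1 / 8" using b by (simp add: field_simps)
    finally show ?thesis .
  qed
  define U where "U = color_cut k0 c u"
  \<comment> \<open>Subtracting the last stage leaves a function that vanishes from depth
    \<open>4 * (1 / 2) ^ k0\<close> on. \<open>v m\<close> is zero, and \<open>v 0\<close> equals
    \<open>u\<close> near the boundary.\<close>
  define v where "v i x = U i x - U m x" for i x
  have "\<exists>E. lip_deriv b (v i) E \<and> (\<forall>x h. norm (E x h) \<le> 1 / 8 * norm h)" if "i \<le> m" for i
  proof -
    obtain Di where Di: "flat_on cube_exterior (cut_factor ^ i * a) (U i) Di"
      using flat_on_color_cut[OF u a] unfolding U_def by blast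
    obtain Dm where Dm: "flat_on cube_exterior (cut_factor ^ m * a) (U m) Dm"
      using flat_on_color_cut[OF u a] unfolding U_def by blast
    let ?E = "\<lambda>x h. Di x h - Dm x h" and ?b = "cut_factor ^ i * a + cut_factor ^ m * a"
    have fl: "flat_on cube_exterior ?b (v i) ?E"
      using flat_on_diff[OF Di Dm] unfolding v_def .
    have "cut_factor ^ i * a \<le> cut_factor ^ m * a"
      using that a cut_factor_ge_1 by (intro mult_right_mono power_increasing) auto
    then have le: "?b \<le> b" unfolding b_def by linarith
    have pos: "0 \<le> ?b" using a cut_factor_ge_1 by (intro add_nonneg_nonneg mult_nonneg_nonneg) auto
    have "norm (?E x h) \<le> 1 / 8 * norm h" for x h
    proof -
      have "norm (?E x h) \<le> ?b * (4 * (1 / 2) ^ k0) * norm h"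
      proof (rule lip_deriv_small[OF fl closed_cube_exterior cube_exterior_nonempty pos])
        show "0 \<le> 4 * (1 / 2 :: real) ^ k0" by simp
        fix x :: "real^'n" assume "4 * (1 / 2) ^ k0 < infdist x cube_exterior"
        then have "4 * (1 / 2) ^ k0 \<le> depth x" unfolding depth_def by simp
        then show "v i x = 0" unfolding v_def U_def by (simp add: color_cut_deep)
      qed
      also have "\<dots> \<le> b * (4 * (1 / 2) ^ k0) * norm h" using le by (intro mult_right_mono) auto
      also have "\<dots> \<le> 1 / 8 * norm h" using small by (intro mult_right_mono) auto
      finally show ?thesis .
    qed
    moreover have "lip_deriv b (v i) ?E"
    proof -
      have "norm (?E x h - ?E y h) \<le> b * norm (x - y) * norm h" for x y h
      proof -
        have "norm (?E x h - ?E y h) \<le> ?b * norm (x - y) * norm h"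
          using fl unfolding flat_on_def lip_deriv_def by blast
        also have "\<dots> \<le> b * norm (x - y) * norm h" using le by (intro mult_right_mono) auto
        finally show ?thesis .
      qed
      then show ?thesis using fl unfolding flat_on_def lip_deriv_def by blast
    qed
    ultimately show ?thesis by (intro exI[of _ ?E] conjI allI)
  qed
  then obtain E where E: "\<And>i. i \<le> m \<Longrightarrow> lip_deriv b (v i) (E i)"
    "\<And>i x h. i \<le> m \<Longrightarrow> norm (E i x h) \<le> 1 / 8 * norm h" by metis
  have vl: "norm (v i x - v i y) \<le> 1 / 8 * norm (x - y)" if "i \<le> m" for i x y
    using E(1)[OF that] by (intro lipschitz_of_derivative_bound[OF convex_UNIV _ E(2)[OF that]]) (auto simp: lip_deriv_def)
  have "\<exists>g. (\<forall>x. g x + v i (g x) = x) \<and> (\<forall>x. g (x + v i x) = x) \<and> (\<forall>x y. norm (g x - g y) \<le> 8 / 7 * norm (x - y))"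
    if "i \<le> m" for i
    by (rule near_id_inverse[OF vl[OF that]]) blast
  then obtain g where g: "\<And>i x. i \<le> m \<Longrightarrow> g i x + v i (g i x) = x" "\<And>i x. i \<le> m \<Longrightarrow> g i (x + v i x) = x"
    "\<And>i x y. i \<le> m \<Longrightarrow> norm (g i x - g i y) \<le> 8 / 7 * norm (x - y)" by metis
  define \<Phi> where "\<Phi> i x = x + v i x" for i x
  have \<Phi>_lip: "norm (\<Phi> i x - \<Phi> i y) \<le> 9 / 8 * norm (x - y)" if "i \<le> m" for i x y
  proof -
    have "\<Phi> i x - \<Phi> i y = (x - y) + (v i x - v i y)" by (simp add: \<Phi>_def)
    then have "norm (\<Phi> i x - \<Phi> i y) \<le> norm (x - y) + norm (v i x - v i y)" by (metis norm_triangle_ineq)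
    then show ?thesis using vl[OF that, of x y] by linarith
  qed
  have step: "flowable 2 (g (Suc i) \<circ> \<Phi> i)" if i: "Suc i \<le> m" for i
  proof -
    let ?\<psi> = "g (Suc i) \<circ> \<Phi> i" and ?\<chi> = "g i \<circ> \<Phi> (Suc i)"
    have i': "i \<le> m" using i by simp
    have comp_lip: "norm ((g k \<circ> \<Phi> l) x - (g k \<circ> \<Phi> l) y) \<le> 9 / 7 * norm (x - y)" if "k \<le> m" "l \<le> m" for k l x y
      using g(3)[OF that(1), of "\<Phi> l x" "\<Phi> l y"] \<Phi>_lip[OF that(2), of x y] by simp
    obtain Dg where Dg: "lip_deriv (8 * b) (g (Suc i)) Dg" "\<And>x h. norm (Dg x h) \<le> 2 * norm h"
      using lip_deriv_near_id_inverse[OF E(1)[OF i] b E(2)[OF i] g(1)[OF i] g(3)[OF i]] by blast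
    have D\<Phi>: "lip_deriv b (\<Phi> i) (\<lambda>x h. h + E i x h)" unfolding \<Phi>_def by (rule lip_deriv_add_id[OF E(1)[OF i']])
    have D\<Phi>b: "norm (h + E i x h) \<le> 2 * norm h" for x h
      using norm_triangle_ineq[of h "E i x h"] E(2)[OF i', of x h] norm_ge_zero[of h] by linarith
    have ld: "lip_deriv (8 * b * 2 * 2 + 2 * b) ?\<psi> (\<lambda>x h. Dg (\<Phi> i x) (h + E i x h))"
      by (rule lip_deriv_compose[OF Dg D\<Phi> D\<Phi>b]) (use b in auto)
    \<comment> \<open>2/7 = 1/8 + 1/8 * 9/7, because
      \<open>?\<psi> x - x = v i x - v (Suc i) (?\<psi> x)\<close> and \<open>?\<psi>\<close> has
      Lipschitz constant 8/7 * 9/8 = 9/7.\<close>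
    have ineq: "norm ((?\<psi> x - x) - (?\<psi> y - y)) \<le> 2 / 7 * norm (x - y)" for x y
    proof -
      have e: "?\<psi> x - x = v i x - v (Suc i) (?\<psi> x)" for x
        using g(1)[OF i, of "\<Phi> i x"] by (simp add: \<Phi>_def algebra_simps)
      have "(?\<psi> x - x) - (?\<psi> y - y) = (v i x - v i y) - (v (Suc i) (?\<psi> x) - v (Suc i) (?\<psi> y))"
        unfolding e by (simp add: algebra_simps)
      then have "norm ((?\<psi> x - x) - (?\<psi> y - y)) \<le> norm (v i x - v i y) + norm (v (Suc i) (?\<psi> x) - v (Suc i) (?\<psi> y))"
        by (metis norm_triangle_ineq4)
      then show ?thesis
        using vl[OF i', of x y] vl[OF i, of "?\<psi> x" "?\<psi> y"] comp_lip[OF i i', of x y] by linarith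
    qed
    have moved: "\<exists>j\<in>cells k0 (c i). x \<in> ball (center j) (radius j)" if "?\<psi> x \<noteq> x" for x
    proof (rule ccontr)
      assume "\<not> ?thesis"
      then have "U (Suc i) x = U i x" unfolding U_def color_cut.simps by (intro bump_cut_outside radius_pos) blast
      then have "\<Phi> i x = \<Phi> (Suc i) x" by (simp add: \<Phi>_def v_def)
      then have "?\<psi> x = x" using g(2)[OF i, of x] by (simp add: \<Phi>_def)
      then show False using that by simp
    qed
    have dis: "disjoint_family_on (\<lambda>j. ball (pole j) (16 * radius j)) (cells k0 (c i))"
    proof -
      have "ball (pole j) (16 * radius j) \<subseteq> ball (center j) (22 * radius j)" for j :: "'n cell"
        using pole_ball[of j] ball_subset_cball by blast
      then show ?thesis using cells_disjoint[of k0 "c i"] unfolding disjoint_family_on_def by blast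
    qed
    show ?thesis
    proof (rule flowable_annular[OF dis, where g = ?\<chi> and a = "8 * b * 2 * 2 + 2 * b" and M = "9 / 7"])
      fix j assume j: "j \<in> cells k0 (c i)"
      show "0 < 16 * radius j" using radius_pos[of j] by simp
      show "16 * radius j \<le> 1" using radius_le[of j] by linarith
      show "ball (pole j) (16 * radius j) \<subseteq> unit_cube"
        using pole_ball[of j] ball_subset_cball cell_ball_in_cube[OF j] by blast
      fix x assume x: "x \<in> ball (pole j) (16 * radius j)"
      show "?\<psi> x \<in> ball (pole j) (16 * radius j)"
      proof (rule preserves_ball[OF ineq _ _ _ _ x])
        fix z assume z: "z \<in> sphere (pole j) (16 * radius j)"
        \<comment> \<open>A moved point of the sphere would lie in a cell of this color. It is in
          the enlarged ball of \<open>j\<close>, so that cell is \<open>j\<close>, whose points are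
          within 7 radii of the pole and not at 16.\<close>
        show "?\<psi> z = z"
        proof (rule ccontr)
          assume "?\<psi> z \<noteq> z"
          then obtain l where l: "l \<in> cells k0 (c i)" "z \<in> ball (center l) (radius l)" using moved by blast
          have "z \<in> cball (pole j) (16 * radius j)" using z by simp
          then have "z \<in> ball (center j) (22 * radius j)" using pole_ball[of j] by blast
          moreover have "ball (center l) (radius l) \<subseteq> ball (center l) (22 * radius l)"
            using radius_pos[of l] by (intro subset_ball) simp
          then have "z \<in> ball (center l) (22 * radius l)" using l(2) by (rule subsetD)
          ultimately have "l = j" using cells_disjoint[of k0 "c i"] l(1) j unfolding disjoint_family_on_def by blast
          then have "norm (z - pole j) < 7 / 16 * (16 * radius j)" using pole_annulus(2)[OF l(2)] by simp
          then show False using z radius_pos[of j] by (simp add: dist_norm norm_minus_commute)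
        qed
      qed (use radius_pos[of j] in auto)
    next
      show "lip_deriv (8 * b * 2 * 2 + 2 * b) ?\<psi> (\<lambda>x h. Dg (\<Phi> i x) (h + E i x h))" by (rule ld)
      show "?\<psi> (?\<chi> x) = x" for x using g(1)[OF i'] g(2)[OF i] by (simp add: \<Phi>_def)
      show "?\<chi> (?\<psi> x) = x" for x using g(1)[OF i] g(2)[OF i'] by (simp add: \<Phi>_def)
      show "norm (?\<chi> x - ?\<chi> y) \<le> 9 / 7 * norm (x - y)" for x y by (rule comp_lip[OF i' i])
      fix x assume "?\<psi> x \<noteq> x"
      then obtain j where "j \<in> cells k0 (c i)" "x \<in> ball (center j) (radius j)" using moved by blast
      then show "\<exists>j\<in>cells k0 (c i). 16 * radius j / 4 < norm (x - pole j) \<and> norm (x - pole j) < 7 / 16 * (16 * radius j)"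
        using pole_annulus by blast
    qed (use b in auto)
  qed
  \<comment> \<open>Downward induction from \<open>\<Phi> m = id\<close>, with two flows per
    color.\<close>
  have "flowable (2 * n) (\<Phi> (m - n))" if "n \<le> m" for n
    using that
  proof (induction n)
    case 0
    have "\<Phi> m = id" by (simp add: \<Phi>_def v_def fun_eq_iff)
    then show ?case using flowable_0_id by (simp only: mult_0_right diff_zero)
  next
    case (Suc n)
    let ?i = "m - Suc n"
    have i: "Suc ?i \<le> m" "Suc ?i = m - n" using Suc(2) by auto
    have "flowable (2 + 2 * n) (\<Phi> (Suc ?i) \<circ> (g (Suc ?i) \<circ> \<Phi> ?i))"
      using flowable_comp[OF step[OF i(1)]] Suc i(2) by simp
    moreover have "\<Phi> (Suc ?i) \<circ> (g (Suc ?i) \<circ> \<Phi> ?i) = \<Phi> ?i"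
      using g(1)[OF i(1)] by (auto simp: \<Phi>_def[of "Suc ?i"])
    ultimately show ?case by simp
  qed
  from this[of m] have fl: "flowable (2 * m) (\<lambda>x. x + v 0 x)" by (simp add: \<Phi>_def[abs_def])
  have uo: "u x = 0" if "x \<in> cube_exterior" for x using u that unfolding flat_on_def by blast
  have "v 0 x = u x" if "depth x < (1 / 2) ^ k0" for x
    using color_cut_shallow[OF uo c that] by (simp add: v_def U_def)
  moreover have "v 0 x = 0" if "x \<in> cube_exterior" for x
  proof -
    have "U m x = 0" unfolding U_def by (rule color_cut_zero_mono[of _ _ _ 0]) (use uo[OF that] in auto)
    then show ?thesis using uo[OF that] by (simp add: v_def U_def)
  qed
  ultimately show ?thesis using fl E[of 0] b
    by (intro exI[of _ "v 0"] exI[of _ "E 0"] exI[of _ b] exI[of _ "(1 / 2) ^ k0"]) auto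
qed

section \<open>The compactly supported part\<close>

lemma frontier_zero:
  fixes f :: "'a::real_normed_vector \<Rightarrow> 'b::real_normed_vector"
  assumes "continuous_on UNIV f" "\<And>x. x \<notin> S \<Longrightarrow> f x = 0" "x \<in> closure (- S)"
  shows "f x = 0"
proof -
  have "closed {x. f x = 0}" using assms(1) by (intro closed_Collect_eq continuous_intros)
  then have "closure (- S) \<subseteq> {x. f x = 0}" using assms(2) by (intro closure_minimal) auto
  then show ?thesis using assms(3) by blast
qed

text \<open>\<open>Ck\<close> controls derivatives in one fixed direction at a time; summing over
  the basis makes such bounds uniform in the direction.\<close>

lemma norm_linear_basis_bound:
  fixes T :: "'a::euclidean_space \<Rightarrow> 'b::real_normed_vector"
  assumes "linear T" "\<And>b. b \<in> Basis \<Longrightarrow> norm (T b) \<le> B b"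
  shows "norm (T h) \<le> (\<Sum>b\<in>Basis. B b) * norm h"
proof -
  have "T h = T (\<Sum>b\<in>Basis. (h \<bullet> b) *\<^sub>R b)" by (simp add: euclidean_representation)
  also have "\<dots> = (\<Sum>b\<in>Basis. (h \<bullet> b) *\<^sub>R T b)"
    by (simp add: linear_sum[OF assms(1)] linear_cmul[OF assms(1)])
  also have "norm \<dots> \<le> (\<Sum>b\<in>Basis. B b * norm h)"
  proof (rule order_trans[OF norm_sum sum_mono])
    fix b :: 'a assume b: "b \<in> Basis"
    have "\<bar>h \<bullet> b\<bar> * norm (T b) \<le> norm h * B b"
      using Basis_le_norm[OF b] assms(2)[OF b] by (intro mult_mono) auto
    then show "norm ((h \<bullet> b) *\<^sub>R T b) \<le> B b * norm h" by (simp add: mult.commute)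
  qed
  finally show ?thesis by (simp add: sum_distrib_right)
qed

lemma compactly_supported_C1_lipschitz:
  fixes f :: "real^'n \<Rightarrow> real^'n"
  assumes d: "\<And>x. (f has_derivative D x) (at x)" and cont: "\<And>h. continuous_on UNIV (\<lambda>x. D x h)"
    and out: "\<And>x. x \<notin> unit_cube \<Longrightarrow> f x = 0"
  shows "\<exists>L\<ge>0. \<forall>x y. norm (f x - f y) \<le> L * norm (x - y)"
proof -
  have "\<exists>B. \<forall>x\<in>unit_cube. norm (D x h) \<le> B" for h
  proof -
    have "compact ((\<lambda>x. D x h) ` unit_cube)"
      unfolding unit_cube_def
      by (intro compact_continuous_image compact_cbox continuous_on_subset[OF cont]) simp
    then have "bounded ((\<lambda>x. D x h) ` unit_cube)" by (rule compact_imp_bounded)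
    then show ?thesis unfolding bounded_iff ball_simps(9) .
  qed
  then obtain B where B: "\<And>h x. x \<in> unit_cube \<Longrightarrow> norm (D x h) \<le> B h" by metis
  define L where "L = (\<Sum>b\<in>Basis. B b)"
  have 0: "(0 :: real^'n) \<in> unit_cube" by (simp add: unit_cube_def mem_box)
  have L: "0 \<le> L" unfolding L_def by (intro sum_nonneg order_trans[OF norm_ge_zero B[OF 0]])
  have cf: "continuous_on UNIV f" by (intro continuous_at_imp_continuous_on ballI has_derivative_continuous[OF d])
  have "norm (f x - f y) \<le> L * norm (x - y)" for x y
  proof (rule lipschitz_zero_extension[where S = unit_cube])
    show "closed (unit_cube :: (real^'n) set)" by (simp add: unit_cube_def closed_cbox)
    fix x y :: "real^'n" assume xy: "x \<in> unit_cube" "y \<in> unit_cube"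
    show "norm (f x - f y) \<le> L * norm (x - y)"
    proof (rule lipschitz_of_derivative_bound[OF _ d _ xy])
      show "convex (unit_cube :: (real^'n) set)" by (simp add: unit_cube_def convex_box)
      show "norm (D z h) \<le> L * norm h" if "z \<in> unit_cube" for z h
        unfolding L_def by (rule norm_linear_basis_bound[OF has_derivative_linear[OF d] B[OF that]])
    qed
  next
    fix x :: "real^'n" assume "x \<in> frontier unit_cube"
    then show "f x = 0" using frontier_zero[OF cf out] by (simp add: frontier_closures)
  qed (use L out in auto)
  then show ?thesis using L by blast
qed

lemma cube_exterior_eq_closure: "cube_exterior = closure (- unit_cube)"
  unfolding cube_exterior_def unit_cube_def closure_complement interior_cbox ..

lemma Ck_1_D:
  assumes "Ck (Suc 0) f"
  shows "(f has_derivative frechet_derivative f (at x)) (at x)"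
    "continuous_on UNIV (\<lambda>x. frechet_derivative f (at x) h)"
  using assms by (simp_all add: frechet_derivative_works)

text \<open>For fixed \<open>h\<close> the map \<open>D x h\<close> is C^1 in \<open>x\<close> and
  zero off the cube, hence Lipschitz; the basis makes this uniform in \<open>h\<close>. Vanishing
  reaches the faces of the cube by continuity.\<close>

lemma smooth_minus_id_flat:
  fixes \<phi> :: "real^'n \<Rightarrow> real^'n"
  assumes sm: "Ck (Suc (Suc 0)) \<phi>" and out: "\<And>x. x \<notin> unit_cube \<Longrightarrow> \<phi> x = x"
  obtains a D where "0 \<le> a" "flat_on cube_exterior a (\<lambda>x. \<phi> x - x) D"
proof -
  define D where "D x h = frechet_derivative \<phi> (at x) h - h" for x h
  have \<phi>d: "(\<phi> has_derivative frechet_derivative \<phi> (at x)) (at x)" for x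
    using sm by (simp add: frechet_derivative_works)
  have ud: "((\<lambda>x. \<phi> x - x) has_derivative D x) (at x)" for x
    unfolding D_def[abs_def] by (intro has_derivative_diff \<phi>d has_derivative_ident)
  have Dout: "D x h = 0" if "x \<notin> unit_cube" for x h
  proof -
    have "open (- (unit_cube :: (real^'n) set))" by (simp add: unit_cube_def open_Compl closed_cbox)
    then have "((\<lambda>x. 0) has_derivative D x) (at x)"
      using has_derivative_transform_within_open[OF ud, of "- unit_cube" x "\<lambda>x. 0"] that out by auto
    then show ?thesis using has_derivative_unique has_derivative_const by (metis (full_types))
  qed
  have "\<exists>L. 0 \<le> L \<and> (\<forall>x y. norm (D x h - D y h) \<le> L * norm (x - y))" for h
  proof -
    let ?f = "\<lambda>x. frechet_derivative \<phi> (at x) h"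
    have c1: "Ck (Suc 0) ?f" using sm by simp
    have "((\<lambda>x. D x h) has_derivative frechet_derivative ?f (at x)) (at x)" for x
      using has_derivative_diff[OF Ck_1_D(1)[OF c1] has_derivative_const[of h]] unfolding D_def by simp
    from compactly_supported_C1_lipschitz[OF this Ck_1_D(2)[OF c1] Dout] show ?thesis by blast
  qed
  then obtain L where L: "\<And>h. 0 \<le> L h" "\<And>h x y. norm (D x h - D y h) \<le> L h * norm (x - y)" by metis
  define a where "a = (\<Sum>b\<in>Basis. L b)"
  have a: "0 \<le> a" unfolding a_def using L(1) by (intro sum_nonneg)
  have "norm (D x h - D y h) \<le> a * norm (x - y) * norm h" for x y h
  proof -
    have "linear (\<lambda>h. D x h - D y h)"
      using has_derivative_linear[OF ud] by (intro linear_compose_sub)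
    then have "norm (D x h - D y h) \<le> (\<Sum>b\<in>Basis. L b * norm (x - y)) * norm h"
      by (rule norm_linear_basis_bound) (rule L(2))
    then show ?thesis by (simp add: a_def sum_distrib_right)
  qed
  then have ld: "lip_deriv a (\<lambda>x. \<phi> x - x) D" using ud unfolding lip_deriv_def by blast
  have "\<phi> x - x = 0" "D x h = 0" if "x \<in> cube_exterior" for x h
  proof -
    have x: "x \<in> closure (- unit_cube)" using that cube_exterior_eq_closure by blast
    have "continuous_on UNIV (\<lambda>x. \<phi> x - x)"
      by (intro continuous_at_imp_continuous_on ballI has_derivative_continuous[OF ud])
    then show "\<phi> x - x = 0" by (rule frontier_zero[OF _ _ x]) (simp add: out)
    have "(L h)-lipschitz_on UNIV (\<lambda>x. D x h)" using L by (intro lipschitz_onI) (auto simp: dist_norm)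
    then have "continuous_on UNIV (\<lambda>x. D x h)" by (rule lipschitz_on_continuous_on)
    then show "D x h = 0" by (rule frontier_zero[OF _ Dout x])
  qed
  then show thesis using that a ld unfolding flat_on_def by blast
qed

section \<open>The cube as the unit ball of a gauge\<close>

lemma infnorm_le_iff: "infnorm x \<le> c \<longleftrightarrow> (\<forall>b\<in>Basis. \<bar>x \<bullet> b\<bar> \<le> c)"
  by (simp add: infnorm_Max)

lemma One_inner_Basis: "b \<in> Basis \<Longrightarrow> (One :: 'a::euclidean_space) \<bullet> b = 1"
  by simp

definition midpoint_cube :: "real^'n" where "midpoint_cube = (1 / 2) *\<^sub>R One"

lemma midpoint_inner: "b \<in> Basis \<Longrightarrow> (x - midpoint_cube) \<bullet> b = x \<bullet> b - 1 / 2"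
  unfolding midpoint_cube_def inner_diff_left inner_scaleR_left by (simp only: One_inner_Basis mult_1_right)

lemma unit_cube_infnorm:
  fixes x :: "real^'n"
  shows "x \<in> unit_cube \<longleftrightarrow> 2 * infnorm (x - midpoint_cube) \<le> 1"
proof -
  have "2 * infnorm (x - midpoint_cube) \<le> 1 \<longleftrightarrow> infnorm (x - midpoint_cube) \<le> 1 / 2" by linarith
  also have "\<dots> \<longleftrightarrow> (\<forall>b\<in>Basis. 0 \<le> x \<bullet> b \<and> x \<bullet> b \<le> 1)"
    unfolding infnorm_le_iff by (intro ball_cong refl) (simp only: midpoint_inner, linarith)
  finally show ?thesis unfolding unit_cube_def mem_box by (simp add: One_inner_Basis)
qed

text \<open>Moving \<open>x\<close> along an axis to a face reaches the exterior, so the depth is at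
  most the distance of each coordinate to 0 and to 1.\<close>

lemma depth_imp_infnorm:
  fixes x :: "real^'n"
  assumes "0 < \<epsilon>" "\<epsilon> \<le> depth x"
  shows "2 * infnorm (x - midpoint_cube) \<le> 1 - \<epsilon>"
proof -
  have "\<bar>(x - midpoint_cube) \<bullet> b\<bar> \<le> (1 - \<epsilon>) / 2" if b: "b \<in> Basis" for b
  proof -
    have near: "depth x \<le> \<bar>t\<bar>" if "x \<bullet> b + t \<le> 0 \<or> 1 \<le> x \<bullet> b + t" for t
    proof -
      have "(x + t *\<^sub>R b) \<bullet> b = x \<bullet> b + t" using b by (simp add: inner_add_left)
      then have "x + t *\<^sub>R b \<in> cube_exterior"
        using that b unfolding cube_exterior_def by (force simp: mem_box One_inner_Basis)
      then have "depth x \<le> dist x (x + t *\<^sub>R b)" unfolding depth_def by (rule infdist_le)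
      then show ?thesis using b by (simp add: dist_norm)
    qed
    have "depth x \<le> \<bar>- (x \<bullet> b)\<bar>" "depth x \<le> \<bar>1 - x \<bullet> b\<bar>" by (rule near, simp)+
    moreover have "0 \<le> x \<bullet> b" "x \<bullet> b \<le> 1" using near[of 0] assms by (force, force)
    ultimately have "\<epsilon> \<le> x \<bullet> b" "\<epsilon> \<le> 1 - x \<bullet> b" using assms(2) by simp_all
    moreover from this have "x \<bullet> b - 1 / 2 \<le> (1 - \<epsilon>) / 2" "- (x \<bullet> b - 1 / 2) \<le> (1 - \<epsilon>) / 2"
      using assms(1) by (simp_all add: field_simps)
    ultimately show ?thesis unfolding midpoint_inner[OF b] by (intro abs_leI)
  qed
  then have "infnorm (x - midpoint_cube) \<le> (1 - \<epsilon>) / 2" unfolding infnorm_le_iff by blast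
  then show ?thesis by simp
qed

lemma radial_gauge_infnorm:
  assumes "0 < \<eta>" "\<eta> < 1"
  shows "radial_gauge (\<lambda>x::real^'n. 2 * infnorm x) \<eta> 2 (sqrt DIM(real^'n))"
proof
  fix x y :: "real^'n" and c :: real
  show "0 \<le> 2 * infnorm x" by (simp add: infnorm_pos_le)
  show "0 \<le> c \<Longrightarrow> 2 * infnorm (c *\<^sub>R x) = c * (2 * infnorm x)" by (simp add: infnorm_mul)
  have "\<bar>infnorm x - infnorm y\<bar> \<le> norm (x - y)"
    using absdiff_infnorm[of x y] infnorm_le_norm[of "x - y"] by linarith
  then show "\<bar>2 * infnorm x - 2 * infnorm y\<bar> \<le> 2 * norm (x - y)" by linarith
  have "sqrt DIM(real^'n) * infnorm x \<le> sqrt DIM(real^'n) * (2 * infnorm x)"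
    by (intro mult_left_mono) (simp_all add: infnorm_pos_le)
  then show "norm x \<le> sqrt DIM(real^'n) * (2 * infnorm x)" using norm_le_infnorm[of x] by linarith
qed (use assms in simp_all)

text \<open>The center of contraction is again put beside the support. The large ball is preserved
  whatever the size of the displacement: a moved point is sent to a moved point, which lies in the
  support.\<close>

lemma flowable_small_ball:
  fixes \<psi> g :: "real^'n \<Rightarrow> real^'n"
  assumes \<rho>: "0 < \<rho>" "16 * \<rho> \<le> 1" and cube: "ball q (22 * \<rho>) \<subseteq> unit_cube"
    and ld: "lip_deriv a \<psi> D" and a: "0 \<le> a"
    and psi_g: "\<And>x. \<psi> (g x) = x" and g_psi: "\<And>x. g (\<psi> x) = x"
    and lipg: "\<And>x y. norm (g x - g y) \<le> M * norm (x - y)" and M: "0 \<le> M"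
    and supp: "\<And>x. \<psi> x \<noteq> x \<Longrightarrow> x \<in> ball q \<rho>"
  shows "flowable 2 \<psi>"
proof -
  define p where "p = q + (11 / 2 * \<rho>) *\<^sub>R axis undefined 1"
  have d: "dist q p = 11 / 2 * \<rho>" using \<rho> by (simp add: p_def dist_norm)
  note ann = shifted_annulus[OF \<rho>(1) d]
  have sub: "ball p (16 * \<rho>) \<subseteq> unit_cube"
    using shifted_ball[OF \<rho>(1) d] ball_subset_cball cube by blast
  show ?thesis
  proof (rule flowable_annular[where J = "{()}" and p = "\<lambda>_. p" and R = "\<lambda>_. 16 * \<rho>", OF _ _ _ _ ld a psi_g g_psi lipg M])
    show "disjoint_family_on (\<lambda>_. ball p (16 * \<rho>)) {()}" by (simp add: disjoint_family_on_def)
    show "ball p (16 * \<rho>) \<subseteq> unit_cube" by (rule sub)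
    fix x
    show "\<psi> x \<noteq> x \<Longrightarrow> \<exists>j\<in>{()}. 16 * \<rho> / 4 < norm (x - p) \<and> norm (x - p) < 7 / 16 * (16 * \<rho>)"
      using ann[OF supp] by blast
    assume x: "x \<in> ball p (16 * \<rho>)"
    show "\<psi> x \<in> ball p (16 * \<rho>)"
    proof (cases "\<psi> x = x")
      case False
      then have "\<psi> (\<psi> x) \<noteq> \<psi> x" using g_psi by metis
      then have "norm (\<psi> x - p) < 7 / 16 * (16 * \<rho>)" by (intro ann(2) supp)
      then show ?thesis using \<rho> by (simp add: dist_norm norm_minus_commute)
    qed (use x in simp)
  qed (use \<rho> in simp_all)
qed

text \<open>A contraction that is linear on the support of \<open>\<omega>\<close> conjugates \<open>\<omega>\<close> to a rescaled copy of itself in a small ball.\<close>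
lemma flowable_compact_support:
  fixes \<omega> g :: "real^'n \<Rightarrow> real^'n"
  assumes ld: "lip_deriv a \<omega> D" and a: "0 \<le> a"
    and chi_g: "\<And>x. \<omega> (g x) = x" and g_chi: "\<And>x. g (\<omega> x) = x"
    and lipg: "\<And>x y. norm (g x - g y) \<le> M * norm (x - y)" and M: "0 \<le> M"
    and \<epsilon>: "0 < \<epsilon>" and supp: "\<And>x. \<omega> x \<noteq> x \<Longrightarrow> \<epsilon> \<le> depth x"
  shows "flowable 4 \<omega>"
proof -
  let ?c = "midpoint_cube :: real^'n" and ?N = "\<lambda>x::real^'n. 2 * infnorm x"
  \<comment> \<open>At most \<epsilon>, so that the linear region contains all moved points, and
    below 1 as the gauge requires.\<close>
  define \<eta> where "\<eta> = min \<epsilon> (1 / 2)"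
  have \<eta>: "0 < \<eta>" "\<eta> < 1" using \<epsilon> by (simp_all add: \<eta>_def)
  define K where "K = sqrt DIM(real^'n)"
  have K: "0 \<le> K" by (simp add: K_def)
  interpret radial_gauge ?N \<eta> 2 K unfolding K_def by (rule radial_gauge_infnorm[OF \<eta>])
  \<comment> \<open>Moved points have distance at most \<open>K\<close> from the midpoint. Since
    \<open>1 + s \<le> exp s\<close>, contracting for time \<open>s\<close> brings them within 1/128
    of it.\<close>
  define s where "s = 128 * K + 1"
  have s: "0 \<le> s" using K by (simp add: s_def)
  have sK: "exp (- s) * K < 1 / 128"
  proof -
    have "1 + s \<le> exp s" by (rule exp_ge_add_one_self)
    then have "128 * K < exp s" by (simp add: s_def)
    then show ?thesis by (simp add: exp_minus field_simps)
  qed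
  define h where "h t x = ?c + contraction_flow t (x - ?c)" for t x
  have h_add: "h t (h t' x) = h (t + t') x" for t t' x by (simp add: h_def contraction_flow_add)
  have h_0: "h 0 x = x" for x by (simp add: h_def contraction_flow_at_0)
  have h_flow: "flowable 1 (h t)" for t
  proof (rule flowable_time_1)
    fix x y
    have "norm (t *\<^sub>R contraction (x - ?c) - t *\<^sub>R contraction (y - ?c)) = \<bar>t\<bar> * norm (contraction (x - ?c) - contraction (y - ?c))"
      by (simp flip: scaleR_diff_right)
    also have "\<dots> \<le> \<bar>t\<bar> * ((1 + 2 * K / \<eta>) * norm (x - y))"
      using contraction_lipschitz[of "x - ?c" "y - ?c"] by (intro mult_left_mono) auto
    finally show "norm (t *\<^sub>R contraction (x - ?c) - t *\<^sub>R contraction (y - ?c)) \<le> (\<bar>t\<bar> * (1 + 2 * K / \<eta>)) * norm (x - y)"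
      by (simp only: mult.assoc)
    show "0 \<le> \<bar>t\<bar> * (1 + 2 * K / \<eta>)" using K \<eta> by simp
    show "\<exists>\<gamma>. trajectory (\<lambda>x. t *\<^sub>R contraction (x - ?c)) \<gamma> \<and> \<gamma> 0 = x \<and> \<gamma> 1 = h t x"
    proof (intro exI conjI)
      show "trajectory (\<lambda>x. t *\<^sub>R contraction (x - ?c)) (\<lambda>r. ?c + contraction_flow (t * r) (x - ?c))"
        using trajectory_affine[OF trajectory_rescale[OF contraction_trajectory, of t "x - ?c"], of 1 ?c] by simp
    qed (simp_all add: h_def contraction_flow_at_0)
  next
    fix x :: "real^'n" assume "x \<notin> unit_cube"
    then have "1 \<le> ?N (x - ?c)" unfolding unit_cube_infnorm by simp
    then show "t *\<^sub>R contraction (x - ?c) = 0" by (simp only: contraction_outside scaleR_zero_right)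
  qed
  define A where "A x = ?c + exp (- s) *\<^sub>R (x - ?c)" for x
  define A' where "A' x = ?c + exp s *\<^sub>R (x - ?c)" for x
  have es: "exp (- s) * exp s = 1" "exp s * exp (- s) = 1" by (simp_all flip: exp_add)
  have AA': "A (A' x) = x" and A'A: "A' (A x) = x" for x by (simp_all add: A_def A'_def es)
  have dA: "A x - A y = exp (- s) *\<^sub>R (x - y)" and dA': "A' x - A' y = exp s *\<^sub>R (x - y)" for x y
    by (simp_all add: A_def A'_def algebra_simps)
  have moved: "?N (x - ?c) \<le> 1 - \<eta>" if "\<omega> x \<noteq> x" for x
    using depth_imp_infnorm[OF \<epsilon> supp[OF that]] by (simp add: \<eta>_def)
  have h_A: "h s x = A x" if "?N (x - ?c) \<le> 1 - \<eta>" for x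
    using contraction_flow_linear[OF that s] by (simp add: h_def A_def)
  have h_inv: "h (- s) (h s x) = x" for x by (simp add: h_add h_0)
  let ?\<psi> = "A \<circ> \<omega> \<circ> A'" and ?g = "A \<circ> g \<circ> A'"
  have "flowable 2 ?\<psi>"
  proof (rule flowable_small_ball[where q = ?c and \<rho> = "1 / 128" and g = ?g])
    show "ball ?c (22 * (1 / 128)) \<subseteq> unit_cube"
    proof
      fix x assume "x \<in> ball ?c (22 * (1 / 128))"
      then have "norm (x - ?c) \<le> 1 / 2" by (simp add: dist_norm norm_minus_commute)
      then show "x \<in> unit_cube" unfolding unit_cube_infnorm using infnorm_le_norm[of "x - ?c"] by linarith
    qed
    \<comment> \<open>Rescaling enlarges this constant by \<open>exp s\<close>, which affects the
      Lipschitz constants of the fields and not their number.\<close>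
    show "lip_deriv (a * exp s) ?\<psi> (\<lambda>x. D (A' x))" unfolding lip_deriv_def
    proof (intro conjI allI)
      fix x y k
      have cd: "(\<omega> has_derivative D z) (at z)" for z using ld unfolding lip_deriv_def by blast
      have 1: "(A' has_derivative (\<lambda>k. exp s *\<^sub>R k)) (at x)"
        unfolding A'_def[abs_def] by (auto intro!: derivative_eq_intros)
      have 2: "(A has_derivative (\<lambda>k. exp (- s) *\<^sub>R k)) F" for F
        unfolding A_def[abs_def] by (auto intro!: derivative_eq_intros)
      have "((\<lambda>x. A (\<omega> (A' x))) has_derivative (\<lambda>k. exp (- s) *\<^sub>R D (A' x) (exp s *\<^sub>R k))) (at x)"
        using has_derivative_compose[OF has_derivative_compose[OF 1 cd] 2] .
      moreover have "(\<lambda>k. exp (- s) *\<^sub>R D (A' x) (exp s *\<^sub>R k)) = D (A' x)"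
        using linear_cmul[OF has_derivative_linear[OF cd]] by (auto simp: es)
      ultimately show "(?\<psi> has_derivative D (A' x)) (at x)" by (simp add: o_def)
      have "norm (D (A' x) k - D (A' y) k) \<le> a * norm (A' x - A' y) * norm k"
        using ld unfolding lip_deriv_def by blast
      then show "norm (D (A' x) k - D (A' y) k) \<le> a * exp s * norm (x - y) * norm k"
        unfolding dA' by (simp add: mult.assoc)
    qed
    show "norm (?g x - ?g y) \<le> M * norm (x - y)" for x y
    proof -
      have "norm (?g x - ?g y) = exp (- s) * norm (g (A' x) - g (A' y))" by (simp add: dA)
      also have "\<dots> \<le> exp (- s) * (M * norm (A' x - A' y))" using lipg by (intro mult_left_mono) auto
      also have "\<dots> = (exp (- s) * exp s) * (M * norm (x - y))" unfolding dA' by simp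
      finally show ?thesis by (simp add: es)
    qed
    fix x assume "?\<psi> x \<noteq> x"
    then have "\<omega> (A' x) \<noteq> A' x" using AA'[of x] by auto
    from moved[OF this] have "?N (A' x - ?c) \<le> 1" using \<eta> by linarith
    then have "norm (A' x - ?c) \<le> K * 1"
      using norm_le_N[of "A' x - ?c"] mult_left_mono[OF _ K] by (meson order_trans)
    then have "exp (- s) * norm (A' x - ?c) \<le> exp (- s) * K" by (intro mult_left_mono) auto
    moreover have "x - ?c = exp (- s) *\<^sub>R (A' x - ?c)" by (simp add: A'_def es)
    then have "norm (x - ?c) = exp (- s) * norm (A' x - ?c)" by (simp only: norm_scaleR abs_exp_cancel)
    ultimately have "norm (x - ?c) < 1 / 128" using sK by linarith
    then show "x \<in> ball ?c (1 / 128)" by (simp add: dist_norm norm_minus_commute)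
  qed (use a M in \<open>simp_all add: A'A AA' chi_g g_chi\<close>)
  have "flowable (1 + 2 + 1) (h (- s) \<circ> (?\<psi> \<circ> h s))"
    by (rule flowable_comp[OF flowable_comp[OF h_flow \<open>flowable 2 ?\<psi>\<close>] h_flow])
  moreover have "1 + 2 + 1 = (4 :: nat)" by simp
  ultimately have "flowable 4 (h (- s) \<circ> (?\<psi> \<circ> h s))" by (simp only:)
  moreover have "h (- s) \<circ> (?\<psi> \<circ> h s) = \<omega>"
  proof
    fix x
    show "(h (- s) \<circ> (?\<psi> \<circ> h s)) x = \<omega> x"
    proof (cases "\<omega> x = x")
      case False
      then have "\<omega> (\<omega> x) \<noteq> \<omega> x" using g_chi by metis
      then have 1: "h s (\<omega> x) = A (\<omega> x)" by (intro h_A moved)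
      have "?\<psi> (h s x) = h s (\<omega> x)" using h_A[OF moved[OF False]] by (simp add: A'A 1)
      then show ?thesis using h_inv by simp
    next
      case True
      \<comment> \<open>Off the support \<open>h s\<close> may differ from \<open>A\<close>. But a
        point moved by \<open>?\<psi>\<close> is \<open>A z\<close> with \<open>z\<close> moved by
        \<omega>, and there \<open>h s z = A z\<close>; if \<open>h s x\<close> were moved,
        injectivity would give \<open>x = z\<close>.\<close>
      have "?\<psi> (h s x) = h s x"
      proof (rule ccontr)
        assume *: "?\<psi> (h s x) \<noteq> h s x"
        then have m: "\<omega> (A' (h s x)) \<noteq> A' (h s x)" using AA'[of "h s x"] by auto
        then have "h s (A' (h s x)) = h s x" using h_A[OF moved] AA' by simp
        then have "A' (h s x) = x" using h_inv by metis
        then show False using m True by simp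
      qed
      then show ?thesis using h_inv True by simp
    qed
  qed
  ultimately show ?thesis by simp
qed

section \<open>Splitting off the boundary part of a given diffeomorphism\<close>

lemma depth_bounded: obtains B where "0 \<le> B" "\<And>x :: real^'n. depth x \<le> B"
proof -
  obtain B where B: "\<And>x :: real^'n. x \<in> unit_cube \<Longrightarrow> norm x \<le> B"
    using bounded_cbox[of "0 :: real^'n" One] unfolding bounded_iff unit_cube_def by blast
  have 0: "(0 :: real^'n) \<in> unit_cube" "(0 :: real^'n) \<in> cube_exterior"
  proof -
    obtain b :: "real^'n" where "b \<in> Basis" using nonempty_Basis by blast
    then show "(0 :: real^'n) \<in> cube_exterior" unfolding cube_exterior_def by (force simp: mem_box)
  qed (simp add: unit_cube_def mem_box)
  have "0 \<le> B" using B[OF 0(1)] by simp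
  moreover have "depth x \<le> B" for x :: "real^'n"
  proof (cases "x \<in> unit_cube")
    case True
    have "depth x \<le> dist x 0" unfolding depth_def by (rule infdist_le[OF 0(2)])
    then show ?thesis using B[OF True] by simp
  next
    case False
    then have "depth x \<le> 0" using depth_pos_imp_in_cube not_le by blast
    then show ?thesis using \<open>0 \<le> B\<close> by linarith
  qed
  ultimately show thesis using that by blast
qed

lemma inverse_lipschitz:
  fixes \<phi> :: "real^'n \<Rightarrow> real^'n"
  assumes "bij \<phi>" "Ck (Suc 0) (inv \<phi>)" "\<And>x. x \<notin> unit_cube \<Longrightarrow> \<phi> x = x"
  shows "\<exists>L\<ge>0. \<forall>x y. norm (inv \<phi> x - inv \<phi> y) \<le> L * norm (x - y)"
proof -
  note d = Ck_1_D[OF assms(2)]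
  have "((\<lambda>x. inv \<phi> x - x) has_derivative (\<lambda>h. frechet_derivative (inv \<phi>) (at x) h - h)) (at x)" for x
    by (intro has_derivative_diff d(1) has_derivative_ident)
  moreover have "continuous_on UNIV (\<lambda>x. frechet_derivative (inv \<phi>) (at x) h - h)" for h
    by (intro continuous_on_diff d(2) continuous_on_const)
  moreover have "inv \<phi> x - x = 0" if "x \<notin> unit_cube" for x
    using assms(1) assms(3)[OF that] by (metis bij_is_inj inv_f_f right_minus_eq)
  ultimately have "\<exists>L\<ge>0. \<forall>x y. norm ((inv \<phi> x - x) - (inv \<phi> y - y)) \<le> L * norm (x - y)"
    by (rule compactly_supported_C1_lipschitz)
  then obtain L where L: "0 \<le> L" "\<And>x y. norm ((inv \<phi> x - x) - (inv \<phi> y - y)) \<le> L * norm (x - y)"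
    by blast
  have "norm (inv \<phi> x - inv \<phi> y) \<le> (L + 1) * norm (x - y)" for x y
  proof -
    have "inv \<phi> x - inv \<phi> y = ((inv \<phi> x - x) - (inv \<phi> y - y)) + (x - y)" by simp
    then have "norm (inv \<phi> x - inv \<phi> y) \<le> norm ((inv \<phi> x - x) - (inv \<phi> y - y)) + norm (x - y)"
      by (metis norm_triangle_ineq)
    then show ?thesis using L(2)[of x y] by (simp add: distrib_right)
  qed
  then show ?thesis using L(1) by (intro exI[of _ "L + 1"]) simp
qed

lemma norm_le_depth:
  fixes v :: "real^'n \<Rightarrow> real^'n"
  assumes "\<And>x y. norm (v x - v y) \<le> 1 / 8 * norm (x - y)" "\<And>x. x \<in> cube_exterior \<Longrightarrow> v x = 0"
  shows "norm (v x) \<le> 1 / 8 * depth x"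
proof -
  have "8 * norm (v x) \<le> dist x y" if "y \<in> cube_exterior" for y
    using assms(1)[of x y] assms(2)[OF that] by (simp add: dist_norm)
  then have "8 * norm (v x) \<le> depth x"
    unfolding depth_def infdist_notempty[OF cube_exterior_nonempty] by (intro cINF_greatest cube_exterior_nonempty)
  then show ?thesis by simp
qed

text \<open>\<phi> is \<open>\<phi> \<circ> g\<close> after \<open>id + v\<close>, with
  \<open>g\<close> the inverse of \<open>id + v\<close>. As \<open>v\<close> equals \<phi> - id at
  depth below \<kappa>, the first of these maps fixes points near the boundary and takes 4 flows;
  the second takes two per color.\<close>

lemma Diff0_flowable:
  fixes \<phi> :: "real^'n \<Rightarrow> real^'n" and c :: "nat \<Rightarrow> 'n cell"
  assumes \<phi>: "\<phi> \<in> Diff0" and c: "c ` {..<m} = colors"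
  shows "flowable (2 * m + 4) \<phi>"
proof -
  have D0: "bij \<phi> \<and> (\<forall>k. Ck k \<phi>) \<and> (\<forall>k. Ck k (inv \<phi>)) \<and>
      (\<forall>x. det (matrix (frechet_derivative \<phi> (at x))) > 0) \<and> (\<forall>x. x \<notin> unit_cube \<longrightarrow> \<phi> x = x)"
    using \<phi> unfolding Diff0_def smooth_def mem_Collect_eq .
  then have bij: "bij \<phi>" by (rule conjunct1)
  have C2: "Ck (Suc (Suc 0)) \<phi>" using D0 by (elim conjE) (rule spec)
  have C1: "Ck (Suc 0) (inv \<phi>)" using D0 by (elim conjE) (rule spec)
  have "\<forall>x. x \<notin> unit_cube \<longrightarrow> \<phi> x = x" using D0 by (elim conjE)
  then have out: "\<phi> x = x" if "x \<notin> unit_cube" for x using that by blast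
  have inv1: "\<phi> (inv \<phi> x) = x" and inv2: "inv \<phi> (\<phi> x) = x" for x
    using surj_f_inv_f[OF bij_is_surj[OF bij]] inv_f_f[OF bij_is_inj[OF bij]] by this+
  obtain L where L: "0 \<le> L" "\<And>x y. norm (inv \<phi> x - inv \<phi> y) \<le> L * norm (x - y)"
    using inverse_lipschitz[OF bij C1 out] by blast
  obtain a D where a: "0 \<le> a" and flat: "flat_on cube_exterior a (\<lambda>x. \<phi> x - x) D"
    by (rule smooth_minus_id_flat[OF C2 out])
  obtain B where B: "0 \<le> B" "\<And>x :: real^'n. depth x \<le> B" by (rule depth_bounded) blast
  obtain v D' b \<kappa> where nb: "flowable (2 * m) (\<lambda>x. x + v x) \<and> lip_deriv b v D' \<and> 0 \<le> b \<and>
      (\<forall>x h. norm (D' x h) \<le> 1 / 8 * norm h) \<and> 0 < \<kappa> \<and> (\<forall>x. depth x < \<kappa> \<longrightarrow> v x = \<phi> x - x) \<and> (\<forall>x\<in>cube_exterior. v x = 0)"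
    using near_boundary_flowable[OF flat a c] by (elim exE) (rule that)
  then have fl: "flowable (2 * m) (\<lambda>x. x + v x)" and ld: "lip_deriv b v D'" and b: "0 \<le> b" and \<kappa>0: "0 < \<kappa>"
    by - (elim conjE, assumption)+
  have D': "norm (D' x h) \<le> 1 / 8 * norm h" for x h using nb by (elim conjE) (elim allE)
  have "\<forall>x. depth x < \<kappa> \<longrightarrow> v x = \<phi> x - x" using nb by (elim conjE)
  then have \<kappa>: "v x = \<phi> x - x" if "depth x < \<kappa>" for x using that by blast
  have v_out: "v x = 0" if "x \<in> cube_exterior" for x using nb that by (elim conjE) (erule bspec)
  have vl: "norm (v x - v y) \<le> 1 / 8 * norm (x - y)" for x y
    using ld by (intro lipschitz_of_derivative_bound[OF convex_UNIV _ D']) (auto simp: lip_deriv_def)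
  obtain g where g: "\<And>x. g x + v (g x) = x" "\<And>x. g (x + v x) = x"
    "\<And>x y. norm (g x - g y) \<le> 8 / 7 * norm (x - y)" by (rule near_id_inverse[OF vl]) blast
  obtain Dg where Dg: "lip_deriv (8 * b) g Dg" "\<And>x h. norm (Dg x h) \<le> 2 * norm h"
    by (rule lip_deriv_near_id_inverse[OF ld b D' g(1) g(3)]) blast
  have ld\<phi>: "lip_deriv a \<phi> (\<lambda>x h. h + D x h)"
    using lip_deriv_add_id[of a "\<lambda>x. \<phi> x - x" D] flat unfolding flat_on_def by simp
  have D\<phi>: "norm (h + D x h) \<le> (1 + a * B) * norm h" for x h
  proof -
    have "norm (D x h) \<le> a * infdist x cube_exterior * norm h" by (rule flat_on_bounds[OF flat closed_cube_exterior cube_exterior_nonempty a])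
    also have "\<dots> \<le> a * B * norm h" using B(2)[of x] a unfolding depth_def by (intro mult_right_mono mult_left_mono) auto
    finally show ?thesis using norm_triangle_ineq[of h "D x h"] by (simp add: algebra_simps)
  qed
  let ?\<Phi> = "\<lambda>x. x + v x"
  have "flowable 4 (\<phi> \<circ> g)"
  proof (rule flowable_compact_support)
    show "lip_deriv (a * 2 * 2 + (1 + a * B) * (8 * b)) (\<phi> \<circ> g) (\<lambda>x h. Dg x h + D (g x) (Dg x h))"
      by (rule lip_deriv_compose[OF ld\<phi> D\<phi> Dg]) (use a B(1) in simp_all)
    show "0 \<le> a * 2 * 2 + (1 + a * B) * (8 * b)" using a b B(1) by (intro add_nonneg_nonneg mult_nonneg_nonneg) simp_all
    show "(\<phi> \<circ> g) ((?\<Phi> \<circ> inv \<phi>) x) = x" for x by (simp only: o_apply g(2) inv1)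
    show "(?\<Phi> \<circ> inv \<phi>) ((\<phi> \<circ> g) x) = x" for x by (simp only: o_apply inv2 g(1))
    show "norm ((?\<Phi> \<circ> inv \<phi>) x - (?\<Phi> \<circ> inv \<phi>) y) \<le> (9 / 8 * L) * norm (x - y)" for x y
    proof -
      let ?x = "inv \<phi> x" and ?y = "inv \<phi> y"
      have "norm ((?\<Phi> \<circ> inv \<phi>) x - (?\<Phi> \<circ> inv \<phi>) y) \<le> norm (?x - ?y) + norm (v ?x - v ?y)"
        unfolding o_apply by (rule norm_diff_triangle_ineq)
      also have "\<dots> \<le> L * norm (x - y) + 1 / 8 * (L * norm (x - y))"
        using vl[of ?x ?y] L(2)[of x y] by linarith
      also have "\<dots> = (9 / 8 * L) * norm (x - y)" by (simp add: algebra_simps)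
      finally show ?thesis .
    qed
    show "0 \<le> 9 / 8 * L" using L(1) by simp
    show "0 < 7 / 8 * \<kappa>" using \<kappa>0 by simp
    fix x assume moved: "(\<phi> \<circ> g) x \<noteq> x"
    have "\<kappa> \<le> depth (g x)"
    proof (rule ccontr)
      assume "\<not> \<kappa> \<le> depth (g x)"
      then have "v (g x) = \<phi> (g x) - g x" by (intro \<kappa>) simp
      then have "\<phi> (g x) = x" using g(1)[of x] by simp
      then show False using moved by simp
    qed
    \<comment> \<open>\<open>g\<close> moves \<open>x\<close> by \<open>norm (v (g x))\<close>, at
      most an eighth of the depth of \<open>g x\<close>; hence the 7/8 in the support bound.\<close>
    moreover have "depth (g x) \<le> depth x + 1 / 8 * depth (g x)"
    proof -
      have "dist (g x) x = norm (v (g x))" using g(1)[of x] by (metis add_diff_cancel_left' dist_norm norm_minus_commute)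
      then show ?thesis using norm_le_depth[OF vl v_out, of "g x"] depth_lipschitz[of "g x" x] by linarith
    qed
    ultimately show "7 / 8 * \<kappa> \<le> depth x" by linarith
  qed
  from flowable_comp[OF fl this] show ?thesis by (simp add: o_def g(2))
qed

theorem theorem10:
  "\<exists>Td::nat. Td > 0 \<and>
     (\<forall>\<phi> \<in> (Diff0 :: (real^'n \<Rightarrow> real^'n) set).
        \<exists>Vs. length Vs \<le> Td \<and> (\<forall>V \<in> set Vs. \<exists>k. V \<in> VF k) \<and> \<phi> = flow_comp Vs)"
proof -
  \<comment> \<open>The enumeration of the colors, and with it the number of flows, is fixed before
    \<phi> and depends on the dimension only.\<close>
  obtain m and c :: "nat \<Rightarrow> 'n cell" where "colors = c ` {i. i < m}"
    using finite_imp_nat_seg_image_inj_on[OF finite_colors] by blast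
  then have c: "c ` {..<m} = colors" by (simp add: lessThan_def)
  show ?thesis
  proof (intro exI[of _ "2 * m + 4"] conjI ballI)
    fix \<phi> :: "real^'n \<Rightarrow> real^'n" assume "\<phi> \<in> Diff0"
    from Diff0_flowable[OF this c] show "\<exists>Vs. length Vs \<le> 2 * m + 4 \<and> (\<forall>V\<in>set Vs. \<exists>k. V \<in> VF k) \<and> \<phi> = flow_comp Vs"
      unfolding flowable_def by blast
  qed simp
qed

end
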